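(* Suppose the constants $a,r$ in the prior satisfy $a>r\max\{1+\lambda,1,-\lambda\}$, and define \[ \rho_0=\frac{a+1}{a-r\max\{1+\lambda,1,-\lambda\}}>1 . \] Under Assumptions (A1)–(A3), for any $\rho>\rho_0$, letting $U_n=\{\beta\in\mathbb R^p:|S_\beta|\ge\rho s^\star\}$, we have $\sup_{\beta^\star}\mathsf E_{\beta^\star}\{\Pi^n(U_n)\}\to0$ as $n\to\infty$, where the supremum is over all $s^\star$-sparse $\beta^\star$ (satisfying (A2)).
   Context: Model: for each $n$, $Y=X\beta^\star+\varepsilon$ with $Y\in\mathbb R^n$, fixed design $X\in\mathbb R^{n\times p}$, true coefficient $\beta^\star\in\mathbb R^p$, $\varepsilon\sim\mathsf N_n(0,\sigma^2I_n)$ with $\sigma^2>0$ known; $\mathsf E_{\beta^\star},\mathsf P_{\beta^\star}$ refer to this distribution of $Y$. Asymptotics are in a triangular-array sense: $p=p_n$, $s^\star=s^\star_n$ and $R=R_n=\mathrm{rank}(X)$ may depend on $n$, with $s^\star\le R\le n\ll p$; $\lambda\in\mathbb R$, $g>0$, $\sigma^2$, $\alpha\in(0,1)$ and $a,c,C,r>0$ are fixed constants; $\phi=\phi_n\in(0,1)$. For a configuration $S\subseteq\{1,\dots,p\}$, $X_S$ is the submatrix of columns in $S$, $s=|S|$, $D(S)=\det(X_S^\top X_S)$, $\kappa(S)$ is the condition number of $X_S^\top X_S$ (equivalently of $n^{-1}X_S^\top X_S$), $\hat\beta_S=(X_S^\top X_S)^{-1}X_S^\top Y$, and $k_S=\mathrm{tr}\{(X_S^\top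 X_S)^{-1}\}/\mathrm{tr}\{(X_S^\top X_S)^{\lambda}\}$. For $\beta\in\mathbb R^p$, $S_\beta$ is its support; $S^\star=S_{\beta^\star}$, $s^\star=|S^\star|$, and $\beta^\star_{S^\star}$ is the vector of nonzero entries of $\beta^\star$. For $\beta_S\in\mathbb R^{|S|}$, $\beta_{S+}\in\mathbb R^p$ is obtained by filling zeros in coordinates outside $S$. Prior: $f_n(s)\propto c^{-s}p^{-as}$ for $s=0,1,\dots,R$; $\pi(S)=f_n(|S|)\,\pi(S\mid |S|)$ with $\pi(S\mid|S|=s)=D(S)^{-\lambda/(2s)}1\{\kappa(S)<Cp^r\}\big/\sum_{S':|S'|=s}D(S')^{-\lambda/(2s)}1\{\kappa(S')<Cp^r\}$; given $S$, $\pi(\beta_S\mid S)$ is the density of $\mathsf N\big(\phi\hat\beta_S,\ \sigma^2 g k_S (X_S^\top X_S)^{\lambda}\big)$. Posterior: $L_n(\beta)=(2\pi\sigma^2)^{-n/2}\exp\{-\|Y-X\beta\|^2/(2\sigma^2)\}$ and $R_n(\beta,\beta^\star)=L_n(\beta)/L_n(\beta^\star)$. For measurable $A\subseteq\mathbb R^p$, $N_n(A)=\sum_S\pi(S)\int_{\{\beta_S:\beta_{S+}\in A\}}R_n(\beta_{S+},\beta^\star)^{\alpha}\pi(\beta_S\mid S)\,d\beta_S$, $D_n=N_n(\mathbb R^p)$, and $\Pi^n(A)=N_n(A)/D_n$. Design quantities: $\lambda_{\min}(S),\lambda_{\max}(S)$ are the smallest and largest eigenvalues of $n^{-1}X_S^\top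 X_S$; $\ell(s)=\min_{|S|=s}\lambda_{\min}(S)$, $u(s)=\max_{|S|=s}\lambda_{\max}(S)$, $\omega(s)=\max_{|S|=s}\kappa(S)$. Assumptions: (A1) $s^\star=o(n)$. (A2) $s^\star\{n\|\beta^\star_{S^\star}\|\}^{-1}\to0$ and $1-\phi_n=O(s^\star\{n\|\beta^\star_{S^\star}\|\}^{-1})$. (A3) $0<\liminf_n\ell(s^\star)<\limsup_n u(s^\star)<\infty$. *)

theory Defs
  imports "HOL-Probability.Probability" "HOL-Library.Landau_Symbols"
    "Jordan_Normal_Form.Determinant" "Jordan_Normal_Form.Char_Poly" "Jordan_Normal_Form.DL_Rank"
begin

text \<open>A design matrix for sample size n and p covariates is a function X with X i j the
 (i,j) entry, i < n, j < p. Vectors in R^p are functions nat => real vanishing outside {..<p}.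
 Configurations S are subsets of {..<p}; their columns are ordered increasingly.\<close>

definition sl :: "nat set \<Rightarrow> nat list" where
  "sl S = sorted_list_of_set S"

definition XS :: "nat \<Rightarrow> (nat \<Rightarrow> nat \<Rightarrow> real) \<Rightarrow> nat set \<Rightarrow> real mat" where
  "XS n X S = mat n (card S) (\<lambda>(i,k). X i (sl S ! k))"

definition gram :: "nat \<Rightarrow> (nat \<Rightarrow> nat \<Rightarrow> real) \<Rightarrow> nat set \<Rightarrow> real mat" where
  "gram n X S = transpose_mat (XS n X S) * XS n X S"

definition design_rank :: "nat \<Rightarrow> nat \<Rightarrow> (nat \<Rightarrow> nat \<Rightarrow> real) \<Rightarrow> nat" where
  "design_rank n p X = vec_space.rank n (XS n X {..<p} :: real mat)"

definition mtrace :: "real mat \<Rightarrow> real" where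
  "mtrace M = (\<Sum>i<dim_row M. M $$ (i,i))"

definition minv :: "real mat \<Rightarrow> real mat" where
  "minv M = (SOME B. B \<in> carrier_mat (dim_row M) (dim_row M) \<and>
                     M * B = 1\<^sub>m (dim_row M) \<and> B * M = 1\<^sub>m (dim_row M))"

definition diagm :: "nat \<Rightarrow> (nat \<Rightarrow> real) \<Rightarrow> real mat" where
  "diagm m d = mat m m (\<lambda>(i,j). if i = j then d i else 0)"

definition mat_powr :: "real mat \<Rightarrow> real \<Rightarrow> real mat" where
  "mat_powr M l = (THE B. \<exists>Q d. Q \<in> carrier_mat (dim_row M) (dim_row M) \<and>
        transpose_mat Q * Q = 1\<^sub>m (dim_row M) \<and> (\<forall>i<dim_row M. d i > 0) \<and>
        M = Q * diagm (dim_row M) d * transpose_mat Q \<and>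
        B = Q * diagm (dim_row M) (\<lambda>i. d i powr l) * transpose_mat Q)"

definition lam_min :: "real mat \<Rightarrow> real" where
  "lam_min M = Min {k. eigenvalue M k}"

definition lam_max :: "real mat \<Rightarrow> real" where
  "lam_max M = Max {k. eigenvalue M k}"

definition cond_num :: "nat \<Rightarrow> (nat \<Rightarrow> nat \<Rightarrow> real) \<Rightarrow> nat set \<Rightarrow> ereal" where
  "cond_num n X S = (if S = {} then 1 else
     if lam_min (gram n X S) > 0 then ereal (lam_max (gram n X S) / lam_min (gram n X S)) else \<infinity>)"

definition Dg :: "nat \<Rightarrow> (nat \<Rightarrow> nat \<Rightarrow> real) \<Rightarrow> nat set \<Rightarrow> real" where
  "Dg n X S = det (gram n X S)"

definition kS :: "nat \<Rightarrow> (nat \<Rightarrow> nat \<Rightarrow> real) \<Rightarrow> real \<Rightarrow> nat set \<Rightarrow> real" where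
  "kS n X l S = mtrace (minv (gram n X S)) / mtrace (mat_powr (gram n X S) l)"

definition to_vec :: "nat set \<Rightarrow> (nat \<Rightarrow> real) \<Rightarrow> real vec" where
  "to_vec S b = vec (card S) (\<lambda>k. b (sl S ! k))"

definition beta_hat :: "nat \<Rightarrow> (nat \<Rightarrow> nat \<Rightarrow> real) \<Rightarrow> nat set \<Rightarrow> (nat \<Rightarrow> real) \<Rightarrow> real vec" where
  "beta_hat n X S Y = minv (gram n X S) *\<^sub>v (transpose_mat (XS n X S) *\<^sub>v vec n Y)"

definition gauss_dens :: "nat \<Rightarrow> real vec \<Rightarrow> real mat \<Rightarrow> real vec \<Rightarrow> real" where
  "gauss_dens m mu Sig x = (2 * pi) powr (- real m / 2) * det Sig powr (- 1 / 2) *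
     exp (- scalar_prod (x - mu) (minv Sig *\<^sub>v (x - mu)) / 2)"

definition extend :: "nat set \<Rightarrow> (nat \<Rightarrow> real) \<Rightarrow> (nat \<Rightarrow> real)" where
  "extend S b = (\<lambda>j. if j \<in> S then b j else 0)"

definition supp :: "(nat \<Rightarrow> real) \<Rightarrow> nat set" where
  "supp b = {j. b j \<noteq> 0}"

definition f_size :: "nat \<Rightarrow> nat \<Rightarrow> real \<Rightarrow> real \<Rightarrow> nat \<Rightarrow> real" where
  "f_size p R a c s = (if s \<le> R then
      (c powr (- real s) * real p powr (- a * real s)) /
      (\<Sum>t\<le>R. c powr (- real t) * real p powr (- a * real t)) else 0)"

definition cfg_weight :: "nat \<Rightarrow> nat \<Rightarrow> (nat \<Rightarrow> nat \<Rightarrow> real) \<Rightarrow> real \<Rightarrow> real \<Rightarrow> real \<Rightarrow> nat set \<Rightarrow> real" where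
  "cfg_weight n p X l C r S = Dg n X S powr (- l / (2 * real (card S))) *
      (if cond_num n X S < ereal (C * real p powr r) then 1 else 0)"

definition prior_S :: "nat \<Rightarrow> nat \<Rightarrow> nat \<Rightarrow> (nat \<Rightarrow> nat \<Rightarrow> real) \<Rightarrow> real \<Rightarrow> real \<Rightarrow> real \<Rightarrow> real \<Rightarrow> real \<Rightarrow> nat set \<Rightarrow> real" where
  "prior_S n p R X l a c C r S = f_size p R a c (card S) *
     (cfg_weight n p X l C r S /
      (\<Sum>S'\<in>{S'. S' \<subseteq> {..<p} \<and> card S' = card S}. cfg_weight n p X l C r S'))"

definition prior_beta :: "nat \<Rightarrow> (nat \<Rightarrow> nat \<Rightarrow> real) \<Rightarrow> real \<Rightarrow> real \<Rightarrow> real \<Rightarrow> real \<Rightarrow>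
    (nat \<Rightarrow> real) \<Rightarrow> nat set \<Rightarrow> (nat \<Rightarrow> real) \<Rightarrow> real" where
  "prior_beta n X sigma2 g l phi Y S b =
     gauss_dens (card S) (phi \<cdot>\<^sub>v beta_hat n X S Y)
       ((sigma2 * g * kS n X l S) \<cdot>\<^sub>m mat_powr (gram n X S) l) (to_vec S b)"

definition lik :: "nat \<Rightarrow> nat \<Rightarrow> (nat \<Rightarrow> nat \<Rightarrow> real) \<Rightarrow> real \<Rightarrow> (nat \<Rightarrow> real) \<Rightarrow> (nat \<Rightarrow> real) \<Rightarrow> real" where
  "lik n p X sigma2 Y b = (2 * pi * sigma2) powr (- real n / 2) *
     exp (- (\<Sum>i<n. (Y i - (\<Sum>j<p. X i j * b j))\<^sup>2) / (2 * sigma2))"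

definition post_num :: "nat \<Rightarrow> nat \<Rightarrow> nat \<Rightarrow> (nat \<Rightarrow> nat \<Rightarrow> real) \<Rightarrow> real \<Rightarrow> real \<Rightarrow> real \<Rightarrow> real \<Rightarrow>
    real \<Rightarrow> real \<Rightarrow> real \<Rightarrow> real \<Rightarrow> real \<Rightarrow> (nat \<Rightarrow> real) \<Rightarrow> (nat \<Rightarrow> real) set \<Rightarrow> (nat \<Rightarrow> real) \<Rightarrow> real" where
  "post_num n p R X sigma2 g l alpha a c C r phi bstar A Y =
     (\<Sum>S\<in>{S. S \<subseteq> {..<p} \<and> card S \<le> R}.
        prior_S n p R X l a c C r S *
        (\<integral>b. indicator A (extend S b) *
              (lik n p X sigma2 Y (extend S b) / lik n p X sigma2 Y bstar) powr alpha *
              prior_beta n X sigma2 g l phi Y S b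
          \<partial>(PiM S (\<lambda>_. lborel))))"

definition posterior :: "nat \<Rightarrow> nat \<Rightarrow> nat \<Rightarrow> (nat \<Rightarrow> nat \<Rightarrow> real) \<Rightarrow> real \<Rightarrow> real \<Rightarrow> real \<Rightarrow> real \<Rightarrow>
    real \<Rightarrow> real \<Rightarrow> real \<Rightarrow> real \<Rightarrow> real \<Rightarrow> (nat \<Rightarrow> real) \<Rightarrow> (nat \<Rightarrow> real) set \<Rightarrow> (nat \<Rightarrow> real) \<Rightarrow> real" where
  "posterior n p R X sigma2 g l alpha a c C r phi bstar A Y =
     post_num n p R X sigma2 g l alpha a c C r phi bstar A Y /
     post_num n p R X sigma2 g l alpha a c C r phi bstar UNIV Y"

definition data_measure :: "nat \<Rightarrow> nat \<Rightarrow> (nat \<Rightarrow> nat \<Rightarrow> real) \<Rightarrow> real \<Rightarrow> (nat \<Rightarrow> real) \<Rightarrow> (nat \<Rightarrow> real) measure" where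
  "data_measure n p X sigma2 bstar =
     PiM {..<n} (\<lambda>i. density lborel (normal_density (\<Sum>j<p. X i j * bstar j) (sqrt sigma2)))"

definition ell :: "nat \<Rightarrow> nat \<Rightarrow> (nat \<Rightarrow> nat \<Rightarrow> real) \<Rightarrow> nat \<Rightarrow> real" where
  "ell n p X s = Min ((\<lambda>S. lam_min ((1 / real n) \<cdot>\<^sub>m gram n X S)) ` {S. S \<subseteq> {..<p} \<and> card S = s})"

definition uu :: "nat \<Rightarrow> nat \<Rightarrow> (nat \<Rightarrow> nat \<Rightarrow> real) \<Rightarrow> nat \<Rightarrow> real" where
  "uu n p X s = Max ((\<lambda>S. lam_max ((1 / real n) \<cdot>\<^sub>m gram n X S)) ` {S. S \<subseteq> {..<p} \<and> card S = s})"

end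

theory Submission
  imports Defs
begin

text \<open>
  Let S0 be the true support, s0 its size, and q(S) the squared length of the projection of the
  noise onto the span of the columns in S or S0. Since the residual sum of squares of any
  coefficient vector supported in S is at least that of the truth minus q(S), the fractional
  likelihood ratio is at most exp (alpha q(S) / (2 sigma2)), whatever the data-dependent centre of
  the conditional prior; this bounds the numerator of the posterior. The denominator is at least
  its S0-term. There (A3) makes the prior covariance comparable to the inverse Gram matrix, so that
  the Gaussian integral loses only a factor exponential in s0, while shrinking the centre by phi
  costs (1 - phi)^2 times the squared length of the fitted vector, which by (A2) is O(s0) plus a
  vanishing multiple of q(S). As alpha < 1, the resulting exponential moments of q(S) are finite,
  namely powers of a constant with exponent at most |S| + s0. Since (A3) also bounds the weights of
  all configurations of size s0 against each other, S0 has prior mass at least a constant to the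
  power s0 times f(s0) / p^s0. Summing over configurations leaves p^(s0 - a(|S| - s0)) up to
  constants to the power |S| + s0, which vanishes when |S| >= rho s0 with a rho > a + 1.
\<close>

section \<open>Gaussian integrals of quadratic forms\<close>

text \<open>The centre of the conditional prior depends on Y, so expectation and prior integral
  cannot be exchanged, and numerator and denominator share the same noise. Everything is therefore
  bounded pointwise in Y by one random quantity per configuration. Projecting on the columns of S
  together with those of S0 controls both the likelihood ratio on S and the fitted vector on S0, so
  the random loss in the denominator can be moved into the exponent of each summand of the
  numerator. That exponent becomes alpha (1 + 4 (1 - phi)^2) q(S) / (2 sigma2); the gap between
  alpha and 1 absorbs the correction once phi is close to 1.

  The prior covariance is diagonal in the eigenbasis of the Gram matrix. Carrying an explicit
  eigenbasis turns determinants, traces, inverses and powers into expressions in eigenvalues, and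
  the factor k_S leaves only ratios of eigenvalues, from which n cancels.

  Larger models cost no combinatorial factor, since the prior is normalised within each size. In a
  rho > a + 1 the a is the prior price of the size s0, and the 1 pays for the at most p^s0
  configurations of that size that compete with S0.\<close>

lemma nn_integral_gaussian_shift:
  fixes d c :: real
  assumes "d > 0"
  shows "(\<integral>\<^sup>+ y. ennreal (exp (- (d * (y - c)\<^sup>2) / 2)) \<partial>lborel) = ennreal (sqrt (2 * pi / d))"
proof -
  have s: "1 / sqrt d > 0" using assms by simp
  interpret prob_space "density lborel (normal_density c (1 / sqrt d))"
    by (rule prob_space_normal_density[OF s])
  have "emeasure (density lborel (normal_density c (1 / sqrt d))) UNIV = 1"
    using emeasure_space_1 by simp
  then have one: "(\<integral>\<^sup>+ y. ennreal (normal_density c (1 / sqrt d) y) \<partial>lborel) = 1"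
    by (simp add: emeasure_density)
  have eq: "exp (- (d * (y - c)\<^sup>2) / 2) = sqrt (2 * pi / d) * normal_density c (1 / sqrt d) y" for y
    using assms by (simp add: normal_density_def real_sqrt_divide real_sqrt_mult power_divide field_simps)
  have "(\<integral>\<^sup>+ y. ennreal (exp (- (d * (y - c)\<^sup>2) / 2)) \<partial>lborel)
      = (\<integral>\<^sup>+ y. ennreal (sqrt (2 * pi / d)) * ennreal (normal_density c (1 / sqrt d) y) \<partial>lborel)"
    unfolding eq using assms by (intro nn_integral_cong ennreal_mult) (auto intro: less_imp_le)
  also have "\<dots> = ennreal (sqrt (2 * pi / d))"
    by (subst nn_integral_cmult) (simp_all add: one)
  finally show ?thesis .
qed

definition qform :: "nat \<Rightarrow> (nat \<Rightarrow> nat \<Rightarrow> real) \<Rightarrow> (nat \<Rightarrow> real) \<Rightarrow> real" where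
  "qform k A x = (\<Sum>i<k. \<Sum>j<k. A i j * x i * x j)"

definition posdef :: "nat \<Rightarrow> (nat \<Rightarrow> nat \<Rightarrow> real) \<Rightarrow> bool" where
  "posdef k A \<longleftrightarrow> (\<forall>i<k. \<forall>j<k. A i j = A j i) \<and> (\<forall>x. (\<exists>i<k. x i \<noteq> 0) \<longrightarrow> qform k A x > 0)"

text \<open>The pivot is the last index, so a form of size \<open>Suc k\<close> is reduced to one of
  size \<open>k\<close> on the same indices; this is what the inductions on dimension use.\<close>

definition schur_compl :: "nat \<Rightarrow> (nat \<Rightarrow> nat \<Rightarrow> real) \<Rightarrow> nat \<Rightarrow> nat \<Rightarrow> real" where
  "schur_compl k A = (\<lambda>i j. A i j - A i k * A k j / A k k)"

lemma posdefD:
  assumes "posdef k A" "i < k" "x i \<noteq> 0" shows "qform k A x > 0"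
  using assms unfolding posdef_def by meson

lemma posdef_sym: "posdef k A \<Longrightarrow> \<forall>i<k. \<forall>j<k. A i j = A j i"
  unfolding posdef_def by (rule conjunct1)

lemma qform_cong:
  assumes "\<And>i. i < k \<Longrightarrow> x i = y i" shows "qform k A x = qform k A y"
  unfolding qform_def using assms by (intro sum.cong) auto

text \<open>Completing the square in the last coordinate. The subtracted term is the value of
  \<open>x k\<close> that minimises the form when the other coordinates are fixed.\<close>

lemma qform_Suc:
  assumes sym: "\<forall>i<Suc k. \<forall>j<Suc k. A i j = A j i" and d: "A k k \<noteq> 0"
  shows "qform (Suc k) A x = qform k (schur_compl k A) x
           + A k k * (x k - (- (\<Sum>j<k. A k j * x j) / A k k))\<^sup>2"
proof -
  define b where "b = (\<Sum>j<k. A k j * x j)"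
  have b': "(\<Sum>i<k. A i k * x i) = b"
    unfolding b_def using sym by (intro sum.cong) auto
  have bb: "(\<Sum>i<k. \<Sum>j<k. A i k * A k j / A k k * x i * x j) = b * b / A k k"
  proof -
    have "(\<Sum>i<k. \<Sum>j<k. A i k * A k j / A k k * x i * x j)
        = (\<Sum>i<k. \<Sum>j<k. (A i k * x i) * (A k j * x j)) / A k k"
      by (simp add: sum_divide_distrib field_simps)
    also have "\<dots> = b * b / A k k"
      by (simp add: sum_product[symmetric] b' b_def)
    finally show ?thesis .
  qed
  have "qform (Suc k) A x = (\<Sum>i<k. (\<Sum>j<k. A i j * x i * x j) + A i k * x i * x k)
        + (\<Sum>j<k. A k j * x k * x j) + A k k * x k * x k"
    by (simp add: qform_def)
  also have "\<dots> = (\<Sum>i<k. \<Sum>j<k. A i j * x i * x j) + b * x k + b * x k + A k k * x k * x k"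
  proof -
    have "(\<Sum>i<k. A i k * x i * x k) = b * x k" by (simp add: b'[symmetric] sum_distrib_right)
    moreover have "(\<Sum>j<k. A k j * x k * x j) = b * x k" by (simp add: b_def sum_distrib_left sum_distrib_right mult_ac)
    ultimately show ?thesis by (simp add: sum.distrib)
  qed
  also have "(\<Sum>i<k. \<Sum>j<k. A i j * x i * x j) = qform k (schur_compl k A) x + b * b / A k k"
    unfolding qform_def schur_compl_def bb[symmetric]
    by (simp add: left_diff_distrib sum_subtractf)
  also have "qform k (schur_compl k A) x + b * b / A k k + b * x k + b * x k + A k k * x k * x k
      = qform k (schur_compl k A) x + A k k * (x k - (- b / A k k))\<^sup>2"
    using d by (simp add: field_simps power2_eq_square)
  finally show ?thesis unfolding b_def .
qed

lemma posdef_diag: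
  assumes "posdef (Suc k) A" shows "A k k > 0"
proof -
  have "qform (Suc k) A (\<lambda>i. if i = k then 1 else 0) > 0"
    by (rule posdefD[OF assms, of k]) auto
  also have "qform (Suc k) A (\<lambda>i. if i = k then 1 else 0) = A k k"
    by (simp add: qform_def)
  finally show ?thesis .
qed

lemma posdef_schur_compl:
  assumes "posdef (Suc k) A" shows "posdef k (schur_compl k A)"
  unfolding posdef_def
proof (intro conjI allI impI)
  have d: "A k k > 0" by (rule posdef_diag[OF assms])
  have sym: "\<forall>i<Suc k. \<forall>j<Suc k. A i j = A j i" by (rule posdef_sym[OF assms])
  show "schur_compl k A i j = schur_compl k A j i" if "i < k" "j < k" for i j
    using that sym by (simp add: schur_compl_def)
  fix x :: "nat \<Rightarrow> real" assume x: "\<exists>i<k. x i \<noteq> 0"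
  \<comment> \<open>The last coordinate is set to the minimiser, so that the square in
    \<open>qform_Suc\<close> vanishes and the form of \<open>A\<close> at \<open>y\<close> equals
    that of the Schur complement at \<open>x\<close>.\<close>
  define y where "y = x(k := - (\<Sum>j<k. A k j * x j) / A k k)"
  from x obtain i where "i < k" "x i \<noteq> 0" by blast
  then have "qform (Suc k) A y > 0"
    by (intro posdefD[OF assms, of i]) (simp_all add: y_def)
  moreover have "(\<Sum>j<k. A k j * y j) = (\<Sum>j<k. A k j * x j)"
    by (intro sum.cong) (auto simp: y_def)
  moreover have "qform k (schur_compl k A) y = qform k (schur_compl k A) x"
    by (intro qform_cong) (auto simp: y_def)
  ultimately show "qform k (schur_compl k A) x > 0"
    using qform_Suc[OF sym, of y] d by (simp add: y_def)
qed

text \<open>The matrix factors into a unit upper block triangular one and a lower block triangular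
  one whose diagonal blocks are the Schur complement and the pivot.\<close>

lemma det_schur_compl:
  assumes d: "A k k \<noteq> (0::real)"
  shows "det (mat (Suc k) (Suc k) (\<lambda>(i,j). A i j))
       = A k k * det (mat k k (\<lambda>(i,j). schur_compl k A i j))"
proof -
  let ?S = "mat k k (\<lambda>(i,j). schur_compl k A i j)"
  let ?b = "mat k 1 (\<lambda>(i,j). A i k / A k k)"
  let ?c = "mat 1 k (\<lambda>(i,j). A k j)"
  let ?d = "mat 1 1 (\<lambda>(i,j). A k k)"
  let ?L = "four_block_mat (1\<^sub>m k) ?b (0\<^sub>m 1 k) (1\<^sub>m 1)"
  let ?M = "four_block_mat ?S (0\<^sub>m k 1) ?c ?d"
  have prod: "?L * ?M = four_block_mat (1\<^sub>m k * ?S + ?b * ?c) (1\<^sub>m k * 0\<^sub>m k 1 + ?b * ?d)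
       (0\<^sub>m 1 k * ?S + 1\<^sub>m 1 * ?c) (0\<^sub>m 1 k * 0\<^sub>m k 1 + 1\<^sub>m 1 * ?d)"
    by (rule mult_four_block_mat) auto
  have eq: "mat (Suc k) (Suc k) (\<lambda>(i,j). A i j) = ?L * ?M"
    unfolding prod
  proof (rule eq_matI)
    fix i j
    assume "i < dim_row (four_block_mat (1\<^sub>m k * ?S + ?b * ?c) (1\<^sub>m k * 0\<^sub>m k 1 + ?b * ?d)
       (0\<^sub>m 1 k * ?S + 1\<^sub>m 1 * ?c) (0\<^sub>m 1 k * 0\<^sub>m k 1 + 1\<^sub>m 1 * ?d))"
      "j < dim_col (four_block_mat (1\<^sub>m k * ?S + ?b * ?c) (1\<^sub>m k * 0\<^sub>m k 1 + ?b * ?d)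
       (0\<^sub>m 1 k * ?S + 1\<^sub>m 1 * ?c) (0\<^sub>m 1 k * 0\<^sub>m k 1 + 1\<^sub>m 1 * ?d))"
    then have ij: "i < Suc k" "j < Suc k" by auto
    then consider "i < k" "j < k" | "i = k" "j < k" | "i < k" "j = k" | "i = k" "j = k"
      by linarith
    then show "mat (Suc k) (Suc k) (\<lambda>(i,j). A i j) $$ (i,j) =
      four_block_mat (1\<^sub>m k * ?S + ?b * ?c) (1\<^sub>m k * 0\<^sub>m k 1 + ?b * ?d)
       (0\<^sub>m 1 k * ?S + 1\<^sub>m 1 * ?c) (0\<^sub>m 1 k * 0\<^sub>m k 1 + 1\<^sub>m 1 * ?d) $$ (i,j)"
      by cases (use d in \<open>auto simp: schur_compl_def scalar_prod_def\<close>)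
  qed auto
  have "det ?L = 1"
    by (subst det_four_block_mat_lower_left_zero[where n=k and m=1]) auto
  moreover have "det ?M = det ?S * det ?d"
    by (rule det_four_block_mat_upper_right_zero[where n=k and m=1]) auto
  moreover have "det ?d = A k k"
    by (simp add: det_single)
  moreover have "det (?L * ?M) = det ?L * det ?M"
  proof (rule det_mult)
    show "?L \<in> carrier_mat (k + 1) (k + 1)" by (rule four_block_carrier_mat) auto
    show "?M \<in> carrier_mat (k + 1) (k + 1)" by (rule four_block_carrier_mat) auto
  qed
  ultimately show ?thesis unfolding eq by simp
qed

lemma posdef_det_pos: "posdef k A \<Longrightarrow> det (mat k k (\<lambda>(i,j). A i j)) > 0"
proof (induction k arbitrary: A)
  case 0
  then show ?case by simp
next
  case (Suc k)
  have "A k k > 0" by (rule posdef_diag[OF Suc.prems])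
  then show ?case using Suc.IH[OF posdef_schur_compl[OF Suc.prems]] by (simp add: det_schur_compl)
qed

text \<open>The last coordinate is integrated first. Its conditional centre depends on the other
  coordinates, but the value of the one-dimensional integral does not; what remains is the Gaussian
  integral of the Schur complement, and the determinants multiply.\<close>

lemma nn_integral_gaussian_qform:
  assumes "posdef k A"
  shows "(\<integral>\<^sup>+ x. ennreal (exp (- qform k A (\<lambda>i. x i - mu i) / 2)) \<partial>(PiM {..<k} (\<lambda>_. lborel)))
       = ennreal ((2 * pi) powr (real k / 2) * det (mat k k (\<lambda>(i,j). A i j)) powr (- 1 / 2))"
  using assms
proof (induction k arbitrary: A)
  case 0
  interpret product_sigma_finite "\<lambda>_::nat. lborel :: real measure" ..
  show ?case
    by (simp add: qform_def emeasure_PiM_empty space_PiM_empty)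
next
  case (Suc k)
  interpret product_sigma_finite "\<lambda>_::nat. lborel :: real measure" ..
  have d: "A k k > 0" by (rule posdef_diag[OF Suc.prems])
  have sym: "\<forall>i<Suc k. \<forall>j<Suc k. A i j = A j i" by (rule posdef_sym[OF Suc.prems])
  let ?S = "schur_compl k A"
  have dS: "det (mat k k (\<lambda>(i,j). ?S i j)) > 0"
    by (rule posdef_det_pos[OF posdef_schur_compl[OF Suc.prems]])
  have [measurable]: "(\<lambda>x. qform m B (\<lambda>i. x i - mu i)) \<in> borel_measurable (PiM {..<m} (\<lambda>_. lborel))" for m B
    unfolding qform_def by measurable
  have "(\<integral>\<^sup>+ x. ennreal (exp (- qform (Suc k) A (\<lambda>i. x i - mu i) / 2)) \<partial>(PiM {..<Suc k} (\<lambda>_. lborel)))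
      = (\<integral>\<^sup>+ x. ennreal (exp (- qform (Suc k) A (\<lambda>i. x i - mu i) / 2)) \<partial>(PiM (insert k {..<k}) (\<lambda>_. lborel)))"
    by (simp add: lessThan_Suc)
  also have "\<dots> = (\<integral>\<^sup>+ x. (\<integral>\<^sup>+ y. ennreal (exp (- qform (Suc k) A (\<lambda>i. (x(k := y)) i - mu i) / 2)) \<partial>lborel)
         \<partial>(PiM {..<k} (\<lambda>_. lborel)))"
    by (rule product_nn_integral_insert) (simp_all flip: lessThan_Suc)
  also have "\<dots> = (\<integral>\<^sup>+ x. ennreal (sqrt (2 * pi / A k k)) * ennreal (exp (- qform k ?S (\<lambda>i. x i - mu i) / 2))
         \<partial>(PiM {..<k} (\<lambda>_. lborel)))"
  proof (rule nn_integral_cong)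
    fix x :: "nat \<Rightarrow> real"
    define m where "m = mu k - (\<Sum>j<k. A k j * (x j - mu j)) / A k k"
    have e: "qform (Suc k) A (\<lambda>i. (x(k := y)) i - mu i)
        = qform k ?S (\<lambda>i. x i - mu i) + A k k * (y - m)\<^sup>2" for y
    proof -
      have "(\<Sum>j<k. A k j * ((x(k := y)) j - mu j)) = (\<Sum>j<k. A k j * (x j - mu j))"
        by (intro sum.cong) auto
      moreover have "qform k ?S (\<lambda>i. (x(k := y)) i - mu i) = qform k ?S (\<lambda>i. x i - mu i)"
        by (intro qform_cong) auto
      ultimately show ?thesis
        using qform_Suc[OF sym, of "\<lambda>i. (x(k := y)) i - mu i"] d
        by (simp add: m_def algebra_simps)
    qed
    have "(\<integral>\<^sup>+ y. ennreal (exp (- qform (Suc k) A (\<lambda>i. (x(k := y)) i - mu i) / 2)) \<partial>lborel)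
        = (\<integral>\<^sup>+ y. ennreal (exp (- qform k ?S (\<lambda>i. x i - mu i) / 2)) *
              ennreal (exp (- (A k k * (y - m)\<^sup>2) / 2)) \<partial>lborel)"
      unfolding e by (simp add: ennreal_mult[symmetric] exp_add[symmetric] diff_divide_distrib)
    also have "\<dots> = ennreal (exp (- qform k ?S (\<lambda>i. x i - mu i) / 2)) * ennreal (sqrt (2 * pi / A k k))"
      by (subst nn_integral_cmult) (simp, simp only: nn_integral_gaussian_shift[OF d])
    finally show "(\<integral>\<^sup>+ y. ennreal (exp (- qform (Suc k) A (\<lambda>i. (x(k := y)) i - mu i) / 2)) \<partial>lborel)
        = ennreal (sqrt (2 * pi / A k k)) * ennreal (exp (- qform k ?S (\<lambda>i. x i - mu i) / 2))"
      by (simp add: mult.commute)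
  qed
  also have "\<dots> = ennreal (sqrt (2 * pi / A k k)) *
      ennreal ((2 * pi) powr (real k / 2) * det (mat k k (\<lambda>(i,j). ?S i j)) powr (- 1 / 2))"
    by (subst nn_integral_cmult) (simp, simp only: Suc.IH[OF posdef_schur_compl[OF Suc.prems]])
  also have "\<dots> = ennreal ((2 * pi) powr (real (Suc k) / 2)
      * det (mat (Suc k) (Suc k) (\<lambda>(i,j). A i j)) powr (- 1 / 2))"
  proof -
    have "sqrt (2 * pi / A k k) = (2 * pi) powr (1/2) * A k k powr (- 1 / 2)"
      using d by (simp add: powr_half_sqrt[symmetric] powr_divide powr_minus_divide)
    moreover have "(2 * pi) powr (real (Suc k) / 2) = (2 * pi) powr (1/2) * (2 * pi) powr (real k / 2)"
      by (simp add: powr_add[symmetric] add_divide_distrib)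
    moreover have "(A k k * det (mat k k (\<lambda>(i,j). ?S i j))) powr (- 1 / 2)
        = A k k powr (- 1 / 2) * det (mat k k (\<lambda>(i,j). ?S i j)) powr (- 1 / 2)"
      using d dS by (simp add: powr_mult)
    ultimately show ?thesis
      using d by (simp add: det_schur_compl ennreal_mult[symmetric])
  qed
  finally show ?case .
qed

text \<open>The conditional prior lives on coordinates indexed by the configuration, quadratic forms
  on positions below its cardinality. This passes from one to the other along the enumeration of the
  configuration.\<close>

lemma nn_integral_PiM_reindex:
  fixes f :: "(nat \<Rightarrow> real) \<Rightarrow> ennreal"
  assumes S: "finite (S :: nat set)" and h: "bij_betw h {..<m} S"
    and f: "f \<in> borel_measurable (PiM {..<m} (\<lambda>_. lborel))"
  shows "(\<integral>\<^sup>+ b. f (\<lambda>k\<in>{..<m}. b (h k)) \<partial>(PiM S (\<lambda>_. lborel :: real measure))) = (\<integral>\<^sup>+ x. f x \<partial>(PiM {..<m} (\<lambda>_. lborel)))"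
proof -
  interpret product_sigma_finite "\<lambda>_::nat. lborel :: real measure" ..
  let ?t = "\<lambda>b::nat \<Rightarrow> real. \<lambda>k\<in>{..<m}. b (h k)"
  have hS: "h k \<in> S" if "k < m" for k using h that by (auto simp: bij_betw_def)
  have t: "?t \<in> measurable (PiM S (\<lambda>_. lborel)) (PiM {..<m} (\<lambda>_. lborel))"
    by (rule measurable_restrict) (use hS in \<open>auto intro!: measurable_component_singleton\<close>)
  have "distr (PiM S (\<lambda>_. lborel)) (PiM {..<m} (\<lambda>_. lborel)) ?t = PiM {..<m} (\<lambda>_. lborel)"
  proof (rule PiM_eqI)
    fix A :: "nat \<Rightarrow> real set" assume A: "\<And>i. i \<in> {..<m} \<Longrightarrow> A i \<in> sets lborel"
    define g where "g = the_inv_into {..<m} h"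
    have gh: "g (h k) = k" if "k < m" for k
      using h that unfolding g_def bij_betw_def by (simp add: the_inv_into_f_f)
    have gS: "g j < m \<and> h (g j) = j" if "j \<in> S" for j
      using h that gh unfolding bij_betw_def by auto
    have pre: "?t -` Pi\<^sub>E {..<m} A \<inter> space (PiM S (\<lambda>_. lborel)) = Pi\<^sub>E S (\<lambda>j. A (g j))"
    proof -
      have "(\<forall>k<m. b (h k) \<in> A k) \<longleftrightarrow> (\<forall>j\<in>S. b j \<in> A (g j))" for b :: "nat \<Rightarrow> real"
        using gS hS gh by metis
      note key = this
      show ?thesis
      proof (rule Set.set_eqI)
        fix b :: "nat \<Rightarrow> real"
        show "b \<in> ?t -` Pi\<^sub>E {..<m} A \<inter> space (PiM S (\<lambda>_. lborel)) \<longleftrightarrow> b \<in> Pi\<^sub>E S (\<lambda>j. A (g j))"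
          using key[of b] by (auto simp: space_PiM PiE_iff)
      qed
    qed
    have "emeasure (distr (PiM S (\<lambda>_. lborel)) (PiM {..<m} (\<lambda>_. lborel)) ?t) (Pi\<^sub>E {..<m} A)
        = emeasure (PiM S (\<lambda>_. lborel)) (Pi\<^sub>E S (\<lambda>j. A (g j)))"
      using A by (subst emeasure_distr[OF t]) (auto simp: pre intro!: sets_PiM_I_finite)
    also have "\<dots> = (\<Prod>j\<in>S. emeasure lborel (A (g j)))"
      by (rule emeasure_PiM[OF S]) (use gS A in auto)
    also have "\<dots> = (\<Prod>i<m. emeasure lborel (A i))"
      by (rule prod.reindex_bij_betw[OF h, symmetric, THEN trans]) (simp add: gh)
    finally show "emeasure (distr (PiM S (\<lambda>_. lborel)) (PiM {..<m} (\<lambda>_. lborel)) ?t) (Pi\<^sub>E {..<m} A)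
        = (\<Prod>i<m. emeasure lborel (A i))" .
  qed auto
  then show ?thesis
    using nn_integral_distr[OF t, of f] f by simp
qed

section \<open>The real spectral theorem\<close>

text \<open>The characteristic polynomial has a complex root. For an eigenvector x, the number
  \<open>L\<close>, that is x* A x, equals its own conjugate and also the root times the squared
  norm \<open>N\<close>; so the root is real and is an eigenvalue of the real matrix.\<close>

lemma symmetric_real_mat_eigenvector:
  fixes A :: "real mat"
  assumes A: "A \<in> carrier_mat n n" and n: "n > 0" and sym: "transpose_mat A = A"
  obtains e v where "eigenvector A v e"
proof -
  let ?C = "map_mat complex_of_real A"
  have C: "?C \<in> carrier_mat n n" using A by simp
  obtain as where as: "char_poly ?C = (\<Prod>a\<leftarrow>as. [:- a, 1:])" "length as = n"
    using char_poly_factorized[OF C] by auto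
  then obtain a as' where "as = a # as'" using n by (cases as) auto
  then have root: "poly (char_poly ?C) a = 0" using as by simp
  then obtain v where v: "eigenvector ?C v a"
    using eigenvalue_root_char_poly[OF C] by (auto simp: eigenvalue_def)
  then have vC: "v \<in> carrier_vec n" and v0: "v \<noteq> 0\<^sub>v n" and ev: "?C *\<^sub>v v = a \<cdot>\<^sub>v v"
    using C by (auto simp: eigenvector_def)
  define x where "x i = vec_index v i" for i
  have evx: "(\<Sum>j<n. complex_of_real (A $$ (i,j)) * x j) = a * x i" if "i < n" for i
  proof -
    have "vec_index (?C *\<^sub>v v) i = vec_index (a \<cdot>\<^sub>v v) i" using ev by simp
    then show ?thesis using that A vC
      by (simp add: x_def scalar_prod_def atLeast0LessThan)
  qed
  have symA: "A $$ (i,j) = A $$ (j,i)" if "i < n" "j < n" for i j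
  proof -
    have "transpose_mat A $$ (i,j) = A $$ (j,i)" using that A by simp
    then show ?thesis using sym by simp
  qed
  define N where "N = (\<Sum>i<n. cnj (x i) * x i)"
  have N: "N = complex_of_real (\<Sum>i<n. (cmod (x i))\<^sup>2)"
    unfolding N_def by (simp add: complex_norm_square mult.commute del: of_real_power)
  define L where "L = (\<Sum>i<n. cnj (x i) * (\<Sum>j<n. complex_of_real (A $$ (i,j)) * x j))"
  have L: "L = a * N"
  proof -
    have "L = (\<Sum>i<n. cnj (x i) * (a * x i))"
      unfolding L_def by (intro sum.cong refl) (simp add: evx)
    then show ?thesis by (simp add: N_def sum_distrib_left mult_ac)
  qed
  have "cnj L = (\<Sum>i<n. \<Sum>j<n. x i * (complex_of_real (A $$ (i,j)) * cnj (x j)))"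
    unfolding L_def by (simp add: sum_distrib_left)
  also have "\<dots> = (\<Sum>j<n. \<Sum>i<n. x i * (complex_of_real (A $$ (i,j)) * cnj (x j)))"
    by (rule sum.swap)
  also have "\<dots> = L"
    unfolding L_def sum_distrib_left
    by (intro sum.cong refl) (use symA in \<open>auto simp: mult_ac\<close>)
  finally have "cnj L = L" .
  then have "cnj a * N = a * N" using L N by simp
  moreover have "N \<noteq> 0"
  proof -
    from v0 vC obtain i where i: "i < n" "x i \<noteq> 0"
      unfolding x_def by (metis carrier_vecD eq_vecI index_zero_vec)
    have "(\<Sum>i<n. (cmod (x i))\<^sup>2) > 0"
      by (rule sum_pos2[of _ i]) (use i in auto)
    then show ?thesis unfolding N by (simp only: of_real_eq_0_iff)
  qed
  ultimately have "cnj a = a" by simp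
  then have a: "a = complex_of_real (Re a)"
    by (metis complex_cnj_cancel_iff Reals_cnj_iff of_real_Re)
  have "char_poly ?C = map_poly complex_of_real (char_poly A)"
    by (rule of_real_hom.char_poly_hom[OF A])
  then have "complex_of_real (poly (char_poly A) (Re a)) = 0"
    using root a by (metis of_real_hom.poly_map_poly)
  then have "eigenvalue A (Re a)"
    using eigenvalue_root_char_poly[OF A] by simp
  then show ?thesis using that by (auto simp: eigenvalue_def)
qed

text \<open>The reflection that exchanges \<open>w\<close> with the first unit vector. Being
  symmetric and its own inverse, it is orthogonal, and conjugation by it preserves symmetry.\<close>

lemma householder:
  fixes w :: "nat \<Rightarrow> real"
  assumes w: "(\<Sum>i<n. (w i)\<^sup>2) = 1" and n: "n > 0"
  obtains W where "W \<in> carrier_mat n n" "transpose_mat W = W" "W * W = 1\<^sub>m n"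
    "\<And>i. i < n \<Longrightarrow> W $$ (i,0) = w i"
proof -
  define u where "u i = w i - (if i = 0 then 1 else 0)" for i
  define U where "U = (\<Sum>i<n. (u i)\<^sup>2)"
  \<comment> \<open>If \<open>w\<close> is already the first unit vector, then \<open>U = 0\<close>,
    division by zero yields \<open>k = 0\<close>, and \<open>W\<close> is the identity, as it should
    be.\<close>
  define k where "k = 2 / U"
  define W where "W = mat n n (\<lambda>(i,j). (if i = j then 1 else 0) - k * u i * u j)"
  have U: "U = 2 - 2 * w 0"
  proof -
    have "U = (\<Sum>i<n. (w i)\<^sup>2 + (if i = 0 then 1 - 2 * w 0 else 0))"
      unfolding U_def u_def by (intro sum.cong) (auto simp: power2_eq_square algebra_simps)
    then show ?thesis using w n by (simp add: sum.distrib)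
  qed
  have k: "k * k * U = 2 * k" by (simp add: k_def)
  have carr: "W \<in> carrier_mat n n" by (simp add: W_def)
  have ent: "W $$ (i,j) = (if i = j then 1 else 0) - k * u i * u j" if "i < n" "j < n" for i j
    using that by (simp add: W_def)
  have t: "transpose_mat W = W"
    by (rule eq_matI) (auto simp: W_def)
  have WW: "W * W = 1\<^sub>m n"
  proof (rule eq_matI)
    fix i j assume "i < dim_row (1\<^sub>m n :: real mat)" "j < dim_col (1\<^sub>m n :: real mat)"
    then have ij: "i < n" "j < n" by auto
    have "(W * W) $$ (i,j) = (\<Sum>l<n. W $$ (i,l) * W $$ (l,j))"
      using ij carr by (simp add: scalar_prod_def atLeast0LessThan)
    also have "\<dots> = (\<Sum>l<n. (if l = i then (if i = j then 1 else 0) - k * u i * u j else 0)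
         - (if l = j then k * u i * u j else 0) + k * k * u i * u j * (u l)\<^sup>2)"
      by (intro sum.cong) (use ij in \<open>auto simp: ent power2_eq_square algebra_simps\<close>)
    also have "\<dots> = ((if i = j then 1 else 0) - k * u i * u j) - k * u i * u j + k * k * u i * u j * U"
      using ij by (simp add: sum.distrib sum_subtractf U_def sum_distrib_left)
    also have "\<dots> = (if i = j then 1 else 0) + (k * k * U - 2 * k) * u i * u j"
      by (simp add: algebra_simps)
    finally show "(W * W) $$ (i,j) = 1\<^sub>m n $$ (i,j)" using k ij by simp
  qed (use carr in auto)
  have "W $$ (i,0) = w i" if i: "i < n" for i
  proof (cases "U = 0")
    case True
    then have "\<forall>i\<in>{..<n}. (u i)\<^sup>2 = 0"
      unfolding U_def by (subst (asm) sum_nonneg_eq_0_iff) auto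
    then show ?thesis using i n by (auto simp: ent u_def)
  next
    case False
    have "k * u 0 = -1" using False U n by (simp add: k_def u_def field_simps)
    have "W $$ (i,0) = (if i = 0 then 1 else 0) - (k * u 0) * u i"
      using i n by (simp add: ent mult_ac)
    then show ?thesis unfolding \<open>k * u 0 = -1\<close> by (simp add: u_def)
  qed
  then show ?thesis using that carr t WW by blast
qed

lemma diagm_carrier [simp]: "diagm m d \<in> carrier_mat m m"
  by (simp add: diagm_def)

lemma diagm_dim [simp]: "dim_row (diagm m d) = m" "dim_col (diagm m d) = m"
  by (simp_all add: diagm_def)

lemma transpose_diagm [simp]: "transpose_mat (diagm m d) = diagm m d"
  by (rule eq_matI) (auto simp: diagm_def)

text \<open>Deflation. A reflection \<open>W\<close> whose first column is a normalised eigenvector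
  turns the first column of \<open>W * A * W\<close> into a multiple of the first unit vector; by
  symmetry the first row has the same shape, and the induction hypothesis diagonalises the remaining
  block. The orthogonal factor is \<open>W\<close> times the block extension \<open>B\<close> of the
  smaller one.\<close>

theorem spectral_decomposition:
  fixes A :: "real mat"
  assumes "A \<in> carrier_mat n n" "transpose_mat A = A"
  shows "\<exists>Q d. Q \<in> carrier_mat n n \<and> transpose_mat Q * Q = 1\<^sub>m n \<and> A = Q * diagm n d * transpose_mat Q"
  using assms
proof (induction n arbitrary: A)
  case 0
  then show ?case by (intro exI[of _ "1\<^sub>m 0"] exI[of _ "\<lambda>_. 0"]) auto
next
  case (Suc n)
  note A = Suc.prems(1) and sym = Suc.prems(2)
  obtain e v where v: "eigenvector A v e"
    by (rule symmetric_real_mat_eigenvector[OF A _ sym]) auto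
  then have vC: "v \<in> carrier_vec (Suc n)" and v0: "v \<noteq> 0\<^sub>v (Suc n)" and ev: "A *\<^sub>v v = e \<cdot>\<^sub>v v"
    using A by (auto simp: eigenvector_def)
  define r where "r = sqrt (\<Sum>i<Suc n. (vec_index v i)\<^sup>2)"
  have "(\<Sum>i<Suc n. (vec_index v i)\<^sup>2) > 0"
  proof -
    from v0 vC obtain i where i: "i < Suc n" "vec_index v i \<noteq> 0"
      by (metis carrier_vecD eq_vecI index_zero_vec)
    show ?thesis by (rule sum_pos2[of _ i]) (use i in auto)
  qed
  then have r: "r > 0" "r\<^sup>2 = (\<Sum>i<Suc n. (vec_index v i)\<^sup>2)" by (auto simp: r_def)
  define w where "w i = vec_index v i / r" for i
  have "(\<Sum>i<Suc n. (w i)\<^sup>2) = 1"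
    using r by (simp only: w_def power_divide sum_divide_distrib[symmetric] r(2)[symmetric]) simp
  then obtain W where W: "W \<in> carrier_mat (Suc n) (Suc n)" "transpose_mat W = W" "W * W = 1\<^sub>m (Suc n)"
    and W0: "\<And>i. i < Suc n \<Longrightarrow> W $$ (i,0) = w i"
    by (rule householder) auto
  have colW: "col W 0 = (1/r) \<cdot>\<^sub>v v"
    using W vC by (intro eq_vecI) (auto simp: W0 w_def)
  define A' where "A' = W * A * W"
  have A': "A' \<in> carrier_mat (Suc n) (Suc n)" using W A by (simp add: A'_def)
  have symA': "transpose_mat A' = A'"
    using W A sym unfolding A'_def
    by (simp add: transpose_mult[where n="Suc n" and nr="Suc n" and nc="Suc n"] assoc_mult_mat[where n\<^sub>1="Suc n" and n\<^sub>2="Suc n" and n\<^sub>3="Suc n" and n\<^sub>4="Suc n"])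
  have "A *\<^sub>v col W 0 = e \<cdot>\<^sub>v col W 0"
    using A vC ev by (simp add: colW mult_mat_vec smult_smult_assoc mult.commute)
  then have AW: "col (A * W) 0 = e \<cdot>\<^sub>v col W 0"
    using col_mult2[OF A W(1), of 0] by simp
  have "A' = W * (A * W)" unfolding A'_def using W A by (simp add: assoc_mult_mat[where n\<^sub>1="Suc n" and n\<^sub>2="Suc n" and n\<^sub>3="Suc n" and n\<^sub>4="Suc n"])
  then have "col A' 0 = W *\<^sub>v (e \<cdot>\<^sub>v col W 0)"
    using A W AW by (simp add: col_mult2[where nr="Suc n" and n="Suc n" and nc="Suc n"])
  also have "\<dots> = e \<cdot>\<^sub>v (W *\<^sub>v col W 0)"
    using W by (intro mult_mat_vec[of _ "Suc n" "Suc n"]) (auto intro: col_carrier_vec)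
  also have "W *\<^sub>v col W 0 = col (W * W) 0"
    using W by (subst col_mult2) auto
  also have "\<dots> = unit_vec (Suc n) 0" using W by simp
  finally have c0: "col A' 0 = e \<cdot>\<^sub>v unit_vec (Suc n) 0" .
  have ci: "A' $$ (i,0) = (if i = 0 then e else 0)" if "i < Suc n" for i
  proof -
    have "A' $$ (i,0) = vec_index (col A' 0) i" using A' that by simp
    then show ?thesis using that by (simp add: c0)
  qed
  have symAe: "A' $$ (i,j) = A' $$ (j,i)" if "i < Suc n" "j < Suc n" for i j
  proof -
    have "transpose_mat A' $$ (i,j) = A' $$ (j,i)" using that A' by simp
    then show ?thesis using symA' by simp
  qed
  have ri: "A' $$ (0,i) = (if i = 0 then e else 0)" if "i < Suc n" for i
    using ci[OF that] symAe[OF _ that, of 0] by simp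
  define A3 where "A3 = mat n n (\<lambda>(i,j). A' $$ (Suc i, Suc j))"
  have "A3 \<in> carrier_mat n n" "transpose_mat A3 = A3"
    by (auto simp: A3_def intro!: eq_matI symAe)
  from Suc.IH[OF this] obtain Q3 d3 where Q3: "Q3 \<in> carrier_mat n n" "transpose_mat Q3 * Q3 = 1\<^sub>m n"
    and A3: "A3 = Q3 * diagm n d3 * transpose_mat Q3" by blast
  define B where "B = four_block_mat (1\<^sub>m 1) (0\<^sub>m 1 n) (0\<^sub>m n 1) Q3"
  define d where "d = case_nat e d3"
  have D: "diagm (Suc n) d = four_block_mat (mat 1 1 (\<lambda>_. e)) (0\<^sub>m 1 n) (0\<^sub>m n 1) (diagm n d3)"
    by (rule eq_matI) (auto simp: diagm_def d_def split: nat.splits)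
  have B: "B \<in> carrier_mat (Suc n) (Suc n)"
    unfolding B_def using four_block_carrier_mat[of "1\<^sub>m 1" 1 1 Q3 n n] Q3 by simp
  have tB: "transpose_mat B = four_block_mat (1\<^sub>m 1) (0\<^sub>m 1 n) (0\<^sub>m n 1) (transpose_mat Q3)"
    unfolding B_def by (subst transpose_four_block_mat) (use Q3 in auto)
  have "transpose_mat B * B = four_block_mat (1\<^sub>m 1) (0\<^sub>m 1 n) (0\<^sub>m n 1) (1\<^sub>m n)"
    unfolding tB unfolding B_def
    by (subst mult_four_block_mat[where ?nr1.0=1 and ?n1.0=1 and ?n2.0=n and ?nr2.0=n and ?nc1.0=1 and ?nc2.0=n]) (use Q3 in auto)
  also have "\<dots> = 1\<^sub>m (Suc n)"
    by (rule eq_matI) auto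
  finally have BB: "transpose_mat B * B = 1\<^sub>m (Suc n)" .
  have "B * diagm (Suc n) d = four_block_mat (mat 1 1 (\<lambda>_. e)) (0\<^sub>m 1 n) (0\<^sub>m n 1) (Q3 * diagm n d3)"
    unfolding D unfolding B_def
    by (subst mult_four_block_mat[where ?nr1.0=1 and ?n1.0=1 and ?n2.0=n and ?nr2.0=n and ?nc1.0=1 and ?nc2.0=n]) (use Q3 in \<open>auto simp: diagm_def\<close>)
  then have "B * diagm (Suc n) d * transpose_mat B
      = four_block_mat (mat 1 1 (\<lambda>_. e)) (0\<^sub>m 1 n) (0\<^sub>m n 1) A3"
    unfolding tB A3
    by (simp, subst mult_four_block_mat[where ?nr1.0=1 and ?n1.0=1 and ?n2.0=n and ?nr2.0=n and ?nc1.0=1 and ?nc2.0=n]) (use Q3 in auto)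
  also have "\<dots> = A'"
    by (rule eq_matI) (use A' ci ri in \<open>auto simp: A3_def\<close>)
  finally have BDB: "B * diagm (Suc n) d * transpose_mat B = A'" .
  define Q where "Q = W * B"
  have Q: "Q \<in> carrier_mat (Suc n) (Suc n)" using W B by (simp add: Q_def)
  note assoc = assoc_mult_mat[where n\<^sub>1="Suc n" and n\<^sub>2="Suc n" and n\<^sub>3="Suc n" and n\<^sub>4="Suc n"] mult_carrier_mat[of _ "Suc n" "Suc n" _ "Suc n"]
  have tQ: "transpose_mat Q = transpose_mat B * W"
    unfolding Q_def using W B transpose_mult[of W "Suc n" "Suc n" B "Suc n"] by simp
  have "transpose_mat Q * Q = transpose_mat B * (W * W) * B"
    unfolding tQ unfolding Q_def using W(1) B by (simp add: assoc)
  also have "\<dots> = 1\<^sub>m (Suc n)" using W B BB by simp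
  finally have QQ: "transpose_mat Q * Q = 1\<^sub>m (Suc n)" .
  have "Q * diagm (Suc n) d * transpose_mat Q = W * (B * diagm (Suc n) d * transpose_mat B) * W"
    unfolding tQ unfolding Q_def using W(1) B by (simp add: assoc)
  also have "\<dots> = W * W * A * (W * W)"
    unfolding BDB unfolding A'_def using W(1) A by (simp add: assoc)
  also have "\<dots> = A" using W A by simp
  finally show ?case using Q QQ by metis
qed

section \<open>Functions of symmetric matrices\<close>

text \<open>The eigenvalues carry neither an order nor a sign condition. Functions of
  \<open>M\<close> are expressed by changing \<open>d\<close> while \<open>Q\<close> stays
  fixed.\<close>

definition spectral_form :: "nat \<Rightarrow> real mat \<Rightarrow> real mat \<Rightarrow> (nat \<Rightarrow> real) \<Rightarrow> bool" where
  "spectral_form m M Q d \<longleftrightarrow> Q \<in> carrier_mat m m \<and> transpose_mat Q * Q = 1\<^sub>m m \<and>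
     M = Q * diagm m d * transpose_mat Q"

lemma spectral_form_carrier:
  assumes "spectral_form m M Q d"
  shows "Q \<in> carrier_mat m m" "M \<in> carrier_mat m m" "dim_row M = m" "dim_col M = m"
  using assms by (auto simp: spectral_form_def)

lemma spectral_form_orth:
  assumes "spectral_form m M Q d"
  shows "transpose_mat Q * Q = 1\<^sub>m m" "Q * transpose_mat Q = 1\<^sub>m m"
proof -
  show "transpose_mat Q * Q = 1\<^sub>m m" using assms by (auto simp: spectral_form_def)
  then show "Q * transpose_mat Q = 1\<^sub>m m"
    using mat_mult_left_right_inverse[of "transpose_mat Q" m Q] spectral_form_carrier(1)[OF assms] by simp
qed

lemma spectral_form_cancel:
  assumes "spectral_form m M Q d" "B \<in> carrier_mat m m"
  shows "transpose_mat Q * (Q * B) = B" "Q * (transpose_mat Q * B) = B"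
  using spectral_form_orth[OF assms(1)] spectral_form_carrier(1)[OF assms(1)] assms(2)
    assoc_mult_mat[of "transpose_mat Q" m m Q m B m] assoc_mult_mat[of Q m m "transpose_mat Q" m B m]
  by auto

lemma spectral_form_change:
  assumes "spectral_form m M Q d"
  shows "spectral_form m (Q * diagm m e * transpose_mat Q) Q e"
  using assms by (auto simp: spectral_form_def)

lemma spectral_form_entry:
  assumes "spectral_form m M Q d" "i < m" "j < m"
  shows "M $$ (i,j) = (\<Sum>a<m. d a * Q $$ (i,a) * Q $$ (j,a))"
proof -
  have Q: "Q \<in> carrier_mat m m" and M: "M = Q * diagm m d * transpose_mat Q"
    using assms by (auto simp: spectral_form_def)
  have QD: "(Q * diagm m d) $$ (i,a) = Q $$ (i,a) * d a" if "a < m" for a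
  proof -
    have "(Q * diagm m d) $$ (i,a) = (\<Sum>b<m. Q $$ (i,b) * diagm m d $$ (b,a))"
      using Q that assms by (simp add: scalar_prod_def atLeast0LessThan)
    also have "\<dots> = (\<Sum>b<m. if b = a then Q $$ (i,a) * d a else 0)"
      using that by (intro sum.cong) (auto simp: diagm_def)
    finally show ?thesis using that by simp
  qed
  have "M $$ (i,j) = (\<Sum>a<m. (Q * diagm m d) $$ (i,a) * Q $$ (j,a))"
    unfolding M using Q assms by (simp add: scalar_prod_def atLeast0LessThan)
  also have "\<dots> = (\<Sum>a<m. d a * Q $$ (i,a) * Q $$ (j,a))"
    by (intro sum.cong) (auto simp: QD)
  finally show ?thesis .
qed

lemma spectral_form_orth_cols:
  assumes "spectral_form m M Q d" "a < m" "b < m"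
  shows "(\<Sum>i<m. Q $$ (i,a) * Q $$ (i,b)) = (if a = b then 1 else 0)"
proof -
  have "(transpose_mat Q * Q) $$ (a,b) = (\<Sum>i<m. Q $$ (i,a) * Q $$ (i,b))"
    using spectral_form_carrier(1)[OF assms(1)] assms by (simp add: scalar_prod_def atLeast0LessThan)
  then show ?thesis using assms by (simp add: spectral_form_orth(1)[OF assms(1)])
qed

lemma diagm_mult: "diagm m d * diagm m e = diagm m (\<lambda>i. d i * e i)"
proof (rule eq_matI)
  fix i j assume "i < dim_row (diagm m (\<lambda>i. d i * e i))" "j < dim_col (diagm m (\<lambda>i. d i * e i))"
  then have ij: "i < m" "j < m" by auto
  have "(diagm m d * diagm m e) $$ (i,j) = (\<Sum>a<m. diagm m d $$ (i,a) * diagm m e $$ (a,j))"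
    using ij by (simp add: scalar_prod_def atLeast0LessThan)
  also have "\<dots> = (\<Sum>a<m. if a = i then (if i = j then d i * e i else 0) else 0)"
    using ij by (intro sum.cong) (auto simp: diagm_def)
  finally show "(diagm m d * diagm m e) $$ (i,j) = diagm m (\<lambda>i. d i * e i) $$ (i,j)"
    using ij by (simp add: diagm_def)
qed auto

lemma spectral_form_mult:
  assumes M: "spectral_form m M Q d" and N: "spectral_form m N Q e"
  shows "M * N = Q * diagm m (\<lambda>i. d i * e i) * transpose_mat Q"
proof -
  have Q: "Q \<in> carrier_mat m m" using M by (auto simp: spectral_form_def)
  note assoc = assoc_mult_mat[where n\<^sub>1=m and n\<^sub>2=m and n\<^sub>3=m and n\<^sub>4=m] mult_carrier_mat[of _ m m _ m]
  have "M * N = Q * diagm m d * (transpose_mat Q * Q) * diagm m e * transpose_mat Q"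
    using M N Q by (simp add: spectral_form_def assoc spectral_form_cancel[OF M])
  also have "\<dots> = Q * diagm m d * diagm m e * transpose_mat Q"
    using Q by (simp only: spectral_form_orth(1)[OF M]) simp
  also have "\<dots> = Q * (diagm m d * diagm m e) * transpose_mat Q"
    using Q by (simp add: assoc)
  finally show ?thesis by (simp add: diagm_mult)
qed

text \<open>The matrix \<open>W\<close> intertwines the two diagonal matrices, so
  \<open>W $$ (i,j)\<close> can be nonzero only where \<open>d j = d' i\<close>; there
  \<open>f\<close> takes equal values as well, hence \<open>W\<close> intertwines the transformed
  diagonals too. This gives the definite description in \<open>mat_powr\<close> its value.\<close>

lemma spectral_form_unique_fun:
  assumes 1: "spectral_form m M Q d" and 2: "spectral_form m M Q' d'"
  shows "Q * diagm m (\<lambda>i. f (d i)) * transpose_mat Q = Q' * diagm m (\<lambda>i. f (d' i)) * transpose_mat Q'"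
proof -
  have Q: "Q \<in> carrier_mat m m" and Q': "Q' \<in> carrier_mat m m"
    using 1 2 by (auto simp: spectral_form_def)
  note assoc = assoc_mult_mat[where n\<^sub>1=m and n\<^sub>2=m and n\<^sub>3=m and n\<^sub>4=m] mult_carrier_mat[of _ m m _ m]
  define W where "W = transpose_mat Q' * Q"
  have W: "W \<in> carrier_mat m m" using Q Q' by (simp add: W_def)
  have "W * diagm m d = transpose_mat Q' * (Q * diagm m d * (transpose_mat Q * Q))"
    using Q Q' by (simp add: spectral_form_orth(1)[OF 1] W_def assoc)
  also have "\<dots> = transpose_mat Q' * M * Q"
    using 1 Q Q' by (simp add: spectral_form_def assoc)
  also have "\<dots> = (transpose_mat Q' * Q') * diagm m d' * (transpose_mat Q' * Q)"
    using 2 Q Q' by (simp add: spectral_form_def assoc spectral_form_cancel[OF 2])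
  also have "\<dots> = diagm m d' * W"
    using Q Q' by (simp add: spectral_form_orth(1)[OF 2] W_def)
  finally have WD: "W * diagm m d = diagm m d' * W" .
  have l: "(W * diagm m e) $$ (i,j) = W $$ (i,j) * e j" if "i < m" "j < m" for i j e
  proof -
    have "(W * diagm m e) $$ (i,j) = (\<Sum>b<m. W $$ (i,b) * diagm m e $$ (b,j))"
      using W that by (simp add: scalar_prod_def atLeast0LessThan)
    also have "\<dots> = (\<Sum>b<m. if b = j then W $$ (i,j) * e j else 0)"
      using that by (intro sum.cong) (auto simp: diagm_def)
    finally show ?thesis using that by simp
  qed
  have r: "(diagm m e * W) $$ (i,j) = e i * W $$ (i,j)" if "i < m" "j < m" for i j e
  proof -
    have "(diagm m e * W) $$ (i,j) = (\<Sum>b<m. diagm m e $$ (i,b) * W $$ (b,j))"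
      using W that by (simp add: scalar_prod_def atLeast0LessThan)
    also have "\<dots> = (\<Sum>b<m. if b = i then e i * W $$ (i,j) else 0)"
      using that by (intro sum.cong) (auto simp: diagm_def)
    finally show ?thesis using that by simp
  qed
  have WDf: "W * diagm m (\<lambda>i. f (d i)) = diagm m (\<lambda>i. f (d' i)) * W"
  proof (rule eq_matI)
    fix i j assume "i < dim_row (diagm m (\<lambda>i. f (d' i)) * W)" "j < dim_col (diagm m (\<lambda>i. f (d' i)) * W)"
    then have ij: "i < m" "j < m" using W by auto
    have "W $$ (i,j) * d j = d' i * W $$ (i,j)"
      using l[OF ij, of d] r[OF ij, of d'] by (simp only: WD)
    then have "W $$ (i,j) = 0 \<or> d j = d' i" by (simp add: mult.commute[of "d' i"])
    then show "(W * diagm m (\<lambda>i. f (d i))) $$ (i,j) = (diagm m (\<lambda>i. f (d' i)) * W) $$ (i,j)"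
      using l[OF ij] r[OF ij] by auto
  qed (use W in auto)
  have QW: "Q = Q' * W"
    using Q Q' spectral_form_orth(2)[OF 2] by (simp add: W_def assoc(1)[symmetric])
  have "Q * diagm m (\<lambda>i. f (d i)) * transpose_mat Q = Q' * (W * diagm m (\<lambda>i. f (d i))) * transpose_mat Q"
    using Q' W Q by (subst (1) QW) (simp add: assoc)
  also have "\<dots> = Q' * diagm m (\<lambda>i. f (d' i)) * (W * transpose_mat Q)"
    unfolding WDf using Q' W Q by (simp add: assoc)
  also have "W * transpose_mat Q = transpose_mat Q'"
    using Q Q' spectral_form_orth(2)[OF 1] by (simp add: W_def assoc)
  finally show ?thesis .
qed

lemma mat_powr_spectral_form:
  assumes M: "spectral_form m M Q d" and d: "\<And>i. i < m \<Longrightarrow> d i > 0"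
  shows "mat_powr M l = Q * diagm m (\<lambda>i. d i powr l) * transpose_mat Q"
  unfolding mat_powr_def spectral_form_carrier(3)[OF M]
proof (rule the_equality)
  show "\<exists>Q' d'. Q' \<in> carrier_mat m m \<and> transpose_mat Q' * Q' = 1\<^sub>m m \<and> (\<forall>i<m. d' i > 0) \<and>
      M = Q' * diagm m d' * transpose_mat Q' \<and>
      Q * diagm m (\<lambda>i. d i powr l) * transpose_mat Q = Q' * diagm m (\<lambda>i. d' i powr l) * transpose_mat Q'"
    using M d unfolding spectral_form_def by blast
next
  fix B assume "\<exists>Q' d'. Q' \<in> carrier_mat m m \<and> transpose_mat Q' * Q' = 1\<^sub>m m \<and> (\<forall>i<m. d' i > 0) \<and>
      M = Q' * diagm m d' * transpose_mat Q' \<and> B = Q' * diagm m (\<lambda>i. d' i powr l) * transpose_mat Q'"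
  then obtain Q' d' where "spectral_form m M Q' d'"
    and "B = Q' * diagm m (\<lambda>i. d' i powr l) * transpose_mat Q'"
    unfolding spectral_form_def by blast
  then show "B = Q * diagm m (\<lambda>i. d i powr l) * transpose_mat Q"
    using spectral_form_unique_fun[OF M, of Q' d' "\<lambda>x. x powr l"] by simp
qed

text \<open>Two-sided inverses are unique, which determines the choice in
  \<open>minv\<close>.\<close>

lemma minv_eqI:
  assumes A: "A \<in> carrier_mat m m" and B: "B \<in> carrier_mat m m" and AB: "A * B = 1\<^sub>m m"
  shows "minv A = B"
proof -
  have BA: "B * A = 1\<^sub>m m" using mat_mult_left_right_inverse[OF A B AB] .
  have m: "dim_row A = m" using A by simp
  have "minv A \<in> carrier_mat m m \<and> A * minv A = 1\<^sub>m m \<and> minv A * A = 1\<^sub>m m"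
    unfolding minv_def m by (rule someI[of _ B]) (use B AB BA in blast)
  then have C: "minv A \<in> carrier_mat m m" and CA: "minv A * A = 1\<^sub>m m" by auto
  have "minv A = minv A * (A * B)" using C AB by simp
  also have "\<dots> = (minv A * A) * B" using A B C by (simp add: assoc_mult_mat[where n\<^sub>1=m and n\<^sub>2=m and n\<^sub>3=m and n\<^sub>4=m])
  also have "\<dots> = B" using CA B by simp
  finally show ?thesis .
qed

lemma diagm_cong: "(\<And>i. i < m \<Longrightarrow> d i = e i) \<Longrightarrow> diagm m d = diagm m e"
  by (rule eq_matI) (auto simp: diagm_def)

lemma diagm_one: "diagm m (\<lambda>_. 1) = 1\<^sub>m m"
  by (rule eq_matI) (auto simp: diagm_def)

lemma minv_spectral_form:
  assumes M: "spectral_form m M Q d" and d: "\<And>i. i < m \<Longrightarrow> d i \<noteq> 0"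
  shows "minv M = Q * diagm m (\<lambda>i. 1 / d i) * transpose_mat Q"
proof (rule minv_eqI)
  let ?N = "Q * diagm m (\<lambda>i. 1 / d i) * transpose_mat Q"
  have "M * ?N = Q * diagm m (\<lambda>i. d i * (1 / d i)) * transpose_mat Q"
    by (rule spectral_form_mult[OF M spectral_form_change[OF M]])
  also have "diagm m (\<lambda>i. d i * (1 / d i)) = 1\<^sub>m m"
    using d by (subst diagm_one[symmetric], intro diagm_cong) simp
  finally show "M * ?N = 1\<^sub>m m"
    using spectral_form_orth[OF M] spectral_form_carrier[OF M] by simp
qed (use spectral_form_carrier[OF M] in auto)

lemma det_diagm: "det (diagm m d) = (\<Prod>i<m. d i)"
proof -
  have "det (diagm m d) = prod_list (diag_mat (diagm m d))"
    by (rule det_upper_triangular[where n=m]) (auto simp: diagm_def)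
  then show ?thesis
    by (simp add: prod_list_diag_prod atLeast0LessThan) (simp add: diagm_def)
qed

lemma det_spectral_form:
  assumes M: "spectral_form m M Q d" shows "det M = (\<Prod>i<m. d i)"
proof -
  have Q: "Q \<in> carrier_mat m m" and M': "M = Q * diagm m d * transpose_mat Q"
    using M by (auto simp: spectral_form_def)
  have "det Q * det Q = det (transpose_mat Q * Q)"
    using Q by (simp add: det_mult[where n=m] det_transpose)
  also have "\<dots> = 1" by (simp add: spectral_form_orth(1)[OF M])
  finally have "det Q * det Q = 1" .
  moreover have "det M = (det Q * det Q) * det (diagm m d)"
    unfolding M' using Q by (simp add: det_mult[where n=m] det_transpose mult_ac)
  ultimately show ?thesis by (simp add: det_diagm)
qed

lemma mtrace_spectral_form:
  assumes M: "spectral_form m M Q d" shows "mtrace M = (\<Sum>i<m. d i)"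
proof -
  have "mtrace M = (\<Sum>i<m. \<Sum>a<m. d a * Q $$ (i,a) * Q $$ (i,a))"
    unfolding mtrace_def spectral_form_carrier(3)[OF M]
    by (intro sum.cong) (auto simp: spectral_form_entry[OF M])
  also have "\<dots> = (\<Sum>a<m. d a * (\<Sum>i<m. Q $$ (i,a) * Q $$ (i,a)))"
    by (subst sum.swap) (simp add: sum_distrib_left mult.assoc)
  also have "\<dots> = (\<Sum>a<m. d a)"
    by (intro sum.cong) (auto simp: spectral_form_orth_cols[OF M])
  finally show ?thesis .
qed

lemma eigenvalues_spectral_form:
  assumes M: "spectral_form m M Q d" shows "{k. eigenvalue M k} = d ` {..<m}"
proof -
  have Q: "Q \<in> carrier_mat m m" and M': "M = Q * diagm m d * transpose_mat Q"
    using M by (auto simp: spectral_form_def)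
  have "similar_mat M (diagm m d)"
    by (rule similar_matI[of _ _ Q "transpose_mat Q" m])
       (use Q M spectral_form_carrier[OF M] spectral_form_orth[OF M] in \<open>auto simp: spectral_form_def\<close>)
  then have "char_poly M = char_poly (diagm m d)" by (rule char_poly_similar)
  also have "\<dots> = (\<Prod>a\<leftarrow>diag_mat (diagm m d). [:- a, 1:])"
    by (rule char_poly_upper_triangular[of _ m]) (auto simp: diagm_def)
  also have "diag_mat (diagm m d) = map d [0..<m]"
    by (auto simp: diag_mat_def diagm_def)
  finally have cp: "char_poly M = (\<Prod>a\<leftarrow>map d [0..<m]. [:- a, 1:])" .
  have "poly (\<Prod>a\<leftarrow>as. [:- a, 1:]) k = 0 \<longleftrightarrow> k \<in> set as" for as and k :: real
    by (induction as) auto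
  from this[of "map d [0..<m]"] show ?thesis
    unfolding eigenvalue_root_char_poly[OF spectral_form_carrier(2)[OF M]] cp
    by (auto simp del: map_map simp: atLeast0LessThan)
qed

lemma qform_spectral_form:
  assumes M: "spectral_form m M Q d"
  shows "qform m (\<lambda>i j. M $$ (i,j)) x = (\<Sum>a<m. d a * (\<Sum>i<m. Q $$ (i,a) * x i)\<^sup>2)"
proof -
  have "qform m (\<lambda>i j. M $$ (i,j)) x = (\<Sum>i<m. \<Sum>j<m. \<Sum>a<m. d a * ((Q $$ (i,a) * x i) * (Q $$ (j,a) * x j)))"
    unfolding qform_def
    by (intro sum.cong refl) (auto simp: spectral_form_entry[OF M] sum_distrib_left sum_distrib_right mult_ac)
  also have "\<dots> = (\<Sum>i<m. \<Sum>a<m. \<Sum>j<m. d a * ((Q $$ (i,a) * x i) * (Q $$ (j,a) * x j)))"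
    by (intro sum.cong refl sum.swap)
  also have "\<dots> = (\<Sum>a<m. \<Sum>i<m. \<Sum>j<m. d a * ((Q $$ (i,a) * x i) * (Q $$ (j,a) * x j)))"
    by (rule sum.swap)
  also have "\<dots> = (\<Sum>a<m. d a * ((\<Sum>i<m. Q $$ (i,a) * x i) * (\<Sum>j<m. Q $$ (j,a) * x j)))"
    by (intro sum.cong refl) (subst sum_product, simp add: sum_distrib_left)
  finally show ?thesis by (simp add: power2_eq_square)
qed

lemma spectral_form_norm:
  assumes M: "spectral_form m M Q d"
  shows "(\<Sum>a<m. (\<Sum>i<m. Q $$ (i,a) * x i)\<^sup>2) = (\<Sum>i<m. (x i)\<^sup>2)"
proof -
  have "(\<Sum>a<m. (\<Sum>i<m. Q $$ (i,a) * x i)\<^sup>2)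
      = qform m (\<lambda>i j. (Q * diagm m (\<lambda>_. 1) * transpose_mat Q) $$ (i,j)) x"
    by (simp add: qform_spectral_form[OF spectral_form_change[OF M]])
  also have "Q * diagm m (\<lambda>_. 1) * transpose_mat Q = 1\<^sub>m m"
    using spectral_form_orth[OF M] spectral_form_carrier[OF M] by (simp add: diagm_one)
  also have "qform m (\<lambda>i j. (1\<^sub>m m :: real mat) $$ (i,j)) x = (\<Sum>i<m. \<Sum>j<m. if j = i then (x i)\<^sup>2 else 0)"
    unfolding qform_def by (intro sum.cong refl) (auto simp: power2_eq_square)
  finally show ?thesis by simp
qed

lemma posdef_spectral_form:
  assumes M: "spectral_form m M Q d" and d: "\<And>i. i < m \<Longrightarrow> d i > 0"
  shows "posdef m (\<lambda>i j. M $$ (i,j))"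
  unfolding posdef_def
proof (intro conjI allI impI)
  show "M $$ (i,j) = M $$ (j,i)" if "i < m" "j < m" for i j
    using that by (simp add: spectral_form_entry[OF M] mult_ac)
  fix x :: "nat \<Rightarrow> real" assume "\<exists>i<m. x i \<noteq> 0"
  then obtain i where i: "i < m" "x i \<noteq> 0" by blast
  have "(\<Sum>i<m. (x i)\<^sup>2) > 0" by (rule sum_pos2[of _ i]) (use i in auto)
  then have pos: "(\<Sum>a<m. (\<Sum>i<m. Q $$ (i,a) * x i)\<^sup>2) > 0"
    unfolding spectral_form_norm[OF M] .
  have "\<exists>a<m. (\<Sum>i<m. Q $$ (i,a) * x i) \<noteq> 0"
  proof (rule ccontr)
    assume "\<not> ?thesis"
    then have "(\<Sum>a<m. (\<Sum>i<m. Q $$ (i,a) * x i)\<^sup>2) = 0" by (intro sum.neutral) auto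
    then show False using pos by simp
  qed
  then obtain a where a: "a < m" "(\<Sum>i<m. Q $$ (i,a) * x i) \<noteq> 0" by blast
  show "qform m (\<lambda>i j. M $$ (i,j)) x > 0"
    unfolding qform_spectral_form[OF M]
    by (rule sum_pos2[of _ a]) (use a d in \<open>auto simp: less_imp_le\<close>)
qed

lemma mat_of_entries: "M \<in> carrier_mat m m \<Longrightarrow> mat m m (\<lambda>(i,j). M $$ (i,j)) = M"
  by (rule eq_matI) auto

lemma scalar_prod_mult_qform:
  assumes "M \<in> carrier_mat m m" "v \<in> carrier_vec m"
  shows "scalar_prod v (M *\<^sub>v v) = qform m (\<lambda>i j. M $$ (i,j)) (vec_index v)"
  unfolding qform_def using assms
  by (auto simp: scalar_prod_def atLeast0LessThan sum_distrib_left mult_ac intro!: sum.cong)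

lemma sl_bij: "finite S \<Longrightarrow> bij_betw (\<lambda>k. sl S ! k) {..<card S} S"
  unfolding sl_def by (rule bij_betw_nth) auto

lemma to_vec_carrier [simp]: "to_vec S b \<in> carrier_vec (card S)"
  by (simp add: to_vec_def)

lemma smult_spectral_form:
  assumes "spectral_form m M Q d"
  shows "spectral_form m (\<gamma> \<cdot>\<^sub>m M) Q (\<lambda>i. \<gamma> * d i)"
proof -
  have "diagm m (\<lambda>i. \<gamma> * d i) = \<gamma> \<cdot>\<^sub>m diagm m d" by (rule eq_matI) (auto simp: diagm_def)
  then show ?thesis using assms
    by (auto simp: spectral_form_def mult_smult_distrib[where nr=m and n=m and nc=m] mult_smult_assoc_mat[where nr=m and n=m and nc=m])
qed

text \<open>Covariance and \<open>G\<close> share the eigenbasis \<open>Q\<close>, so the product is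
  again an unnormalised Gaussian, with precision matrix \<open>A\<close> of eigenvalues
  \<open>e i\<close>. Its integral is \<open>(det Sig * det A) powr (- 1 / 2)\<close>, and in this
  product the powers \<open>d i powr l\<close> cancel except in the perturbation. The case
  \<open>\<theta> = 0\<close> says that the density has mass one.\<close>

lemma nn_integral_gauss_dens:
  assumes S: "finite S" and G: "spectral_form (card S) G Q d" and d: "\<And>i. i < card S \<Longrightarrow> d i > 0"
    and \<gamma>: "\<gamma> > 0" and \<theta>: "\<theta> \<ge> 0" and mu: "mu \<in> carrier_vec (card S)"
  shows "(\<integral>\<^sup>+ b. ennreal (gauss_dens (card S) mu (\<gamma> \<cdot>\<^sub>m mat_powr G l) (to_vec S b) *
            exp (- \<theta> * qform (card S) (\<lambda>i j. G $$ (i,j)) (vec_index (to_vec S b - mu)))) \<partial>(PiM S (\<lambda>_. lborel)))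
       = ennreal (\<Prod>i<card S. (1 + 2 * \<theta> * \<gamma> * d i powr (l + 1)) powr (- 1 / 2))"
proof -
  define m where "m = card S"
  note G = G[folded m_def] and d = d[folded m_def] and mu = mu[folded m_def]
  define Sig where "Sig = \<gamma> \<cdot>\<^sub>m mat_powr G l"
  define e where "e i = 1 / (\<gamma> * d i powr l) + 2 * \<theta> * d i" for i
  define A where "A = Q * diagm m e * transpose_mat Q"
  have "mat_powr G l = Q * diagm m (\<lambda>i. d i powr l) * transpose_mat Q"
    by (rule mat_powr_spectral_form[OF G]) (rule d)
  then have Sig: "spectral_form m Sig Q (\<lambda>i. \<gamma> * d i powr l)"
    unfolding Sig_def by (simp only:) (intro smult_spectral_form spectral_form_change[OF G])
  have P: "minv Sig = Q * diagm m (\<lambda>i. 1 / (\<gamma> * d i powr l)) * transpose_mat Q"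
    by (rule minv_spectral_form[OF Sig]) (use d \<gamma> in fastforce)
  have Pf: "spectral_form m (minv Sig) Q (\<lambda>i. 1 / (\<gamma> * d i powr l))"
    unfolding P by (rule spectral_form_change[OF G])
  have A: "spectral_form m A Q e" unfolding A_def by (rule spectral_form_change[OF G])
  have e: "e i > 0" if "i < m" for i
    unfolding e_def using d[OF that] \<gamma> \<theta> by (intro add_pos_nonneg) auto
  have pd: "posdef m (\<lambda>i j. A $$ (i,j))"
    by (rule posdef_spectral_form[OF A]) (rule e)
  have qA: "qform m (\<lambda>i j. A $$ (i,j)) x = qform m (\<lambda>i j. minv Sig $$ (i,j)) x + 2 * \<theta> * qform m (\<lambda>i j. G $$ (i,j)) x" for x
    unfolding qform_spectral_form[OF A] qform_spectral_form[OF Pf] qform_spectral_form[OF G] e_def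
    by (simp add: distrib_right sum.distrib sum_distrib_left mult.assoc)
  define K where "K = (2 * pi) powr (- real m / 2) * det Sig powr (- 1 / 2)"
  define f where "f x = ennreal (K * exp (- qform m (\<lambda>i j. A $$ (i,j)) (\<lambda>i. x i - vec_index mu i) / 2))" for x
  have K: "K \<ge> 0" by (simp add: K_def)
  have [measurable]: "(\<lambda>x. qform m B (\<lambda>i. x i - vec_index mu i)) \<in> borel_measurable (PiM {..<m} (\<lambda>_. lborel))" for B
    unfolding qform_def by measurable
  have f[measurable]: "f \<in> borel_measurable (PiM {..<m} (\<lambda>_. lborel))"
    unfolding f_def by measurable
  have eq: "ennreal (gauss_dens m mu Sig (to_vec S b) *
            exp (- \<theta> * qform m (\<lambda>i j. G $$ (i,j)) (vec_index (to_vec S b - mu))))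
       = f (\<lambda>k\<in>{..<m}. b (sl S ! k))" for b
  proof -
    have v: "to_vec S b - mu \<in> carrier_vec m" using mu by (simp add: m_def)
    have x: "vec_index (to_vec S b - mu) i = (\<lambda>k\<in>{..<m}. b (sl S ! k)) i - vec_index mu i" if "i < m" for i
      using that mu by (simp add: m_def to_vec_def)
    have q: "qform m B (vec_index (to_vec S b - mu)) = qform m B (\<lambda>i. (\<lambda>k\<in>{..<m}. b (sl S ! k)) i - vec_index mu i)" for B
      by (rule qform_cong) (rule x)
    have ex: "exp (- x / 2) * exp (- \<theta> * y) = exp (- (x + 2 * \<theta> * y) / 2)" for x y :: real
      by (subst exp_add[symmetric]) (simp add: field_simps)
    show ?thesis
      unfolding gauss_dens_def f_def K_def[symmetric]
        scalar_prod_mult_qform[OF spectral_form_carrier(2)[OF Pf] v] q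
      by (simp only: mult.assoc ex qA)
  qed
  have detSig: "det Sig = (\<Prod>i<m. \<gamma> * d i powr l)" by (rule det_spectral_form[OF Sig])
  have detA: "det A = (\<Prod>i<m. e i)" by (rule det_spectral_form[OF A])
  have "(\<integral>\<^sup>+ b. ennreal (gauss_dens m mu Sig (to_vec S b) *
            exp (- \<theta> * qform m (\<lambda>i j. G $$ (i,j)) (vec_index (to_vec S b - mu)))) \<partial>(PiM S (\<lambda>_. lborel)))
     = (\<integral>\<^sup>+ x. f x \<partial>(PiM {..<m} (\<lambda>_. lborel)))"
    unfolding eq by (rule nn_integral_PiM_reindex[OF S sl_bij[OF S, folded m_def] f])
  also have "\<dots> = ennreal K * (\<integral>\<^sup>+ x. ennreal (exp (- qform m (\<lambda>i j. A $$ (i,j)) (\<lambda>i. x i - vec_index mu i) / 2)) \<partial>(PiM {..<m} (\<lambda>_. lborel)))"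
    unfolding f_def ennreal_mult'[OF K] by (rule nn_integral_cmult) measurable
  also have "\<dots> = ennreal K * ennreal ((2 * pi) powr (real m / 2) * det A powr (- 1 / 2))"
    unfolding nn_integral_gaussian_qform[OF pd] mat_of_entries[OF spectral_form_carrier(2)[OF A]] ..
  also have "\<dots> = ennreal (K * ((2 * pi) powr (real m / 2) * det A powr (- 1 / 2)))"
    by (simp add: ennreal_mult K)
  also have "K * ((2 * pi) powr (real m / 2) * det A powr (- 1 / 2))
      = det Sig powr (- 1 / 2) * det A powr (- 1 / 2)"
  proof -
    have "(2 * pi) powr (- real m / 2) * (2 * pi) powr (real m / 2) = 1"
      by (simp add: powr_add[symmetric])
    then show ?thesis unfolding K_def by (simp add: mult_ac)
  qed
  also have "\<dots> = (det Sig * det A) powr (- 1 / 2)"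
    unfolding detSig detA using e d \<gamma> by (intro powr_mult[symmetric])
  also have "det Sig * det A = (\<Prod>i<m. 1 + 2 * \<theta> * \<gamma> * d i powr (l + 1))"
    unfolding detSig detA prod.distrib[symmetric]
  proof (intro prod.cong refl)
    fix i assume "i \<in> {..<m}"
    then have "d i > 0" using d by simp
    then show "\<gamma> * d i powr l * e i = 1 + 2 * \<theta> * \<gamma> * d i powr (l + 1)"
      unfolding e_def using \<gamma> by (simp add: field_simps powr_add)
  qed
  also have "\<dots> powr (- 1 / 2) = (\<Prod>i<m. (1 + 2 * \<theta> * \<gamma> * d i powr (l + 1)) powr (- 1 / 2))"
    by (rule prod_powr_distrib)
  finally show ?thesis unfolding m_def Sig_def .
qed

section \<open>Exponential moments of projected Gaussian noise\<close>

definition dotp :: "nat \<Rightarrow> (nat \<Rightarrow> real) \<Rightarrow> (nat \<Rightarrow> real) \<Rightarrow> real" where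
  "dotp n x y = (\<Sum>i<n. x i * y i)"

definition orthonormal :: "nat \<Rightarrow> nat \<Rightarrow> (nat \<Rightarrow> nat \<Rightarrow> real) \<Rightarrow> bool" where
  "orthonormal n k u \<longleftrightarrow> (\<forall>a<k. \<forall>b<k. dotp n (u a) (u b) = (if a = b then 1 else 0))"

text \<open>For orthonormal \<open>u\<close> this is the squared length of the orthogonal projection
  of \<open>x\<close> on their span.\<close>

definition proj_sq :: "nat \<Rightarrow> nat \<Rightarrow> (nat \<Rightarrow> nat \<Rightarrow> real) \<Rightarrow> (nat \<Rightarrow> real) \<Rightarrow> real" where
  "proj_sq n k u x = (\<Sum>a<k. (dotp n x (u a))\<^sup>2)"

lemma dotp_commute: "dotp n x y = dotp n y x"
  by (simp add: dotp_def mult.commute)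

lemma dotp_cong: "(\<And>i. i < n \<Longrightarrow> x i = x' i) \<Longrightarrow> (\<And>i. i < n \<Longrightarrow> y i = y' i) \<Longrightarrow> dotp n x y = dotp n x' y'"
  unfolding dotp_def by (intro sum.cong) auto

lemma dotp_lincomb: "dotp n x (\<lambda>i. \<Sum>a<k. c a * u a i) = (\<Sum>a<k. c a * dotp n x (u a))"
proof -
  have "dotp n x (\<lambda>i. \<Sum>a<k. c a * u a i) = (\<Sum>i<n. \<Sum>a<k. c a * (x i * u a i))"
    unfolding dotp_def by (simp add: sum_distrib_left mult_ac)
  also have "\<dots> = (\<Sum>a<k. c a * dotp n x (u a))"
    by (subst sum.swap) (simp add: dotp_def sum_distrib_left)
  finally show ?thesis .
qed

lemma dotp_lincomb_orthonormal:
  assumes "orthonormal n k u"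
  shows "dotp n (\<lambda>i. \<Sum>a<k. c a * u a i) (\<lambda>i. \<Sum>a<k. c a * u a i) = (\<Sum>a<k. (c a)\<^sup>2)"
proof -
  have "dotp n (\<lambda>i. \<Sum>a<k. c a * u a i) (u b) = c b" if "b < k" for b
  proof -
    have "dotp n (\<lambda>i. \<Sum>a<k. c a * u a i) (u b) = (\<Sum>a<k. c a * dotp n (u b) (u a))"
      by (subst dotp_commute) (rule dotp_lincomb)
    also have "\<dots> = (\<Sum>a<k. if a = b then c b else 0)"
      using assms that by (intro sum.cong) (auto simp: orthonormal_def)
    finally show ?thesis using that by simp
  qed
  then show ?thesis
    unfolding dotp_lincomb by (intro sum.cong) (auto simp: power2_eq_square)
qed

text \<open>Over the span of \<open>u\<close> the concave function
  \<open>2 * dotp n x w - dotp n w w\<close> is maximal at the projection of \<open>x\<close>; in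
  coordinates this is a sum of inequalities between squares. Both the likelihood bound for the
  numerator and the bound on the fitted vector are instances.\<close>

lemma proj_sq_bound:
  assumes on: "orthonormal n k u" and w: "\<And>i. i < n \<Longrightarrow> w i = (\<Sum>a<k. c a * u a i)"
  shows "2 * dotp n x w - dotp n w w \<le> proj_sq n k u x"
proof -
  have "dotp n x w = (\<Sum>a<k. c a * dotp n x (u a))"
    using w by (subst dotp_lincomb[symmetric]) (intro dotp_cong, auto)
  moreover have "dotp n w w = (\<Sum>a<k. (c a)\<^sup>2)"
    using w by (subst dotp_lincomb_orthonormal[OF on, symmetric]) (intro dotp_cong, auto)
  ultimately have "2 * dotp n x w - dotp n w w = (\<Sum>a<k. 2 * (c a * dotp n x (u a)) - (c a)\<^sup>2)"
    by (simp add: sum_subtractf sum_distrib_left)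
  also have "\<dots> \<le> proj_sq n k u x"
    unfolding proj_sq_def
  proof (rule sum_mono)
    fix a
    show "2 * (c a * dotp n x (u a)) - (c a)\<^sup>2 \<le> (dotp n x (u a))\<^sup>2"
      using zero_le_power2[of "c a - dotp n x (u a)"] by (simp add: power2_diff algebra_simps)
  qed
  finally show ?thesis .
qed

text \<open>The columns may be linearly dependent: a vector already in the span adds no new
  direction. Hence \<open>k\<close> is only bounded by \<open>card T\<close>, which suffices because
  the later moment bounds increase with \<open>k\<close>.\<close>

lemma gram_schmidt_family:
  fixes v :: "nat \<Rightarrow> nat \<Rightarrow> real"
  assumes "finite T"
  shows "\<exists>k u. k \<le> card T \<and> orthonormal n k u \<and> (\<forall>j\<in>T. \<exists>c. \<forall>i<n. v j i = (\<Sum>a<k. c a * u a i))"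
  using assms
proof (induction T)
  case empty
  show ?case by (intro exI[of _ 0]) (simp add: orthonormal_def)
next
  case (insert t T)
  then obtain k u where k: "k \<le> card T" and on: "orthonormal n k u"
    and sp: "\<forall>j\<in>T. \<exists>c. \<forall>i<n. v j i = (\<Sum>a<k. c a * u a i)" by blast
  define e where "e a = dotp n (v t) (u a)" for a
  define w where "w i = v t i - (\<Sum>a<k. e a * u a i)" for i
  show ?case
  proof (cases "\<forall>i<n. w i = 0")
    case True
    then have "\<forall>i<n. v t i = (\<Sum>a<k. e a * u a i)" by (simp add: w_def)
    then show ?thesis using k on sp insert(1,2)
      by (intro exI[of _ k] exI[of _ u]) auto
  next
    case False
    then obtain i where i: "i < n" "w i \<noteq> 0" by blast
    have pos: "dotp n w w > 0"
      unfolding dotp_def by (rule sum_pos2[of _ i]) (use i in \<open>auto simp: mult_less_0_iff zero_less_mult_iff linorder_neq_iff\<close>)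
    define N where "N = sqrt (dotp n w w)"
    have N: "N > 0" "N * N = dotp n w w" using pos by (auto simp: N_def)
    define u' where "u' = u(k := \<lambda>i. w i / N)"
    have wu: "dotp n w (u b) = 0" if "b < k" for b
    proof -
      have "dotp n w (u b) = dotp n (v t) (u b) - dotp n (u b) (\<lambda>i. \<Sum>a<k. e a * u a i)"
        unfolding dotp_commute[of n _ "u b"]
        unfolding dotp_def w_def by (simp add: right_diff_distrib sum_subtractf)
      also have "dotp n (u b) (\<lambda>i. \<Sum>a<k. e a * u a i) = (\<Sum>a<k. e a * dotp n (u b) (u a))"
        by (rule dotp_lincomb)
      also have "\<dots> = (\<Sum>a<k. if a = b then e b else 0)"
        using on that by (intro sum.cong) (auto simp: orthonormal_def)
      finally show ?thesis using that by (simp add: e_def)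
    qed
    have sc: "dotp n (\<lambda>i. w i / N) y = dotp n w y / N" for y
      by (simp add: dotp_def sum_divide_distrib)
    have uu: "dotp n (u' k) (u' k) = 1"
    proof -
      have "dotp n (u' k) (u' k) = dotp n w w / N / N"
        by (simp add: u'_def sc dotp_commute[of n w "\<lambda>i. w i / N"])
      then show ?thesis using N pos by simp
    qed
    have on': "orthonormal n (Suc k) u'"
      unfolding orthonormal_def
    proof (intro allI impI)
      fix a b assume "a < Suc k" "b < Suc k"
      then consider "a < k" "b < k" | "a = k" "b < k" | "a < k" "b = k" | "a = k" "b = k" by linarith
      then show "dotp n (u' a) (u' b) = (if a = b then 1 else 0)"
      proof cases
        case 1 then show ?thesis using on by (auto simp: orthonormal_def u'_def)
      next
        case 2 then show ?thesis by (simp add: u'_def sc wu)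
      next
        case 3 then show ?thesis by (subst dotp_commute) (simp add: u'_def sc wu)
      next
        case 4 then show ?thesis using uu by simp
      qed
    qed
    have sp': "\<exists>c. \<forall>i<n. v j i = (\<Sum>a<Suc k. c a * u' a i)" if "j \<in> insert t T" for j
    proof (cases "j = t")
      case True
      have "v t i = (\<Sum>a<Suc k. (e(k := N)) a * u' a i)" for i
      proof -
        have "(\<Sum>a<k. (e(k := N)) a * u' a i) = (\<Sum>a<k. e a * u a i)"
          by (intro sum.cong) (auto simp: u'_def)
        then show ?thesis using N by (simp add: u'_def w_def)
      qed
      then show ?thesis using True by blast
    next
      case False
      then have "j \<in> T" using that by simp
      from bspec[OF sp this] obtain c where c: "\<forall>i<n. v j i = (\<Sum>a<k. c a * u a i)" ..
      have h: "(\<Sum>a<Suc k. (c(k := 0)) a * u' a i) = (\<Sum>a<k. c a * u a i)" for i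
      proof -
        have "(\<Sum>a<k. (c(k := 0)) a * u' a i) = (\<Sum>a<k. c a * u a i)"
          by (intro sum.cong) (auto simp: u'_def)
        then show ?thesis by simp
      qed
      have "\<forall>i<n. v j i = (\<Sum>a<Suc k. (c(k := 0)) a * u' a i)" unfolding h by (rule c)
      then show ?thesis by (rule exI[of _ "c(k := 0)"])
    qed
    have "Suc k \<le> card (insert t T)" using k insert(1,2) by simp
    then show ?thesis using on' sp' by blast
  qed
qed

lemma orthonormal_basis_span:
  fixes X :: "nat \<Rightarrow> nat \<Rightarrow> real"
  assumes "finite T"
  obtains k u where "k \<le> card T" "orthonormal n k u"
    "\<And>b. \<exists>c. \<forall>i<n. (\<Sum>j\<in>T. X i j * b j) = (\<Sum>a<k. c a * u a i)"
proof -
  obtain k u where k: "k \<le> card T" "orthonormal n k u"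
    and sp: "\<forall>j\<in>T. \<exists>c. \<forall>i<n. X i j = (\<Sum>a<k. c a * u a i)"
    using gram_schmidt_family[OF assms, of n "\<lambda>j i. X i j"] by blast
  then obtain c where c: "\<forall>j\<in>T. \<forall>i<n. X i j = (\<Sum>a<k. c j a * u a i)"
    by metis
  have "\<exists>c. \<forall>i<n. (\<Sum>j\<in>T. X i j * b j) = (\<Sum>a<k. c a * u a i)" for b
  proof (intro exI allI impI)
    fix i assume "i < n"
    then have "(\<Sum>j\<in>T. X i j * b j) = (\<Sum>j\<in>T. \<Sum>a<k. b j * c j a * u a i)"
      using c by (intro sum.cong) (auto simp: sum_distrib_left sum_distrib_right mult_ac)
    also have "\<dots> = (\<Sum>a<k. (\<Sum>j\<in>T. b j * c j a) * u a i)"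
      by (subst sum.swap) (simp add: sum_distrib_right)
    finally show "(\<Sum>j\<in>T. X i j * b j) = (\<Sum>a<k. (\<Sum>j\<in>T. b j * c j a) * u a i)" .
  qed
  then show ?thesis using that k by blast
qed

section \<open>Moment generating functions of Gaussian noise and of its projections\<close>

lemma normal_mgf:
  assumes s: "\<sigma> > 0"
  shows "(\<integral>\<^sup>+ y. ennreal (exp (a * (y - m))) \<partial>density lborel (normal_density m \<sigma>))
       = ennreal (exp (\<sigma>\<^sup>2 * a\<^sup>2 / 2))"
proof -
  \<comment> \<open>Tilting the normal law by \<open>exp (a * (y - m))\<close> gives, up to a
    constant, the normal law with mean shifted by \<open>\<sigma>\<^sup>2 * a\<close>.\<close>
  interpret prob_space "density lborel (normal_density (m + \<sigma>\<^sup>2 * a) \<sigma>)"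
    by (rule prob_space_normal_density[OF s])
  have "emeasure (density lborel (normal_density (m + \<sigma>\<^sup>2 * a) \<sigma>)) UNIV = 1"
    using emeasure_space_1 by simp
  then have one: "(\<integral>\<^sup>+ y. ennreal (normal_density (m + \<sigma>\<^sup>2 * a) \<sigma> y) \<partial>lborel) = 1"
    by (simp add: emeasure_density)
  have eq: "normal_density m \<sigma> y * exp (a * (y - m))
      = exp (\<sigma>\<^sup>2 * a\<^sup>2 / 2) * normal_density (m + \<sigma>\<^sup>2 * a) \<sigma> y" for y
  proof -
    have "- (y - m)\<^sup>2 / (2 * \<sigma>\<^sup>2) + a * (y - m)
        = \<sigma>\<^sup>2 * a\<^sup>2 / 2 + - (y - (m + \<sigma>\<^sup>2 * a))\<^sup>2 / (2 * \<sigma>\<^sup>2)"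
      using s by (simp add: field_simps power2_eq_square)
    then have "exp (- (y - m)\<^sup>2 / (2 * \<sigma>\<^sup>2)) * exp (a * (y - m))
        = exp (\<sigma>\<^sup>2 * a\<^sup>2 / 2) * exp (- (y - (m + \<sigma>\<^sup>2 * a))\<^sup>2 / (2 * \<sigma>\<^sup>2))"
      by (simp only: exp_add[symmetric])
    then show ?thesis by (simp add: normal_density_def)
  qed
  have "(\<integral>\<^sup>+ y. ennreal (exp (a * (y - m))) \<partial>density lborel (normal_density m \<sigma>))
      = (\<integral>\<^sup>+ y. ennreal (exp (\<sigma>\<^sup>2 * a\<^sup>2 / 2)) * ennreal (normal_density (m + \<sigma>\<^sup>2 * a) \<sigma> y) \<partial>lborel)"
    by (subst nn_integral_density) (simp_all add: ennreal_mult[symmetric] eq)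
  also have "\<dots> = ennreal (exp (\<sigma>\<^sup>2 * a\<^sup>2 / 2))"
    by (subst nn_integral_cmult) (simp_all add: one)
  finally show ?thesis .
qed

lemma sigma_finite_normal: "\<sigma> > 0 \<Longrightarrow> sigma_finite_measure (density lborel (normal_density m \<sigma>))"
  by (intro prob_space_imp_sigma_finite prob_space_normal_density)

lemma product_normal_mgf:
  fixes n :: nat
  assumes s: "\<sigma> > 0"
  shows "(\<integral>\<^sup>+ Y. ennreal (exp (\<Sum>i<n. a i * (Y i - m i))) \<partial>PiM {..<n} (\<lambda>i. density lborel (normal_density (m i) \<sigma>)))
       = ennreal (exp (\<sigma>\<^sup>2 * (\<Sum>i<n. (a i)\<^sup>2) / 2))"
proof -
  interpret product_sigma_finite "\<lambda>i. density lborel (normal_density (m i) \<sigma>)"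
    by (rule product_sigma_finite.intro) (rule sigma_finite_normal[OF s])
  have "(\<integral>\<^sup>+ Y. ennreal (exp (\<Sum>i<n. a i * (Y i - m i))) \<partial>PiM {..<n} (\<lambda>i. density lborel (normal_density (m i) \<sigma>)))
      = (\<integral>\<^sup>+ Y. (\<Prod>i<n. ennreal (exp (a i * (Y i - m i)))) \<partial>PiM {..<n} (\<lambda>i. density lborel (normal_density (m i) \<sigma>)))"
    by (intro nn_integral_cong) (subst exp_sum, simp_all add: prod_ennreal)
  also have "\<dots> = (\<Prod>i<n. \<integral>\<^sup>+ y. ennreal (exp (a i * (y - m i))) \<partial>density lborel (normal_density (m i) \<sigma>))"
    by (rule product_nn_integral_prod) auto
  also have "\<dots> = (\<Prod>i<n. ennreal (exp (\<sigma>\<^sup>2 * (a i)\<^sup>2 / 2)))"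
    by (simp only: normal_mgf[OF s])
  also have "\<dots> = ennreal (exp (\<Sum>i<n. \<sigma>\<^sup>2 * (a i)\<^sup>2 / 2))"
    by (simp add: exp_sum prod_ennreal)
  also have "(\<Sum>i<n. \<sigma>\<^sup>2 * (a i)\<^sup>2 / 2) = \<sigma>\<^sup>2 * (\<Sum>i<n. (a i)\<^sup>2) / 2"
    by (simp add: sum_distrib_left sum_divide_distrib)
  finally show ?thesis .
qed

lemma std_normal_square_mgf:
  assumes t: "t < 1"
  shows "(\<integral>\<^sup>+ w. ennreal (exp (t * w\<^sup>2 / 2)) \<partial>density lborel (normal_density 0 1)) = ennreal ((1 - t) powr (- 1 / 2))"
proof -
  have eq: "normal_density 0 1 w * exp (t * w\<^sup>2 / 2) = 1 / sqrt (2 * pi) * exp (- ((1 - t) * (w - 0)\<^sup>2) / 2)" for w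
  proof -
    have "- w\<^sup>2 / 2 + t * w\<^sup>2 / 2 = - ((1 - t) * (w - 0)\<^sup>2) / 2" by (simp add: field_simps)
    then have "exp (- w\<^sup>2 / 2) * exp (t * w\<^sup>2 / 2) = exp (- ((1 - t) * (w - 0)\<^sup>2) / 2)"
      by (simp only: exp_add[symmetric])
    then show ?thesis by (simp add: normal_density_def)
  qed
  have "(\<integral>\<^sup>+ w. ennreal (exp (t * w\<^sup>2 / 2)) \<partial>density lborel (normal_density 0 1))
      = (\<integral>\<^sup>+ w. ennreal (normal_density 0 1 w * exp (t * w\<^sup>2 / 2)) \<partial>lborel)"
    by (subst nn_integral_density) (simp_all add: ennreal_mult)
  also have "\<dots> = (\<integral>\<^sup>+ w. ennreal (1 / sqrt (2 * pi)) * ennreal (exp (- ((1 - t) * (w - 0)\<^sup>2) / 2)) \<partial>lborel)"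
    unfolding eq by (intro nn_integral_cong ennreal_mult) auto
  also have "\<dots> = ennreal (1 / sqrt (2 * pi)) * ennreal (sqrt (2 * pi / (1 - t)))"
    by (subst nn_integral_cmult) (simp, subst nn_integral_gaussian_shift, use t in simp_all)
  also have "\<dots> = ennreal ((1 - t) powr (- 1 / 2))"
  proof -
    have "1 / sqrt (2 * pi) * sqrt (2 * pi / (1 - t)) = (1 - t) powr (- 1 / 2)"
      using t by (simp add: real_sqrt_divide powr_minus_divide powr_half_sqrt)
    moreover have "ennreal (1 / sqrt (2 * pi)) * ennreal (sqrt (2 * pi / (1 - t)))
        = ennreal (1 / sqrt (2 * pi) * sqrt (2 * pi / (1 - t)))"
      using t by (intro ennreal_mult[symmetric]) auto
    ultimately show ?thesis by simp
  qed
  finally show ?thesis .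
qed

text \<open>The moment generating function of a chi-square law with \<open>k\<close> degrees of
  freedom, obtained without completing \<open>u\<close> to a basis and rotating the product measure:
  orthonormality enters only through the length of a linear combination of the
  \<open>u a\<close>.\<close>

lemma nn_integral_exp_proj_sq:
  assumes on: "orthonormal n k u" and t: "0 \<le> t" "t < 1" and s: "\<sigma> > 0"
  shows "(\<integral>\<^sup>+ Y. ennreal (exp (t / (2 * \<sigma>\<^sup>2) * proj_sq n k u (\<lambda>i. Y i - m i)))
            \<partial>PiM {..<n} (\<lambda>i. density lborel (normal_density (m i) \<sigma>)))
       = ennreal ((1 - t) powr (- real k / 2))"
proof -
  let ?N = "density lborel (normal_density 0 1) :: real measure"
  let ?P = "PiM {..<n} (\<lambda>i. density lborel (normal_density (m i) \<sigma>))"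
  let ?W = "PiM {..<k} (\<lambda>_::nat. ?N)"
  interpret P: product_sigma_finite "\<lambda>i. density lborel (normal_density (m i) \<sigma>)"
    by (rule product_sigma_finite.intro) (rule sigma_finite_normal[OF s])
  interpret W: product_sigma_finite "\<lambda>_::nat. ?N"
    by (rule product_sigma_finite.intro) (rule sigma_finite_normal, simp)
  interpret SP: sigma_finite_measure ?P by (rule P.sigma_finite) simp
  interpret SW: sigma_finite_measure ?W by (rule W.sigma_finite) simp
  interpret PW: pair_sigma_finite ?P ?W ..
  \<comment> \<open>With this scale the integral over w returns
    \<open>t / (2 * \<sigma>\<^sup>2)\<close> times the projected square, while the integral over Y,
    of variance \<open>\<sigma>\<^sup>2\<close>, leaves \<open>t * (w a)\<^sup>2 / 2\<close> for
    each coordinate.\<close>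
  define r where "r = sqrt t / \<sigma>"
  define g where "g Y w = (\<Sum>a<k. (r * dotp n (\<lambda>i. Y i - m i) (u a)) * w a)" for Y w
  \<comment> \<open>Averaging over an auxiliary standard normal w turns the square in the exponent into a linear form in Y.\<close>
  have g1: "(\<integral>\<^sup>+ w. ennreal (exp (g Y w)) \<partial>?W) = ennreal (exp (t / (2 * \<sigma>\<^sup>2) * proj_sq n k u (\<lambda>i. Y i - m i)))" for Y
  proof -
    have "(\<integral>\<^sup>+ w. ennreal (exp (g Y w)) \<partial>?W) = ennreal (exp (1\<^sup>2 * (\<Sum>a<k. (r * dotp n (\<lambda>i. Y i - m i) (u a))\<^sup>2) / 2))"
      unfolding g_def using product_normal_mgf[where \<sigma>=1 and n=k and a="\<lambda>a. r * dotp n (\<lambda>i. Y i - m i) (u a)" and m="\<lambda>_. 0"] by simp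
    also have "1\<^sup>2 * (\<Sum>a<k. (r * dotp n (\<lambda>i. Y i - m i) (u a))\<^sup>2) / 2 = t / (2 * \<sigma>\<^sup>2) * proj_sq n k u (\<lambda>i. Y i - m i)"
      using t by (simp add: proj_sq_def power_mult_distrib sum_distrib_left sum_divide_distrib r_def power_divide mult_ac)
    finally show ?thesis .
  qed
  have g2: "(\<integral>\<^sup>+ Y. ennreal (exp (g Y w)) \<partial>?P) = (\<Prod>a<k. ennreal (exp (t * (w a)\<^sup>2 / 2)))" for w
  proof -
    define A where "A i = (\<Sum>a<k. (r * w a) * u a i)" for i
    have "g Y w = (\<Sum>i<n. A i * (Y i - m i))" for Y
    proof -
      have "g Y w = (\<Sum>a<k. (r * w a) * dotp n (\<lambda>i. Y i - m i) (u a))"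
        unfolding g_def by (simp add: mult_ac)
      also have "\<dots> = dotp n (\<lambda>i. Y i - m i) A"
        unfolding A_def by (rule dotp_lincomb[symmetric])
      finally show ?thesis by (simp add: dotp_def mult.commute)
    qed
    then have "(\<integral>\<^sup>+ Y. ennreal (exp (g Y w)) \<partial>?P) = ennreal (exp (\<sigma>\<^sup>2 * (\<Sum>i<n. (A i)\<^sup>2) / 2))"
      by (simp add: product_normal_mgf[OF s])
    also have "(\<Sum>i<n. (A i)\<^sup>2) = (\<Sum>a<k. (r * w a)\<^sup>2)"
      using dotp_lincomb_orthonormal[OF on, of "\<lambda>a. r * w a"]
      by (simp add: A_def dotp_def power2_eq_square)
    also have "\<sigma>\<^sup>2 * (\<Sum>a<k. (r * w a)\<^sup>2) / 2 = (\<Sum>a<k. t * (w a)\<^sup>2 / 2)"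
      using t s by (simp add: r_def power_mult_distrib power_divide sum_distrib_left sum_divide_distrib)
    finally show ?thesis by (simp add: exp_sum prod_ennreal)
  qed
  have meas: "(\<lambda>(Y, w). ennreal (exp (g Y w))) \<in> borel_measurable (?P \<Otimes>\<^sub>M ?W)"
    unfolding g_def dotp_def by measurable
  have "(\<integral>\<^sup>+ Y. ennreal (exp (t / (2 * \<sigma>\<^sup>2) * proj_sq n k u (\<lambda>i. Y i - m i))) \<partial>?P)
      = (\<integral>\<^sup>+ Y. (\<integral>\<^sup>+ w. ennreal (exp (g Y w)) \<partial>?W) \<partial>?P)"
    by (simp only: g1)
  also have "\<dots> = (\<integral>\<^sup>+ w. (\<integral>\<^sup>+ Y. ennreal (exp (g Y w)) \<partial>?P) \<partial>?W)"
    using PW.Fubini'[of "\<lambda>Y w. ennreal (exp (g Y w))"] meas by simp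
  also have "\<dots> = (\<integral>\<^sup>+ w. (\<Prod>a<k. ennreal (exp (t * (w a)\<^sup>2 / 2))) \<partial>?W)"
    by (simp only: g2)
  also have "\<dots> = (\<Prod>a<k. \<integral>\<^sup>+ w. ennreal (exp (t * w\<^sup>2 / 2)) \<partial>?N)"
    by (rule W.product_nn_integral_prod) auto
  also have "\<dots> = ennreal ((1 - t) powr (- real k / 2))"
  proof -
    have "((1 - t) powr (- 1 / 2)) ^ k = (1 - t) powr (- real k / 2)"
      using t by (simp add: powr_realpow[symmetric] powr_powr)
    then show ?thesis using t by (simp only: std_normal_square_mgf prod_constant card_lessThan) (simp add: ennreal_power)
  qed
  finally show ?thesis .
qed

section \<open>Least squares and likelihood ratios\<close>

abbreviation col_ix :: "nat set \<Rightarrow> nat \<Rightarrow> nat" where "col_ix S k \<equiv> sl S ! k"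

lemma gram_carrier [simp]: "gram n X S \<in> carrier_mat (card S) (card S)"
  unfolding gram_def XS_def by (rule mult_carrier_mat[where n=n]) auto

lemma gram_entry:
  assumes "k < card S" "l < card S"
  shows "gram n X S $$ (k,l) = (\<Sum>i<n. X i (col_ix S k) * X i (col_ix S l))"
  using assms by (simp add: gram_def XS_def scalar_prod_def atLeast0LessThan)

lemma gram_spectral: "\<exists>Q d. spectral_form (card S) (gram n X S) Q d"
proof -
  have "transpose_mat (gram n X S) = gram n X S"
    by (rule eq_matI) (use gram_carrier[of n X S] in \<open>auto simp: gram_entry mult.commute simp del: gram_carrier\<close>)
  then show ?thesis
    using spectral_decomposition[OF gram_carrier] unfolding spectral_form_def by blast
qed

definition lin_pred :: "(nat \<Rightarrow> nat \<Rightarrow> real) \<Rightarrow> nat set \<Rightarrow> (nat \<Rightarrow> real) \<Rightarrow> nat \<Rightarrow> real" where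
  "lin_pred X S x i = (\<Sum>k<card S. X i (col_ix S k) * x k)"

lemma qform_gram: "qform (card S) (\<lambda>k l. gram n X S $$ (k,l)) x = (\<Sum>i<n. (lin_pred X S x i)\<^sup>2)"
proof -
  have "qform (card S) (\<lambda>k l. gram n X S $$ (k,l)) x
      = (\<Sum>k<card S. \<Sum>l<card S. \<Sum>i<n. (X i (col_ix S k) * x k) * (X i (col_ix S l) * x l))"
    unfolding qform_def
    by (intro sum.cong refl) (simp add: gram_entry sum_distrib_right sum_distrib_left mult_ac)
  also have "\<dots> = (\<Sum>k<card S. \<Sum>i<n. \<Sum>l<card S. (X i (col_ix S k) * x k) * (X i (col_ix S l) * x l))"
    by (intro sum.cong refl sum.swap)
  also have "\<dots> = (\<Sum>i<n. \<Sum>k<card S. \<Sum>l<card S. (X i (col_ix S k) * x k) * (X i (col_ix S l) * x l))"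
    by (rule sum.swap)
  also have "\<dots> = (\<Sum>i<n. (lin_pred X S x i)\<^sup>2)"
    by (simp only: sum_product[symmetric] lin_pred_def power2_eq_square)
  finally show ?thesis .
qed

lemma sum_col_ix:
  assumes "finite S"
  shows "(\<Sum>k<card S. f (col_ix S k)) = (\<Sum>j\<in>S. f j)"
  by (rule sum.reindex_bij_betw[OF sl_bij[OF assms]])

lemma lin_pred_to_vec:
  assumes "finite S"
  shows "lin_pred X S (vec_index (to_vec S b)) i = (\<Sum>j\<in>S. X i j * b j)"
proof -
  have "lin_pred X S (vec_index (to_vec S b)) i = (\<Sum>k<card S. X i (col_ix S k) * b (col_ix S k))"
    unfolding lin_pred_def by (intro sum.cong) (auto simp: to_vec_def)
  also have "\<dots> = (\<Sum>j\<in>S. X i j * b j)" by (rule sum_col_ix[OF assms])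
  finally show ?thesis .
qed

lemma lin_pred_span:
  assumes "finite S"
  shows "\<exists>b. \<forall>i. lin_pred X S x i = (\<Sum>j\<in>S. X i j * b j)"
proof -
  define g where "g = the_inv_into {..<card S} (col_ix S)"
  have "g (col_ix S k) = k" if "k < card S" for k
    using sl_bij[OF assms] that by (simp add: g_def bij_betw_def the_inv_into_f_f)
  then have "lin_pred X S x i = (\<Sum>k<card S. X i (col_ix S k) * x (g (col_ix S k)))" for i
    unfolding lin_pred_def by (intro sum.cong) auto
  then have "\<forall>i. lin_pred X S x i = (\<Sum>j\<in>S. X i j * x (g j))"
    by (simp add: sum_col_ix[OF assms, of "\<lambda>j. X _ j * x (g j)"])
  then show ?thesis by (rule exI[of _ "\<lambda>j. x (g j)"])
qed

lemma lin_pred_cong: "(\<And>k. k < card S \<Longrightarrow> x k = y k) \<Longrightarrow> lin_pred X S x i = lin_pred X S y i"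
  unfolding lin_pred_def by (intro sum.cong) auto

lemma lin_pred_diff: "lin_pred X S (\<lambda>k. x k - y k) i = lin_pred X S x i - lin_pred X S y i"
  by (simp add: lin_pred_def right_diff_distrib sum_subtractf)

lemma lin_pred_scale: "lin_pred X S (\<lambda>k. c * x k) i = c * lin_pred X S x i"
  by (simp add: lin_pred_def sum_distrib_left mult_ac)

lemma sum_extend:
  assumes "S \<subseteq> {..<p}"
  shows "(\<Sum>j<p. X i j * extend S b j) = (\<Sum>j\<in>S. X i j * b j)"
proof -
  have "(\<Sum>j<p. X i j * extend S b j) = (\<Sum>j\<in>S. X i j * extend S b j)"
    using assms by (intro sum.mono_neutral_right) (auto simp: extend_def)
  then show ?thesis by (simp add: extend_def)
qed

lemma sum_supp:
  assumes "supp b \<subseteq> T" "T \<subseteq> {..<p}"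
  shows "(\<Sum>j<p. X i j * b j) = (\<Sum>j\<in>T. X i j * b j)"
  using assms by (intro sum.mono_neutral_right) (auto simp: supp_def)

lemma beta_hat_carrier:
  assumes "spectral_form (card S) (gram n X S) Q d" "\<And>i. i < card S \<Longrightarrow> d i > 0"
  shows "beta_hat n X S Y \<in> carrier_vec (card S)"
proof -
  have "minv (gram n X S) = Q * diagm (card S) (\<lambda>i. 1 / d i) * transpose_mat Q"
    by (rule minv_spectral_form[OF assms(1)]) (use assms(2) in force)
  then have "minv (gram n X S) \<in> carrier_mat (card S) (card S)"
    using spectral_form_carrier(1)[OF assms(1)] by (auto intro!: mult_carrier_mat[where n="card S"])
  then show ?thesis
    unfolding beta_hat_def by (rule mult_mat_vec_carrier) (auto simp: XS_def intro!: carrier_vecI)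
qed

text \<open>The residual of least squares is orthogonal to the column span, since the Gram matrix
  times the estimate is the vector of inner products of the columns with Y. It serves twice: for the
  Pythagorean identity behind the denominator, and for replacing the squared length of the fit by
  its inner product with Y.\<close>

lemma normal_equations:
  assumes sp: "spectral_form (card S) (gram n X S) Q d" and d: "\<And>i. i < card S \<Longrightarrow> d i > 0"
  shows "dotp n (lin_pred X S x) Y = dotp n (lin_pred X S x) (lin_pred X S (vec_index (beta_hat n X S Y)))"
proof -
  let ?m = "card S" and ?G = "gram n X S" and ?B = "XS n X S"
  define z where "z = transpose_mat ?B *\<^sub>v vec n Y"
  have z: "z \<in> carrier_vec ?m" unfolding z_def XS_def by (rule carrier_vecI) simp
  have bh: "beta_hat n X S Y = minv ?G *\<^sub>v z" by (simp add: beta_hat_def z_def)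
  have G: "?G \<in> carrier_mat ?m ?m" by simp
  have eq: "minv ?G = Q * diagm ?m (\<lambda>i. 1 / d i) * transpose_mat Q"
    by (rule minv_spectral_form[OF sp]) (use d in force)
  have "?G * minv ?G = Q * diagm ?m (\<lambda>i. d i * (1 / d i)) * transpose_mat Q"
    unfolding eq by (rule spectral_form_mult[OF sp spectral_form_change[OF sp]])
  also have "diagm ?m (\<lambda>i. d i * (1 / d i)) = 1\<^sub>m ?m"
    using d by (subst diagm_one[symmetric], intro diagm_cong) force
  finally have inv: "?G * minv ?G = 1\<^sub>m ?m"
    using spectral_form_orth[OF sp] spectral_form_carrier[OF sp] by simp
  have M: "minv ?G \<in> carrier_mat ?m ?m"
    unfolding eq using spectral_form_carrier(1)[OF sp] by (auto intro!: mult_carrier_mat[where n="?m"])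
  have "?G *\<^sub>v beta_hat n X S Y = (?G * minv ?G) *\<^sub>v z"
    unfolding bh by (rule assoc_mult_mat_vec[symmetric, OF G M z])
  then have Gb: "?G *\<^sub>v beta_hat n X S Y = z" using inv z by simp
  have bhc: "beta_hat n X S Y \<in> carrier_vec ?m" by (rule beta_hat_carrier[OF sp d])
  have ne: "(\<Sum>k<?m. ?G $$ (l,k) * vec_index (beta_hat n X S Y) k) = (\<Sum>i<n. X i (col_ix S l) * Y i)"
    if l: "l < ?m" for l
  proof -
    have "vec_index (?G *\<^sub>v beta_hat n X S Y) l = vec_index z l" using Gb by simp
    then show ?thesis using l bhc spectral_form_carrier(3,4)[OF sp]
      by (simp add: z_def XS_def scalar_prod_def atLeast0LessThan)
  qed
  have "dotp n (lin_pred X S x) (lin_pred X S (vec_index (beta_hat n X S Y)))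
      = (\<Sum>i<n. \<Sum>l<?m. \<Sum>k<?m. x l * (X i (col_ix S l) * X i (col_ix S k) * vec_index (beta_hat n X S Y) k))"
    by (simp add: dotp_def lin_pred_def sum_product mult_ac)
  also have "\<dots> = (\<Sum>l<?m. \<Sum>i<n. \<Sum>k<?m. x l * (X i (col_ix S l) * X i (col_ix S k) * vec_index (beta_hat n X S Y) k))"
    by (rule sum.swap)
  also have "\<dots> = (\<Sum>l<?m. \<Sum>k<?m. \<Sum>i<n. x l * (X i (col_ix S l) * X i (col_ix S k) * vec_index (beta_hat n X S Y) k))"
    by (intro sum.cong refl sum.swap)
  also have "\<dots> = (\<Sum>l<?m. x l * (\<Sum>k<?m. ?G $$ (l,k) * vec_index (beta_hat n X S Y) k))"
    by (intro sum.cong refl) (simp add: gram_entry sum_distrib_left sum_distrib_right mult_ac)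
  also have "\<dots> = (\<Sum>l<?m. x l * (\<Sum>i<n. X i (col_ix S l) * Y i))"
    by (intro sum.cong refl) (simp add: ne)
  also have "\<dots> = (\<Sum>l<?m. \<Sum>i<n. X i (col_ix S l) * x l * Y i)"
    by (simp add: sum_distrib_left mult_ac)
  also have "\<dots> = (\<Sum>i<n. \<Sum>l<?m. X i (col_ix S l) * x l * Y i)"
    by (rule sum.swap)
  also have "\<dots> = dotp n (lin_pred X S x) Y"
    by (simp add: dotp_def lin_pred_def sum_distrib_right)
  finally show ?thesis by simp
qed

lemma lik_ratio_powr:
  assumes s: "sigma2 > 0"
  shows "(lik n p X sigma2 Y b / lik n p X sigma2 Y b0) powr alpha =
     exp (alpha / (2 * sigma2) * ((\<Sum>i<n. (Y i - (\<Sum>j<p. X i j * b0 j))\<^sup>2) - (\<Sum>i<n. (Y i - (\<Sum>j<p. X i j * b j))\<^sup>2)))"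
proof -
  define C where "C = (2 * pi * sigma2) powr (- real n / 2)"
  have C: "C > 0" using s by (simp add: C_def)
  let ?a = "\<Sum>i<n. (Y i - (\<Sum>j<p. X i j * b0 j))\<^sup>2" and ?b = "\<Sum>i<n. (Y i - (\<Sum>j<p. X i j * b j))\<^sup>2"
  have "lik n p X sigma2 Y b / lik n p X sigma2 Y b0 = exp (- ?b / (2 * sigma2)) / exp (- ?a / (2 * sigma2))"
    unfolding lik_def C_def[symmetric] using C by simp
  also have "\<dots> = exp ((?a - ?b) / (2 * sigma2))"
    by (simp add: exp_diff[symmetric] diff_divide_distrib)
  finally show ?thesis by (simp add: powr_def)
qed

lemma residual_diff:
  "(\<Sum>i<n. (Y i - e0 i)\<^sup>2) - (\<Sum>i<n. (Y i - e i)\<^sup>2)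
    = 2 * dotp n (\<lambda>i. Y i - e0 i) (\<lambda>i. e i - e0 i) - dotp n (\<lambda>i. e i - e0 i) (\<lambda>i. e i - (e0 i :: real))"
  unfolding dotp_def sum_distrib_left sum_subtractf[symmetric]
  by (intro sum.cong refl) (simp add: power2_eq_square algebra_simps)

definition in_span :: "nat \<Rightarrow> (nat \<Rightarrow> nat \<Rightarrow> real) \<Rightarrow> nat set \<Rightarrow> nat \<Rightarrow> (nat \<Rightarrow> nat \<Rightarrow> real) \<Rightarrow> bool" where
  "in_span n X T k u \<longleftrightarrow> (\<forall>b. \<exists>c. \<forall>i<n. (\<Sum>j\<in>T. X i j * b j) = (\<Sum>a<k. c a * u a i))"

text \<open>The two residual sums differ by twice the inner product of the noise with
  \<open>w\<close> minus the squared length of \<open>w\<close>, where \<open>w\<close> is the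
  difference of the means and lies in the span of the columns in \<open>T\<close>. The bound does
  not involve \<open>b\<close>, so it can be integrated against any probability density.\<close>

lemma lik_ratio_upper:
  assumes s: "sigma2 > 0" and al: "alpha > 0" and on: "orthonormal n k u"
    and sp: "in_span n X T k u" and T: "T \<subseteq> {..<p}" and b: "supp b \<subseteq> T" and b0: "supp b0 \<subseteq> T"
  shows "(lik n p X sigma2 Y b / lik n p X sigma2 Y b0) powr alpha
     \<le> exp (alpha / (2 * sigma2) * proj_sq n k u (\<lambda>i. Y i - (\<Sum>j<p. X i j * b0 j)))"
proof -
  let ?e = "\<lambda>i. \<Sum>j<p. X i j * b j" and ?f = "\<lambda>i. \<Sum>j<p. X i j * b0 j"
  obtain c where c: "\<forall>i<n. (\<Sum>j\<in>T. X i j * (b j - b0 j)) = (\<Sum>a<k. c a * u a i)"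
    using sp[unfolded in_span_def, rule_format, of "\<lambda>j. b j - b0 j"] by blast
  have "(\<Sum>i<n. (Y i - ?f i)\<^sup>2) - (\<Sum>i<n. (Y i - ?e i)\<^sup>2) \<le> proj_sq n k u (\<lambda>i. Y i - ?f i)"
    unfolding residual_diff
  proof (rule proj_sq_bound[OF on, where c=c])
    fix i assume "i < n"
    then have "(\<Sum>a<k. c a * u a i) = (\<Sum>j\<in>T. X i j * (b j - b0 j))" using c by simp
    then show "?e i - ?f i = (\<Sum>a<k. c a * u a i)"
      by (simp add: sum_supp[OF b T] sum_supp[OF b0 T] right_diff_distrib sum_subtractf)
  qed
  then show ?thesis
    unfolding lik_ratio_powr[OF s] exp_le_cancel_iff by (rule mult_left_mono) (use s al in auto)
qed

text \<open>By orthogonality the squared length of \<open>v\<close> is its inner product with Y,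
  that is, with the mean \<open>e\<close> plus the noise. Each of the two inner products is bounded
  at the price of a quarter of the squared length of \<open>v\<close>; half of it is left, whence
  the factors 2. The span is that of a larger set \<open>T\<close>, so that the same projection as
  in the numerator appears.\<close>

lemma fitted_norm_bound:
  fixes Y e :: "nat \<Rightarrow> real"
  assumes sp: "spectral_form (card S) (gram n X S) Q d" and d: "\<And>i. i < card S \<Longrightarrow> d i > 0"
    and S: "finite S" "S \<subseteq> T" "finite T" and on: "orthonormal n k u" and span: "in_span n X T k u"
  defines "v \<equiv> lin_pred X S (vec_index (beta_hat n X S Y))"
  shows "dotp n v v \<le> 2 * dotp n e e + 2 * proj_sq n k u (\<lambda>i. Y i - e i)"
proof -
  have "dotp n v v = dotp n v Y"
    unfolding v_def by (rule normal_equations[OF sp d, symmetric])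
  also have "\<dots> = dotp n v e + dotp n (\<lambda>i. Y i - e i) v"
    by (simp add: dotp_def sum.distrib[symmetric] algebra_simps)
  finally have vv: "dotp n v v = dotp n v e + dotp n (\<lambda>i. Y i - e i) v" .
  obtain b where b: "\<forall>i. v i = (\<Sum>j\<in>S. X i j * b j)"
    unfolding v_def using lin_pred_span[OF S(1)] by blast
  \<comment> \<open>Applying \<open>proj_sq_bound\<close> to half of \<open>v\<close> makes its
    quadratic term exactly one quarter of \<open>dotp n v v\<close>.\<close>
  have bT: "v i / 2 = (\<Sum>j\<in>T. X i j * (if j \<in> S then b j / 2 else 0))" for i
  proof -
    have "(\<Sum>j\<in>T. X i j * (if j \<in> S then b j / 2 else 0)) = (\<Sum>j\<in>S. X i j * (if j \<in> S then b j / 2 else 0))"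
      using S by (intro sum.mono_neutral_right) auto
    also have "\<dots> = v i / 2" using b by (simp add: sum_divide_distrib)
    finally show ?thesis by simp
  qed
  obtain c where c: "\<forall>i<n. (\<Sum>j\<in>T. X i j * (if j \<in> S then b j / 2 else 0)) = (\<Sum>a<k. c a * u a i)"
    using span[unfolded in_span_def, rule_format, of "\<lambda>j. if j \<in> S then b j / 2 else 0"] by blast
  have "2 * dotp n (\<lambda>i. Y i - e i) (\<lambda>i. v i / 2) - dotp n (\<lambda>i. v i / 2) (\<lambda>i. v i / 2)
      \<le> proj_sq n k u (\<lambda>i. Y i - e i)"
    by (rule proj_sq_bound[OF on, where c=c]) (use c bT in auto)
  moreover have "dotp n (\<lambda>i. Y i - e i) (\<lambda>i. v i / 2) = dotp n (\<lambda>i. Y i - e i) v / 2"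
    by (simp add: dotp_def sum_divide_distrib)
  moreover have "dotp n (\<lambda>i. v i / 2) (\<lambda>i. v i / 2) = dotp n v v / 4"
    by (simp add: dotp_def sum_divide_distrib)
  moreover have "2 * dotp n v e \<le> 2 * dotp n e e + dotp n v v / 2"
  proof -
    have "dotp n v e \<le> (\<Sum>i<n. e i * e i + v i * v i / 4)"
      unfolding dotp_def
    proof (rule sum_mono)
      fix i show "v i * e i \<le> e i * e i + v i * v i / 4"
        using zero_le_power2[of "e i - v i / 2"] by (simp add: power2_eq_square algebra_simps)
    qed
    then show ?thesis by (simp add: dotp_def sum.distrib sum_divide_distrib[symmetric])
  qed
  ultimately show ?thesis using vv by linarith
qed

text \<open>Relative to the least squares fit \<open>v\<close>, the mean of \<open>b\<close> is off
  by its deviation from the shrunken centre plus \<open>(phi - 1)\<close> times \<open>v\<close>.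
  Splitting the square of this sum costs a factor 2, which is why \<open>alpha / sigma2\<close>
  stands in place of \<open>alpha / (2 * sigma2)\<close>.\<close>

lemma lik_ratio_lower:
  fixes Y b b0 :: "nat \<Rightarrow> real"
  assumes s: "sigma2 > 0" and al: "alpha > 0" and S: "S \<subseteq> {..<p}" and b0: "supp b0 \<subseteq> S"
    and sp: "spectral_form (card S) (gram n X S) Q d" and d: "\<And>i. i < card S \<Longrightarrow> d i > 0"
  defines "v \<equiv> lin_pred X S (vec_index (beta_hat n X S Y))"
  shows "(lik n p X sigma2 Y (extend S b) / lik n p X sigma2 Y b0) powr alpha
     \<ge> exp (- (alpha / sigma2) * (1 - phi)\<^sup>2 * dotp n v v) *
       exp (- (alpha / sigma2) * qform (card S) (\<lambda>k l. gram n X S $$ (k,l)) (vec_index (to_vec S b - phi \<cdot>\<^sub>v beta_hat n X S Y)))"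
proof -
  let ?e = "\<lambda>i. \<Sum>j<p. X i j * extend S b j" and ?f = "\<lambda>i. \<Sum>j<p. X i j * b0 j"
  let ?bh = "beta_hat n X S Y"
  have fS: "finite S" using S finite_subset by blast
  have bhc: "?bh \<in> carrier_vec (card S)" by (rule beta_hat_carrier[OF sp d])
  have e: "?e i = lin_pred X S (vec_index (to_vec S b)) i" for i
    by (simp add: sum_extend[OF S] lin_pred_to_vec[OF fS])
  have e0: "?f i = lin_pred X S (vec_index (to_vec S b0)) i" for i
    by (simp add: sum_supp[OF b0 S] lin_pred_to_vec[OF fS])
  have pyth: "(\<Sum>i<n. (Y i - lin_pred X S x i)\<^sup>2) = (\<Sum>i<n. (Y i - v i)\<^sup>2) + (\<Sum>i<n. (lin_pred X S x i - v i)\<^sup>2)" for x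
  proof -
    define y where "y = (\<lambda>k. x k - vec_index ?bh k)"
    have "dotp n (lin_pred X S y) Y = dotp n (lin_pred X S y) v"
      unfolding v_def by (rule normal_equations[OF sp d])
    then have "(\<Sum>i<n. lin_pred X S y i * (Y i - v i)) = 0"
      by (simp add: dotp_def right_diff_distrib sum_subtractf)
    moreover have y: "lin_pred X S y i = lin_pred X S x i - v i" for i
      by (simp add: y_def v_def lin_pred_diff)
    ultimately have 0: "(\<Sum>i<n. 2 * ((lin_pred X S x i - v i) * (Y i - v i))) = 0"
      by (simp add: sum_distrib_left[symmetric])
    have "(\<Sum>i<n. (Y i - lin_pred X S x i)\<^sup>2)
        = (\<Sum>i<n. (Y i - v i)\<^sup>2 + (lin_pred X S x i - v i)\<^sup>2 - 2 * ((lin_pred X S x i - v i) * (Y i - v i)))"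
      by (intro sum.cong refl) (simp add: power2_eq_square algebra_simps)
    also have "\<dots> = (\<Sum>i<n. (Y i - v i)\<^sup>2) + (\<Sum>i<n. (lin_pred X S x i - v i)\<^sup>2)"
      by (simp only: sum_subtractf sum.distrib 0)
    finally show ?thesis .
  qed
  let ?z = "vec_index (to_vec S b - phi \<cdot>\<^sub>v ?bh)"
  have zz: "lin_pred X S (vec_index (to_vec S b)) i - v i = lin_pred X S ?z i + (phi - 1) * v i" for i
  proof -
    have "lin_pred X S ?z i = lin_pred X S (\<lambda>k. vec_index (to_vec S b) k - phi * vec_index ?bh k) i"
      by (rule lin_pred_cong) (use bhc in \<open>auto simp: to_vec_def\<close>)
    then show ?thesis by (simp add: lin_pred_diff lin_pred_scale v_def algebra_simps)
  qed
  have "(\<Sum>i<n. (lin_pred X S (vec_index (to_vec S b)) i - v i)\<^sup>2)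
      \<le> (\<Sum>i<n. 2 * (lin_pred X S ?z i)\<^sup>2 + 2 * ((1 - phi)\<^sup>2 * (v i * v i)))"
  proof (rule sum_mono)
    fix i
    have "(x + y)\<^sup>2 \<le> 2 * x\<^sup>2 + 2 * y\<^sup>2" for x y :: real
      using zero_le_power2[of "x - y"] by (simp add: power2_eq_square algebra_simps)
    from this[of "lin_pred X S ?z i" "(phi - 1) * v i"]
    show "(lin_pred X S (vec_index (to_vec S b)) i - v i)\<^sup>2 \<le> 2 * (lin_pred X S ?z i)\<^sup>2 + 2 * ((1 - phi)\<^sup>2 * (v i * v i))"
      unfolding zz by (simp add: power_mult_distrib power2_commute[of phi] power2_eq_square[of "v i"])
  qed
  also have "\<dots> = 2 * qform (card S) (\<lambda>k l. gram n X S $$ (k,l)) ?z + 2 * ((1 - phi)\<^sup>2 * dotp n v v)"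
    by (simp add: qform_gram sum.distrib dotp_def sum_distrib_left)
  finally have A: "(\<Sum>i<n. (lin_pred X S (vec_index (to_vec S b)) i - v i)\<^sup>2)
      \<le> 2 * qform (card S) (\<lambda>k l. gram n X S $$ (k,l)) ?z + 2 * ((1 - phi)\<^sup>2 * dotp n v v)" .
  \<comment> \<open>Both means lie in the column span of \<open>S\<close>, so \<open>pyth\<close>
    applies to each: the residual of \<open>v\<close> cancels, and the squared distance of the true
    mean from \<open>v\<close> is nonnegative and is dropped.\<close>
  have "(\<Sum>i<n. (Y i - ?f i)\<^sup>2) - (\<Sum>i<n. (Y i - ?e i)\<^sup>2)
      \<ge> - (\<Sum>i<n. (lin_pred X S (vec_index (to_vec S b)) i - v i)\<^sup>2)"
    unfolding e e0 pyth by (simp add: sum_nonneg)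
  with A have B: "(\<Sum>i<n. (Y i - ?f i)\<^sup>2) - (\<Sum>i<n. (Y i - ?e i)\<^sup>2)
      \<ge> - (2 * qform (card S) (\<lambda>k l. gram n X S $$ (k,l)) ?z + 2 * ((1 - phi)\<^sup>2 * dotp n v v))" by linarith
  have "alpha / (2 * sigma2) * ((\<Sum>i<n. (Y i - ?f i)\<^sup>2) - (\<Sum>i<n. (Y i - ?e i)\<^sup>2))
     \<ge> alpha / (2 * sigma2) * - (2 * qform (card S) (\<lambda>k l. gram n X S $$ (k,l)) ?z + 2 * ((1 - phi)\<^sup>2 * dotp n v v))"
    by (rule mult_left_mono[OF B]) (use s al in auto)
  moreover have "alpha / (2 * sigma2) * - (2 * qform (card S) (\<lambda>k l. gram n X S $$ (k,l)) ?z + 2 * ((1 - phi)\<^sup>2 * dotp n v v))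
     = - (alpha / sigma2) * (1 - phi)\<^sup>2 * dotp n v v + - (alpha / sigma2) * qform (card S) (\<lambda>k l. gram n X S $$ (k,l)) ?z"
    using s by (simp add: field_simps)
  ultimately show ?thesis
    unfolding lik_ratio_powr[OF s] exp_add[symmetric] by simp
qed

section \<open>Bounds on the posterior numerator and denominator\<close>

lemma lam_spectral:
  assumes sp: "spectral_form m M Q d" and m: "m > 0"
  shows "i < m \<Longrightarrow> lam_min M \<le> d i" "i < m \<Longrightarrow> d i \<le> lam_max M"
    "lam_min M \<in> d ` {..<m}" "lam_max M \<in> d ` {..<m}"
proof -
  have ne: "d ` {..<m} \<noteq> {}" using m by auto
  show "i < m \<Longrightarrow> lam_min M \<le> d i" "i < m \<Longrightarrow> d i \<le> lam_max M"
    unfolding lam_min_def lam_max_def eigenvalues_spectral_form[OF sp] by auto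
  show "lam_min M \<in> d ` {..<m}" "lam_max M \<in> d ` {..<m}"
    unfolding lam_min_def lam_max_def eigenvalues_spectral_form[OF sp] using ne
    by (auto intro!: Min_in Max_in simp del: Min_in Max_in)
qed

lemma cfg_weight_nonneg: "cfg_weight n p X l C r S \<ge> 0"
  by (simp add: cfg_weight_def)

lemma f_size_nonneg: "f_size p R a c s \<ge> 0"
  by (auto simp: f_size_def intro!: divide_nonneg_nonneg sum_nonneg)

lemma prior_S_nonneg: "prior_S n p R X l a c C r S \<ge> 0"
  unfolding prior_S_def
  by (intro mult_nonneg_nonneg divide_nonneg_nonneg sum_nonneg f_size_nonneg cfg_weight_nonneg)

text \<open>A Gram matrix without positive smallest eigenvalue has infinite condition number, so the
  truncation in the prior leaves only positive definite ones.\<close>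

lemma cfg_weight_spectral:
  assumes "cfg_weight n p X l C r S \<noteq> 0" "finite S" "S \<noteq> {}"
  obtains Q d where "spectral_form (card S) (gram n X S) Q d" "\<And>i. i < card S \<Longrightarrow> d i > 0"
proof -
  have m: "card S > 0" using assms(2,3) by (simp add: card_gt_0_iff)
  obtain Q d where sp: "spectral_form (card S) (gram n X S) Q d" using gram_spectral by blast
  have "cond_num n X S < ereal (C * real p powr r)"
    using assms(1) by (auto simp: cfg_weight_def split: if_splits)
  then have "lam_min (gram n X S) > 0"
    using assms(3) by (auto simp: cond_num_def split: if_splits)
  then have "d i > 0" if "i < card S" for i
    using lam_spectral(1)[OF sp m that] by linarith
  then show ?thesis using that sp by blast
qed

section \<open>The scale of the conditional prior\<close>

lemma kS_spectral:
  assumes sp: "spectral_form (card S) (gram n X S) Q d" and d: "\<And>i. i < card S \<Longrightarrow> d i > 0"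
  shows "kS n X l S = (\<Sum>i<card S. 1 / d i) / (\<Sum>i<card S. d i powr l)"
proof -
  have "minv (gram n X S) = Q * diagm (card S) (\<lambda>i. 1 / d i) * transpose_mat Q"
    by (rule minv_spectral_form[OF sp]) (use d in force)
  moreover have "mat_powr (gram n X S) l = Q * diagm (card S) (\<lambda>i. d i powr l) * transpose_mat Q"
    by (rule mat_powr_spectral_form[OF sp]) (rule d)
  ultimately show ?thesis
    unfolding kS_def by (simp add: mtrace_spectral_form[OF spectral_form_change[OF sp]])
qed

lemma kS_pos:
  assumes sp: "spectral_form (card S) (gram n X S) Q d" and d: "\<And>i. i < card S \<Longrightarrow> d i > 0"
    and m: "card S > 0"
  shows "kS n X l S > 0"
proof -
  have ne: "{..<card S} \<noteq> {}" using m by auto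
  have "(\<Sum>i<card S. 1 / d i) > 0" "(\<Sum>i<card S. d i powr l) > 0"
    by (rule sum_pos; use ne d in force)+
  moreover have "kS n X l S = (\<Sum>i<card S. 1 / d i) / (\<Sum>i<card S. d i powr l)"
    by (rule kS_spectral[OF sp]) (rule d)
  ultimately show ?thesis by simp
qed

text \<open>The two-sided bound on \<open>x\<close> treats both signs of the exponent at once, as
  \<open>l\<close> is an arbitrary real.\<close>

lemma powr_ratio_bound:
  fixes x :: real
  assumes "1 / q \<le> x" "x \<le> q" "q > 0"
  shows "x powr e \<le> q powr \<bar>e\<bar>"
proof (cases "e \<ge> 0")
  case True
  have "x > 0" using assms by (smt (verit) divide_pos_pos)
  then show ?thesis using True assms by (simp add: powr_mono2)
next
  case False
  have x: "x > 0" using assms by (smt (verit) divide_pos_pos)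
  have "x powr e = (1 / x) powr (- e)" using x by (simp add: powr_minus powr_divide field_simps)
  also have "\<dots> \<le> q powr (- e)"
    using False assms x by (intro powr_mono2) (auto simp: field_simps)
  finally show ?thesis using False by simp
qed

text \<open>The left side is the average of \<open>(d i / d j) powr (l + 1)\<close> over
  \<open>j\<close> with weights \<open>d j powr l\<close>. Only ratios of eigenvalues occur, so the
  bound does not change when the Gram matrix is rescaled by n.\<close>

lemma kS_bound:
  assumes sp: "spectral_form (card S) (gram n X S) Q d" and lo: "lo > 0"
    and d: "\<And>i. i < card S \<Longrightarrow> lo \<le> d i \<and> d i \<le> hi" and i: "i < card S"
  shows "kS n X l S * d i powr (l + 1) \<le> (hi / lo) powr \<bar>l + 1\<bar>"
proof -
  have dp: "d i > 0" if "i < card S" for i using d[OF that] lo by linarith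
  have hi: "hi > 0" using d[OF i] lo by linarith
  let ?K = "(hi / lo) powr \<bar>l + 1\<bar>"
  have "(\<Sum>j<card S. 1 / d j) * d i powr (l + 1) \<le> (\<Sum>j<card S. ?K * d j powr l)"
    unfolding sum_distrib_right
  proof (rule sum_mono)
    fix j assume "j \<in> {..<card S}"
    then have j: "j < card S" by simp
    have "(d i / d j) powr (l + 1) \<le> ?K"
    proof (rule powr_ratio_bound)
      show "d i / d j \<le> hi / lo"
        using d[OF i] d[OF j] dp[OF j] dp[OF i] lo hi by (intro frac_le) auto
      have "lo / hi \<le> d i / d j"
        using d[OF i] d[OF j] dp[OF j] dp[OF i] lo hi by (intro frac_le) auto
      then show "1 / (hi / lo) \<le> d i / d j" by simp
    qed (use lo hi in auto)
    then have "d j powr l * (d i / d j) powr (l + 1) \<le> d j powr l * ?K"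
      by (intro mult_left_mono) auto
    moreover have "d j powr l * (d i / d j) powr (l + 1) = 1 / d j * d i powr (l + 1)"
      using dp[OF i] dp[OF j] by (simp add: powr_divide powr_add)
    ultimately show "1 / d j * d i powr (l + 1) \<le> ?K * d j powr l" by (simp add: mult.commute)
  qed
  also have "\<dots> = ?K * (\<Sum>j<card S. d j powr l)" by (simp add: sum_distrib_left)
  finally have *: "(\<Sum>j<card S. 1 / d j) * d i powr (l + 1) \<le> ?K * (\<Sum>j<card S. d j powr l)" .
  have ne: "{..<card S} \<noteq> {}" using i by auto
  have "(\<Sum>j<card S. d j powr l) > 0" by (rule sum_pos) (use ne dp in force)+
  moreover have "kS n X l S = (\<Sum>i<card S. 1 / d i) / (\<Sum>i<card S. d i powr l)"
    by (rule kS_spectral[OF sp]) (rule dp)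
  ultimately show ?thesis using * by (simp only: times_divide_eq_left pos_divide_le_eq)
qed

lemma col_ix_in:
  assumes "finite S" "k < card S" shows "col_ix S k \<in> S"
  using sl_bij[OF assms(1)] assms(2) by (auto simp: bij_betw_def)

section \<open>Measurability and normalisation of the conditional prior\<close>

lemma gauss_dens_measurable:
  assumes S: "finite S" and sp: "spectral_form (card S) Sig Q e" and e: "\<And>i. i < card S \<Longrightarrow> e i \<noteq> 0"
    and mu: "mu \<in> carrier_vec (card S)"
  shows "(\<lambda>b. gauss_dens (card S) mu Sig (to_vec S b)) \<in> borel_measurable (PiM S (\<lambda>_. lborel))"
proof -
  have P: "minv Sig = Q * diagm (card S) (\<lambda>i. 1 / e i) * transpose_mat Q"
    by (rule minv_spectral_form[OF sp]) (rule e)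
  have Pc: "minv Sig \<in> carrier_mat (card S) (card S)"
    unfolding P by (rule spectral_form_carrier(2)[OF spectral_form_change[OF sp]])
  have eq: "gauss_dens (card S) mu Sig (to_vec S b) = (2 * pi) powr (- real (card S) / 2) * det Sig powr (- 1 / 2) *
     exp (- qform (card S) (\<lambda>i j. minv Sig $$ (i,j)) (\<lambda>k. b (col_ix S k) - vec_index mu k) / 2)" for b
  proof -
    have v: "to_vec S b - mu \<in> carrier_vec (card S)" using mu by simp
    have "qform (card S) (\<lambda>i j. minv Sig $$ (i,j)) (vec_index (to_vec S b - mu))
        = qform (card S) (\<lambda>i j. minv Sig $$ (i,j)) (\<lambda>k. b (col_ix S k) - vec_index mu k)"
      by (rule qform_cong) (use mu in \<open>auto simp: to_vec_def\<close>)
    then show ?thesis unfolding gauss_dens_def scalar_prod_mult_qform[OF Pc v] by simp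
  qed
  have m: "(\<lambda>b. b (col_ix S k)) \<in> borel_measurable (PiM S (\<lambda>_. lborel :: real measure))" if "k < card S" for k
    using measurable_component_singleton[OF col_ix_in[OF S that], of "\<lambda>_. lborel :: real measure"] by simp
  have "(\<lambda>b. qform (card S) (\<lambda>i j. minv Sig $$ (i,j)) (\<lambda>k. b (col_ix S k) - vec_index mu k))
      \<in> borel_measurable (PiM S (\<lambda>_. lborel))"
    unfolding qform_def
    by (intro borel_measurable_sum borel_measurable_times borel_measurable_diff borel_measurable_const m) auto
  then show ?thesis unfolding eq by simp
qed

lemma lik_ratio_measurable:
  assumes "sigma2 > 0"
  shows "(\<lambda>b. (lik n p X sigma2 Y (extend S b) / lik n p X sigma2 Y b0) powr alpha)
     \<in> borel_measurable (PiM S (\<lambda>_. lborel))"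
proof -
  have [measurable]: "(\<lambda>b. extend S b j) \<in> borel_measurable (PiM S (\<lambda>_. lborel :: real measure))" for j
  proof (cases "j \<in> S")
    case True
    then show ?thesis
      using measurable_component_singleton[OF True, of "\<lambda>_. lborel :: real measure"] by (simp add: extend_def)
  qed (simp add: extend_def)
  show ?thesis unfolding lik_ratio_powr[OF assms] by measurable
qed

lemma prior_beta_nonneg: "prior_beta n X sigma2 g l phi Y S b \<ge> 0"
  by (simp add: prior_beta_def gauss_dens_def)

context
  fixes n :: nat and X :: "nat \<Rightarrow> nat \<Rightarrow> real" and sigma2 g l phi :: real and S :: "nat set"
    and Q :: "real mat" and d :: "nat \<Rightarrow> real"
  assumes s: "sigma2 > 0" and g: "g > 0" and S: "finite S" "S \<noteq> {}"
    and sp: "spectral_form (card S) (gram n X S) Q d" and d: "\<And>i. i < card S \<Longrightarrow> d i > 0"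
begin

lemma prior_scale_pos: "sigma2 * g * kS n X l S > 0"
proof -
  have "card S > 0" using S by (simp add: card_gt_0_iff)
  then show ?thesis using kS_pos[OF sp d] s g by simp
qed

lemma prior_beta_measurable:
  "prior_beta n X sigma2 g l phi Y S \<in> borel_measurable (PiM S (\<lambda>_. lborel))"
proof -
  have "mat_powr (gram n X S) l = Q * diagm (card S) (\<lambda>i. d i powr l) * transpose_mat Q"
    by (rule mat_powr_spectral_form[OF sp]) (rule d)
  then have "spectral_form (card S) ((sigma2 * g * kS n X l S) \<cdot>\<^sub>m mat_powr (gram n X S) l) Q
      (\<lambda>i. sigma2 * g * kS n X l S * d i powr l)"
    by (simp only:) (intro smult_spectral_form spectral_form_change[OF sp])
  then show ?thesis
    unfolding prior_beta_def
  proof (rule gauss_dens_measurable[OF S(1)])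
    fix i assume "i < card S"
    then show "sigma2 * g * kS n X l S * d i powr l \<noteq> 0"
      using prior_scale_pos d by force
  qed (auto intro!: smult_carrier_vec beta_hat_carrier[OF sp d])
qed

lemma nn_integral_prior_beta:
  assumes "\<theta> \<ge> 0"
  shows "(\<integral>\<^sup>+ b. ennreal (prior_beta n X sigma2 g l phi Y S b *
      exp (- \<theta> * qform (card S) (\<lambda>k l. gram n X S $$ (k,l)) (vec_index (to_vec S b - phi \<cdot>\<^sub>v beta_hat n X S Y))))
        \<partial>(PiM S (\<lambda>_. lborel)))
    = ennreal (\<Prod>i<card S. (1 + 2 * \<theta> * (sigma2 * g * kS n X l S) * d i powr (l + 1)) powr (- 1 / 2))"
  unfolding prior_beta_def
  by (rule nn_integral_gauss_dens[OF S(1) sp d prior_scale_pos assms])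
     (auto intro!: smult_carrier_vec beta_hat_carrier[OF sp d])

lemma prior_beta_integral:
  "integrable (PiM S (\<lambda>_. lborel)) (prior_beta n X sigma2 g l phi Y S)"
  "(\<integral>b. prior_beta n X sigma2 g l phi Y S b \<partial>(PiM S (\<lambda>_. lborel))) = 1"
proof -
  have "(\<integral>\<^sup>+ b. ennreal (prior_beta n X sigma2 g l phi Y S b) \<partial>(PiM S (\<lambda>_. lborel))) = ennreal 1"
    using nn_integral_prior_beta[of 0] by simp
  then show "integrable (PiM S (\<lambda>_. lborel)) (prior_beta n X sigma2 g l phi Y S)"
    "(\<integral>b. prior_beta n X sigma2 g l phi Y S b \<partial>(PiM S (\<lambda>_. lborel))) = 1"
    using integrableI_nn_integral_finite[OF prior_beta_measurable, of Y 1]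
      integral_eq_nn_integral[OF prior_beta_measurable, of Y] prior_beta_nonneg by auto
qed

end

lemma supp_extend: "supp (extend S b) \<subseteq> S"
  by (auto simp: supp_def extend_def)

lemma posterior_term_upper:
  assumes s: "sigma2 > 0" and g: "g > 0" and al: "alpha > 0"
    and S: "S \<subseteq> {..<p}" "S \<noteq> {}" and w: "cfg_weight n p X l C r S \<noteq> 0"
    and b0: "supp b0 \<subseteq> {..<p}" and on: "orthonormal n k u" and span: "in_span n X (S \<union> supp b0) k u"
  shows "(\<integral>b. indicator A (extend S b) *
              (lik n p X sigma2 Y (extend S b) / lik n p X sigma2 Y b0) powr alpha *
              prior_beta n X sigma2 g l phi Y S b \<partial>(PiM S (\<lambda>_. lborel)))
     \<le> exp (alpha / (2 * sigma2) * proj_sq n k u (\<lambda>i. Y i - (\<Sum>j<p. X i j * b0 j)))"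
proof -
  have fS: "finite S" using S(1) finite_subset by blast
  obtain Q d where sp: "spectral_form (card S) (gram n X S) Q d" and d: "\<And>i. i < card S \<Longrightarrow> d i > 0"
    using cfg_weight_spectral[OF w fS S(2)] by blast
  note I = prior_beta_integral[OF s g fS S(2) sp d]
  let ?E = "exp (alpha / (2 * sigma2) * proj_sq n k u (\<lambda>i. Y i - (\<Sum>j<p. X i j * b0 j)))"
  have "(\<integral>b. indicator A (extend S b) *
              (lik n p X sigma2 Y (extend S b) / lik n p X sigma2 Y b0) powr alpha *
              prior_beta n X sigma2 g l phi Y S b \<partial>(PiM S (\<lambda>_. lborel)))
     \<le> (\<integral>b. ?E * prior_beta n X sigma2 g l phi Y S b \<partial>(PiM S (\<lambda>_. lborel)))"
  \<comment> \<open>Only the larger function has to be integrable: a non-integrable left side has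
    Bochner integral 0, and the right side is nonnegative. Hence \<open>A\<close> can be any
    set.\<close>
  proof (rule integral_mono')
    show "integrable (PiM S (\<lambda>_. lborel)) (\<lambda>b. ?E * prior_beta n X sigma2 g l phi Y S b)"
      using I(1) by simp
    fix b
    have "(lik n p X sigma2 Y (extend S b) / lik n p X sigma2 Y b0) powr alpha \<le> ?E"
    proof (rule lik_ratio_upper[OF s al on span])
      show "supp (extend S b) \<subseteq> S \<union> supp b0" using supp_extend[of S b] by blast
    qed (use S b0 in auto)
    then have "indicator A (extend S b) * (lik n p X sigma2 Y (extend S b) / lik n p X sigma2 Y b0) powr alpha \<le> ?E"
      by (auto simp: indicator_def)
    then show "indicator A (extend S b) *
              (lik n p X sigma2 Y (extend S b) / lik n p X sigma2 Y b0) powr alpha *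
              prior_beta n X sigma2 g l phi Y S b \<le> ?E * prior_beta n X sigma2 g l phi Y S b"
      by (rule mult_right_mono[OF _ prior_beta_nonneg])
    show "0 \<le> ?E * prior_beta n X sigma2 g l phi Y S b"
      by (intro mult_nonneg_nonneg prior_beta_nonneg) auto
  qed
  also have "\<dots> = ?E" using I(2) by simp
  finally show ?thesis .
qed

text \<open>The support of \<open>extend S b\<close> lies inside \<open>S\<close>, so configurations
  smaller than \<open>t\<close> contribute nothing; positivity of \<open>t\<close> excludes the
  empty one.\<close>

lemma post_num_upper:
  assumes s: "sigma2 > 0" and g: "g > 0" and al: "alpha > 0" and b0: "supp b0 \<subseteq> {..<p}" and t: "t > 0"
    and on: "\<And>S. S \<subseteq> {..<p} \<Longrightarrow> orthonormal n (k S) (u S)"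
    and span: "\<And>S. S \<subseteq> {..<p} \<Longrightarrow> in_span n X (S \<union> supp b0) (k S) (u S)"
  shows "post_num n p R X sigma2 g l alpha a c C r phi b0 {b. real (card (supp b)) \<ge> t} Y
    \<le> (\<Sum>S | S \<subseteq> {..<p} \<and> card S \<le> R \<and> real (card S) \<ge> t. prior_S n p R X l a c C r S *
          exp (alpha / (2 * sigma2) * proj_sq n (k S) (u S) (\<lambda>i. Y i - (\<Sum>j<p. X i j * b0 j))))"
proof -
  let ?A = "{b. real (card (supp b)) \<ge> t}"
  let ?I = "\<lambda>S. (\<integral>b. indicator ?A (extend S b) *
              (lik n p X sigma2 Y (extend S b) / lik n p X sigma2 Y b0) powr alpha *
              prior_beta n X sigma2 g l phi Y S b \<partial>(PiM S (\<lambda>_. lborel)))"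
  have fin: "finite {S. S \<subseteq> {..<p} \<and> card S \<le> R}"
    by (rule finite_subset[of _ "Pow {..<p}"]) auto
  have "post_num n p R X sigma2 g l alpha a c C r phi b0 ?A Y
      = (\<Sum>S | S \<subseteq> {..<p} \<and> card S \<le> R. prior_S n p R X l a c C r S * ?I S)"
    by (simp add: post_num_def)
  also have "\<dots> = (\<Sum>S | S \<subseteq> {..<p} \<and> card S \<le> R \<and> real (card S) \<ge> t. prior_S n p R X l a c C r S * ?I S)"
  proof (rule sum.mono_neutral_right[OF fin], goal_cases)
    case 2
    show ?case
    proof
      fix S assume "S \<in> {S. S \<subseteq> {..<p} \<and> card S \<le> R} - {S. S \<subseteq> {..<p} \<and> card S \<le> R \<and> real (card S) \<ge> t}"
      then have S: "S \<subseteq> {..<p}" "real (card S) < t" by auto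
      then have fS: "finite S" using finite_subset by blast
      have "extend S b \<notin> ?A" for b
        using card_mono[OF fS supp_extend[of S b]] S(2) by auto
      then show "prior_S n p R X l a c C r S * ?I S = 0" by (simp add: indicator_def)
    qed
  qed auto
  also have "\<dots> \<le> (\<Sum>S | S \<subseteq> {..<p} \<and> card S \<le> R \<and> real (card S) \<ge> t. prior_S n p R X l a c C r S *
          exp (alpha / (2 * sigma2) * proj_sq n (k S) (u S) (\<lambda>i. Y i - (\<Sum>j<p. X i j * b0 j))))"
  proof (rule sum_mono)
    fix S assume "S \<in> {S. S \<subseteq> {..<p} \<and> card S \<le> R \<and> real (card S) \<ge> t}"
    then have S: "S \<subseteq> {..<p}" "S \<noteq> {}" using t by auto
    show "prior_S n p R X l a c C r S * ?I S \<le> prior_S n p R X l a c C r S *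
          exp (alpha / (2 * sigma2) * proj_sq n (k S) (u S) (\<lambda>i. Y i - (\<Sum>j<p. X i j * b0 j)))"
    \<comment> \<open>A configuration of weight zero may have a singular Gram matrix, for which
      \<open>prior_beta\<close> is not a density; its prior mass is zero, which removes the
      term.\<close>
    proof (cases "cfg_weight n p X l C r S = 0")
      case True
      then show ?thesis by (simp add: prior_S_def)
    next
      case False
      show ?thesis
        by (rule mult_left_mono[OF posterior_term_upper[OF s g al S False b0 on[OF S(1)] span[OF S(1)]] prior_S_nonneg])
    qed
  qed
  finally show ?thesis .
qed

text \<open>All summands are nonnegative, so the one of the true support is kept alone. The Gaussian
  integral over it has one factor per eigenvalue, each bounded below through
  \<open>kS_bound\<close>.\<close>

lemma post_num_lower:
  fixes Y :: "nat \<Rightarrow> real"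
  assumes s: "sigma2 > 0" and g: "g > 0" and al: "alpha > 0" and b0: "supp b0 \<subseteq> {..<p}"
    and ne: "supp b0 \<noteq> {}" and cR: "card (supp b0) \<le> R"
    and sp: "spectral_form (card (supp b0)) (gram n X (supp b0)) Q d" and lo: "lo > 0"
    and d: "\<And>i. i < card (supp b0) \<Longrightarrow> lo \<le> d i \<and> d i \<le> hi"
  defines "v \<equiv> lin_pred X (supp b0) (vec_index (beta_hat n X (supp b0) Y))"
  shows "prior_S n p R X l a c C r (supp b0) *
      (exp (- (alpha / sigma2) * (1 - phi)\<^sup>2 * dotp n v v) *
       (1 + 2 * alpha * g * (hi / lo) powr \<bar>l + 1\<bar>) powr (- real (card (supp b0)) / 2))
    \<le> post_num n p R X sigma2 g l alpha a c C r phi b0 UNIV Y"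
proof -
  define S where "S = supp b0"
  have S: "S \<subseteq> {..<p}" "S \<noteq> {}" "finite S" using b0 ne finite_subset by (auto simp: S_def)
  note sp = sp[folded S_def]
  have dl: "lo \<le> d i \<and> d i \<le> hi" if "i < card S" for i using d that by (simp add: S_def)
  have dp: "d i > 0" if "i < card S" for i using dl[OF that] lo by linarith
  let ?I = "\<lambda>S. (\<integral>b. indicator UNIV (extend S b) *
              (lik n p X sigma2 Y (extend S b) / lik n p X sigma2 Y b0) powr alpha *
              prior_beta n X sigma2 g l phi Y S b \<partial>(PiM S (\<lambda>_. lborel)))"
  let ?ratio = "\<lambda>b. (lik n p X sigma2 Y (extend S b) / lik n p X sigma2 Y b0) powr alpha"
  let ?pb = "\<lambda>b. prior_beta n X sigma2 g l phi Y S b"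
  let ?q = "\<lambda>b. qform (card S) (\<lambda>k l. gram n X S $$ (k,l)) (vec_index (to_vec S b - phi \<cdot>\<^sub>v beta_hat n X S Y))"
  let ?V = "exp (- (alpha / sigma2) * (1 - phi)\<^sup>2 * dotp n v v)"
  let ?M = "1 + 2 * alpha * g * (hi / lo) powr \<bar>l + 1\<bar>"
  have fin: "finite {S. S \<subseteq> {..<p} \<and> card S \<le> R}"
    by (rule finite_subset[of _ "Pow {..<p}"]) auto
  have "(\<lambda>b. ?ratio b * ?pb b) \<in> borel_measurable (PiM S (\<lambda>_. lborel))"
    by (intro borel_measurable_times lik_ratio_measurable[OF s] prior_beta_measurable[OF s g S(3,2) sp dp])
  \<comment> \<open>A lower bound on a Bochner integral requires integrability, since otherwise the
    integral is 0 by convention. It comes from the upper bound on the likelihood ratio, here with a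
    basis for the true support only.\<close>
  obtain k u where on: "orthonormal n k u" and span: "in_span n X S k u"
    using orthonormal_basis_span[OF S(3), of n X] unfolding in_span_def by metis
  have meas: "?pb \<in> borel_measurable (PiM S (\<lambda>_. lborel))"
    "(\<lambda>b. exp (- (alpha / sigma2) * ?q b)) \<in> borel_measurable (PiM S (\<lambda>_. lborel))"
  proof -
    show "?pb \<in> borel_measurable (PiM S (\<lambda>_. lborel))"
      by (rule prior_beta_measurable[OF s g S(3,2) sp dp])
    have c: "(\<lambda>b. b (col_ix S k)) \<in> borel_measurable (PiM S (\<lambda>_. lborel :: real measure))" if "k < card S" for k
      using measurable_component_singleton[OF col_ix_in[OF S(3) that], of "\<lambda>_. lborel :: real measure"] by simp
    have bh: "beta_hat n X S Y \<in> carrier_vec (card S)" by (rule beta_hat_carrier[OF sp dp])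
    have "?q b = qform (card S) (\<lambda>k l. gram n X S $$ (k,l)) (\<lambda>k. b (col_ix S k) - phi * vec_index (beta_hat n X S Y) k)" for b
      by (rule qform_cong) (use bh in \<open>auto simp: to_vec_def\<close>)
    moreover have "(\<lambda>b. qform (card S) (\<lambda>k l. gram n X S $$ (k,l)) (\<lambda>k. b (col_ix S k) - phi * vec_index (beta_hat n X S Y) k))
      \<in> borel_measurable (PiM S (\<lambda>_. lborel))"
      unfolding qform_def
      by (intro borel_measurable_sum borel_measurable_times borel_measurable_diff borel_measurable_const c) auto
    ultimately show "(\<lambda>b. exp (- (alpha / sigma2) * ?q b)) \<in> borel_measurable (PiM S (\<lambda>_. lborel))"
      by simp
  qed
  let ?E = "exp (alpha / (2 * sigma2) * proj_sq n k u (\<lambda>i. Y i - (\<Sum>j<p. X i j * b0 j)))"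
  have up: "?ratio b \<le> ?E" for b
    by (rule lik_ratio_upper[OF s al on span S(1) supp_extend]) (simp add: S_def)
  have int: "integrable (PiM S (\<lambda>_. lborel)) (\<lambda>b. ?ratio b * ?pb b)"
  proof (rule Bochner_Integration.integrable_bound)
    show "integrable (PiM S (\<lambda>_. lborel)) (\<lambda>b. ?E * ?pb b)"
      using prior_beta_integral(1)[OF s g S(3,2) sp dp] by simp
    show "AE b in PiM S (\<lambda>_. lborel). norm (?ratio b * ?pb b) \<le> norm (?E * ?pb b)"
      using up prior_beta_nonneg by (auto simp: abs_mult intro!: mult_right_mono)
  qed fact
  have "ennreal (?V * ?M powr (- real (card S) / 2)) \<le> ennreal (?I S)"
  proof -
    have "?M powr (- real (card S) / 2) = (\<Prod>i<card S. ?M powr (- 1 / 2))"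
    proof -
      have "?M > 0" using al g by (intro add_pos_nonneg) auto
      then show ?thesis by (simp add: powr_realpow[symmetric] powr_powr)
    qed
    then have "ennreal (?M powr (- real (card S) / 2)) = ennreal (\<Prod>i<card S. ?M powr (- 1 / 2))"
      by (rule arg_cong)
    \<comment> \<open>The rate \<open>alpha / sigma2\<close> meets the prior scale
      \<open>sigma2 * g * kS n X l S\<close>; \<open>sigma2\<close> cancels, which leaves
      \<open>2 * alpha * g\<close> in the base of the bound.\<close>
    also have "\<dots> \<le> ennreal (\<Prod>i<card S. (1 + 2 * (alpha / sigma2) * (sigma2 * g * kS n X l S) * d i powr (l + 1)) powr (- 1 / 2))"
    proof (intro ennreal_leI prod_mono conjI)
      fix i assume "i \<in> {..<card S}"
      then have i: "i < card S" by simp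
      have kp: "kS n X l S > 0" by (rule kS_pos[OF sp dp]) (use i in auto)
      have e: "2 * (alpha / sigma2) * (sigma2 * g * kS n X l S) * d i powr (l + 1)
          = 2 * alpha * g * (kS n X l S * d i powr (l + 1))" using s by simp
      have "1 + 2 * (alpha / sigma2) * (sigma2 * g * kS n X l S) * d i powr (l + 1) \<le> ?M"
        unfolding e using kS_bound[OF sp lo dl i, of l] al g by (intro add_left_mono mult_left_mono) auto
      moreover have "1 + 2 * (alpha / sigma2) * (sigma2 * g * kS n X l S) * d i powr (l + 1) > 0"
        unfolding e using kp al g by (intro add_pos_nonneg) auto
      ultimately show "?M powr (- 1 / 2) \<le> (1 + 2 * (alpha / sigma2) * (sigma2 * g * kS n X l S) * d i powr (l + 1)) powr (- 1 / 2)"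
        by (intro powr_mono2') auto
    qed auto
    also have "\<dots> = (\<integral>\<^sup>+ b. ennreal (?pb b * exp (- (alpha / sigma2) * ?q b)) \<partial>(PiM S (\<lambda>_. lborel)))"
    proof (rule nn_integral_prior_beta[symmetric])
      show "spectral_form (card S) (gram n X S) Q d" by (rule sp)
      show "i < card S \<Longrightarrow> 0 < d i" for i by (rule dp)
    qed (use al s g S in auto)
    finally have h: "ennreal (?M powr (- real (card S) / 2))
        \<le> (\<integral>\<^sup>+ b. ennreal (?pb b * exp (- (alpha / sigma2) * ?q b)) \<partial>(PiM S (\<lambda>_. lborel)))" .
    have "ennreal (?V * ?M powr (- real (card S) / 2)) = ennreal ?V * ennreal (?M powr (- real (card S) / 2))"
      by (rule ennreal_mult) auto
    also have "\<dots> \<le> ennreal ?V * (\<integral>\<^sup>+ b. ennreal (?pb b * exp (- (alpha / sigma2) * ?q b)) \<partial>(PiM S (\<lambda>_. lborel)))"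
      by (rule mult_left_mono[OF h]) simp
    also have "\<dots> = (\<integral>\<^sup>+ b. ennreal ?V * ennreal (?pb b * exp (- (alpha / sigma2) * ?q b)) \<partial>(PiM S (\<lambda>_. lborel)))"
      by (rule nn_integral_cmult[symmetric], intro measurable_compose[OF _ measurable_ennreal] borel_measurable_times meas)
    also have "\<dots> \<le> (\<integral>\<^sup>+ b. ennreal (?ratio b * ?pb b) \<partial>(PiM S (\<lambda>_. lborel)))"
    proof (rule nn_integral_mono)
      fix b
      have "?V * exp (- (alpha / sigma2) * ?q b) \<le> ?ratio b"
        unfolding v_def using lik_ratio_lower[OF s al S(1) _ sp dp, of b0 phi Y b] by (simp add: S_def)
      then have "?pb b * (?V * exp (- (alpha / sigma2) * ?q b)) \<le> ?pb b * ?ratio b"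
        by (rule mult_left_mono[OF _ prior_beta_nonneg])
      then have "?V * (?pb b * exp (- (alpha / sigma2) * ?q b)) \<le> ?ratio b * ?pb b"
        by (simp only: mult_ac)
      then show "ennreal ?V * ennreal (?pb b * exp (- (alpha / sigma2) * ?q b)) \<le> ennreal (?ratio b * ?pb b)"
        by (subst ennreal_mult[symmetric]) (auto intro!: ennreal_leI mult_nonneg_nonneg prior_beta_nonneg)
    qed
    also have "\<dots> = ennreal (\<integral>b. ?ratio b * ?pb b \<partial>(PiM S (\<lambda>_. lborel)))"
      by (rule nn_integral_eq_integral[OF int]) (auto intro!: mult_nonneg_nonneg prior_beta_nonneg)
    also have "(\<integral>b. ?ratio b * ?pb b \<partial>(PiM S (\<lambda>_. lborel))) = ?I S" by simp
    finally show ?thesis .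
  qed
  then have "?V * ?M powr (- real (card S) / 2) \<le> ?I S"
    by (subst (asm) ennreal_le_iff) (auto intro!: Bochner_Integration.integral_nonneg mult_nonneg_nonneg prior_beta_nonneg)
  then have "prior_S n p R X l a c C r S * (?V * ?M powr (- real (card S) / 2)) \<le> prior_S n p R X l a c C r S * ?I S"
    by (rule mult_left_mono[OF _ prior_S_nonneg])
  also have "\<dots> \<le> (\<Sum>S | S \<subseteq> {..<p} \<and> card S \<le> R. prior_S n p R X l a c C r S * ?I S)"
  proof (rule member_le_sum[OF _ _ fin])
    show "S \<in> {S. S \<subseteq> {..<p} \<and> card S \<le> R}" using S cR by (simp add: S_def)
    show "0 \<le> prior_S n p R X l a c C r S' * ?I S'" for S'
      by (intro mult_nonneg_nonneg prior_S_nonneg Bochner_Integration.integral_nonneg prior_beta_nonneg) auto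
  qed
  finally show ?thesis by (simp add: post_num_def S_def)
qed

section \<open>Expected posterior mass\<close>

lemma proj_sq_nonneg: "proj_sq n k u x \<ge> 0"
  by (simp add: proj_sq_def sum_nonneg)

lemma exp_proj_sq_integral:
  fixes p :: nat and b0 :: "nat \<Rightarrow> real" and X :: "nat \<Rightarrow> nat \<Rightarrow> real"
  assumes on: "orthonormal n k u" and q: "0 \<le> q" "q < 1" and s: "sigma2 > 0"
  defines "h \<equiv> (\<lambda>Y. exp (q / (2 * sigma2) * proj_sq n k u (\<lambda>i. Y i - (\<Sum>j<p. X i j * b0 j))))"
  shows "integrable (data_measure n p X sigma2 b0) h"
    "(\<integral>Y. h Y \<partial>data_measure n p X sigma2 b0) = (1 - q) powr (- real k / 2)"
proof -
  have meas: "h \<in> borel_measurable (data_measure n p X sigma2 b0)"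
    unfolding h_def proj_sq_def dotp_def data_measure_def by measurable
  have sq: "(sqrt sigma2)\<^sup>2 = sigma2" "sqrt sigma2 > 0" using s by auto
  have nn: "(\<integral>\<^sup>+ Y. ennreal (h Y) \<partial>data_measure n p X sigma2 b0) = ennreal ((1 - q) powr (- real k / 2))"
    unfolding h_def data_measure_def
    using nn_integral_exp_proj_sq[OF on q sq(2), of "\<lambda>i. \<Sum>j<p. X i j * b0 j"] by (simp only: sq(1))
  show "integrable (data_measure n p X sigma2 b0) h"
    by (rule integrableI_nn_integral_finite[OF meas _ nn]) (simp add: h_def)
  have "(\<integral>Y. h Y \<partial>data_measure n p X sigma2 b0) = enn2real (\<integral>\<^sup>+ Y. ennreal (h Y) \<partial>data_measure n p X sigma2 b0)"
    by (rule integral_eq_nn_integral[OF meas]) (simp add: h_def)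
  then show "(\<integral>Y. h Y \<partial>data_measure n p X sigma2 b0) = (1 - q) powr (- real k / 2)"
    unfolding nn by simp
qed

lemma posterior_nonneg: "posterior n p R X sigma2 g l alpha a c C r phi b0 A Y \<ge> 0"
  unfolding posterior_def post_num_def
  by (intro divide_nonneg_nonneg sum_nonneg mult_nonneg_nonneg Bochner_Integration.integral_nonneg prior_S_nonneg prior_beta_nonneg) auto

text \<open>The quotient is bounded pointwise in Y before integration. The denominator costs
  \<open>(alpha / sigma2) * (1 - phi)\<^sup>2\<close> times the squared length of the fit; by
  \<open>fitted_norm_bound\<close> this splits into a signal part, covered by \<open>K\<close>, and
  a noise part, which raises the factor of the projected noise from \<open>alpha\<close> to
  \<open>alpha * (1 + 4 * (1 - phi)\<^sup>2)\<close>. The moment is finite since this is at most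
  \<open>q < 1\<close>.\<close>

lemma posterior_expectation:
  fixes n p R :: nat
  assumes s: "sigma2 > 0" and g: "g > 0" and al: "alpha > 0" and b0: "supp b0 \<subseteq> {..<p}"
    and ne: "supp b0 \<noteq> {}" and cR: "card (supp b0) \<le> R"
    and sp: "spectral_form (card (supp b0)) (gram n X (supp b0)) Q d" and lo: "lo > 0"
    and d: "\<And>i. i < card (supp b0) \<Longrightarrow> lo \<le> d i \<and> d i \<le> hi"
    and t: "t > 0" and q: "alpha * (1 + 4 * (1 - phi)\<^sup>2) \<le> q" "q < 1"
    and pr: "prior_S n p R X l a c C r (supp b0) > 0"
    and K: "2 * alpha / sigma2 * (1 - phi)\<^sup>2 * (\<Sum>i<n. (\<Sum>j<p. X i j * b0 j)\<^sup>2) \<le> K * real (card (supp b0))"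
  defines "s0 \<equiv> card (supp b0)" and "M \<equiv> 1 + 2 * alpha * g * (hi / lo) powr \<bar>l + 1\<bar>"
  shows "(\<integral>Y. posterior n p R X sigma2 g l alpha a c C r phi b0 {b. real (card (supp b)) \<ge> t} Y
             \<partial>data_measure n p X sigma2 b0)
     \<le> (\<Sum>S | S \<subseteq> {..<p} \<and> card S \<le> R \<and> real (card S) \<ge> t.
          prior_S n p R X l a c C r S / prior_S n p R X l a c C r (supp b0) * (M powr (real s0 / 2) * exp (K * real s0)) *
            (1 - q) powr (- real (card S + s0) / 2))"
proof -
  define T where "T = supp b0"
  have T: "T \<subseteq> {..<p}" "finite T" "card T = s0" using b0 finite_subset by (auto simp: T_def s0_def)
  have dp: "d i > 0" if "i < card T" for i using d[of i] lo that by (force simp: T_def)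
  \<comment> \<open>One basis for each \<open>S\<close> joined with the true support serves
    numerator and denominator alike.\<close>
  have "\<exists>k u. k \<le> card S + s0 \<and> orthonormal n k u \<and> in_span n X (S \<union> supp b0) k u" if S: "S \<subseteq> {..<p}" for S
  proof -
    have "finite (S \<union> T)" using S T finite_subset by blast
    then obtain k u where "k \<le> card (S \<union> T)" "orthonormal n k u" "in_span n X (S \<union> T) k u"
      using orthonormal_basis_span[of "S \<union> T" n X] unfolding in_span_def by metis
    moreover have "card (S \<union> T) \<le> card S + s0" using card_Un_le[of S T] T by simp
    ultimately show ?thesis unfolding T_def by (meson order_trans)
  qed
  then obtain k u where ku: "\<And>S. S \<subseteq> {..<p} \<Longrightarrow> k S \<le> card S + s0"
    and on: "\<And>S. S \<subseteq> {..<p} \<Longrightarrow> orthonormal n (k S) (u S)"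
    and span: "\<And>S. S \<subseteq> {..<p} \<Longrightarrow> in_span n X (S \<union> supp b0) (k S) (u S)"
    by metis
  define e0 where "e0 i = (\<Sum>j<p. X i j * b0 j)" for i
  define P where "P S = prior_S n p R X l a c C r S" for S
  define F where "F = {S. S \<subseteq> {..<p} \<and> card S \<le> R \<and> real (card S) \<ge> t}"
  have F: "S \<subseteq> {..<p}" if "S \<in> F" for S using that by (simp add: F_def)
  define pq where "pq S Y = proj_sq n (k S) (u S) (\<lambda>i. Y i - e0 i)" for S Y
  define B where "B = M powr (real s0 / 2) * exp (K * real s0)"
  define H where "H Y = (\<Sum>S\<in>F. P S / P T * B * exp (q / (2 * sigma2) * pq S Y))" for Y
  have q0: "q \<ge> 0" using q(1) al by (smt (verit) mult_nonneg_nonneg zero_le_power2)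
  have PT: "P T > 0" using pr by (simp add: P_def T_def)
  have Pn: "P S \<ge> 0" for S by (simp add: P_def prior_S_nonneg)
  have Mp: "M > 0" unfolding M_def using al g by (intro add_pos_nonneg) auto
  have le: "posterior n p R X sigma2 g l alpha a c C r phi b0 {b. real (card (supp b)) \<ge> t} Y \<le> H Y" for Y
  proof -
    define v where "v = lin_pred X T (vec_index (beta_hat n X T Y))"
    define L where "L = P T * (exp (- (alpha / sigma2) * (1 - phi)\<^sup>2 * dotp n v v) * M powr (- real s0 / 2))"
    have L: "L > 0" using PT Mp by (simp add: L_def)
    have D: "L \<le> post_num n p R X sigma2 g l alpha a c C r phi b0 UNIV Y"
      unfolding L_def P_def v_def T_def M_def s0_def
      by (rule post_num_lower[OF s g al b0 ne cR sp lo d])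
    have N: "post_num n p R X sigma2 g l alpha a c C r phi b0 {b. real (card (supp b)) \<ge> t} Y
        \<le> (\<Sum>S\<in>F. P S * exp (alpha / (2 * sigma2) * pq S Y))"
      unfolding F_def P_def pq_def e0_def by (rule post_num_upper[OF s g al b0 t on span])
    have "posterior n p R X sigma2 g l alpha a c C r phi b0 {b. real (card (supp b)) \<ge> t} Y
        \<le> (\<Sum>S\<in>F. P S * exp (alpha / (2 * sigma2) * pq S Y)) / L"
      unfolding posterior_def
      by (rule frac_le[OF _ N L D]) (auto intro!: sum_nonneg mult_nonneg_nonneg Pn)
    also have "\<dots> = (\<Sum>S\<in>F. P S / P T * (M powr (real s0 / 2) *
        exp (alpha / (2 * sigma2) * pq S Y + (alpha / sigma2) * (1 - phi)\<^sup>2 * dotp n v v)))"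
      unfolding sum_divide_distrib
    proof (rule sum.cong[OF refl])
      fix S
      show "P S * exp (alpha / (2 * sigma2) * pq S Y) / L = P S / P T * (M powr (real s0 / 2) *
        exp (alpha / (2 * sigma2) * pq S Y + (alpha / sigma2) * (1 - phi)\<^sup>2 * dotp n v v))"
        unfolding L_def exp_add using Mp PT by (simp add: exp_minus powr_minus field_simps)
    qed
    also have "\<dots> \<le> H Y"
      unfolding H_def
    proof (rule sum_mono)
      fix S assume S: "S \<in> F"
      have fST: "finite (S \<union> supp b0)" using finite_subset[OF F[OF S]] T by (simp add: T_def)
      have vv: "dotp n v v \<le> 2 * dotp n e0 e0 + 2 * pq S Y"
        unfolding v_def pq_def
        by (rule fitted_norm_bound[OF _ _ T(2) _ _ on[OF F[OF S]] span[OF F[OF S]]])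
           (use sp dp T fST in \<open>auto simp: T_def\<close>)
      have "(alpha / sigma2) * (1 - phi)\<^sup>2 * dotp n v v \<le> (alpha / sigma2) * (1 - phi)\<^sup>2 * (2 * dotp n e0 e0 + 2 * pq S Y)"
        using al s by (intro mult_left_mono[OF vv]) auto
      also have "\<dots> = 2 * alpha / sigma2 * (1 - phi)\<^sup>2 * dotp n e0 e0 + alpha * (4 * (1 - phi)\<^sup>2) / (2 * sigma2) * pq S Y"
        using s by (simp add: field_simps)
      also have "2 * alpha / sigma2 * (1 - phi)\<^sup>2 * dotp n e0 e0 \<le> K * real s0"
        using K by (simp add: dotp_def e0_def s0_def power2_eq_square)
      finally have 1: "alpha / (2 * sigma2) * pq S Y + (alpha / sigma2) * (1 - phi)\<^sup>2 * dotp n v v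
          \<le> K * real s0 + (alpha * (1 + 4 * (1 - phi)\<^sup>2)) / (2 * sigma2) * pq S Y"
        by (simp add: distrib_left distrib_right add_divide_distrib)
      have "(alpha * (1 + 4 * (1 - phi)\<^sup>2)) / (2 * sigma2) * pq S Y \<le> q / (2 * sigma2) * pq S Y"
        using q(1) s by (intro mult_right_mono divide_right_mono) (auto simp: pq_def proj_sq_nonneg)
      with 1 have "exp (alpha / (2 * sigma2) * pq S Y + (alpha / sigma2) * (1 - phi)\<^sup>2 * dotp n v v)
          \<le> exp (K * real s0) * exp (q / (2 * sigma2) * pq S Y)"
        unfolding exp_add[symmetric] by simp
      then have "P S / P T * (M powr (real s0 / 2) *
        exp (alpha / (2 * sigma2) * pq S Y + (alpha / sigma2) * (1 - phi)\<^sup>2 * dotp n v v))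
        \<le> P S / P T * (M powr (real s0 / 2) * (exp (K * real s0) * exp (q / (2 * sigma2) * pq S Y)))"
        using Pn PT by (intro mult_left_mono) (auto intro: less_imp_le)
      then show "P S / P T * (M powr (real s0 / 2) *
        exp (alpha / (2 * sigma2) * pq S Y + (alpha / sigma2) * (1 - phi)\<^sup>2 * dotp n v v))
        \<le> P S / P T * B * exp (q / (2 * sigma2) * pq S Y)"
        by (simp only: B_def mult.assoc)
    qed
    finally show ?thesis .
  qed
  note I = exp_proj_sq_integral[OF on q0 q(2) s, of _ p X b0, folded e0_def, folded pq_def]
  have iH: "integrable (data_measure n p X sigma2 b0) H"
    unfolding H_def by (intro Bochner_Integration.integrable_sum integrable_mult_right I(1) F)
  \<comment> \<open>The dominating \<open>H\<close> is integrable and nonnegative, so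
    \<open>integral_mono'\<close> yields the bound from the pointwise inequality alone.\<close>
  have "(\<integral>Y. posterior n p R X sigma2 g l alpha a c C r phi b0 {b. real (card (supp b)) \<ge> t} Y
             \<partial>data_measure n p X sigma2 b0) \<le> (\<integral>Y. H Y \<partial>data_measure n p X sigma2 b0)"
    by (rule integral_mono'[OF iH le order_trans[OF posterior_nonneg le]])
  also have "\<dots> = (\<Sum>S\<in>F. P S / P T * B * (1 - q) powr (- real (k S) / 2))"
  proof -
    have "(\<integral>Y. H Y \<partial>data_measure n p X sigma2 b0)
        = (\<Sum>S\<in>F. \<integral>Y. P S / P T * B * exp (q / (2 * sigma2) * pq S Y) \<partial>data_measure n p X sigma2 b0)"
      unfolding H_def by (intro Bochner_Integration.integral_sum integrable_mult_right I(1) F)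
    also have "\<dots> = (\<Sum>S\<in>F. P S / P T * B * (1 - q) powr (- real (k S) / 2))"
      by (intro sum.cong refl) (simp only: integral_mult_right_zero I(2)[OF F])
    finally show ?thesis .
  qed
  also have "\<dots> \<le> (\<Sum>S\<in>F. P S / P T * B * (1 - q) powr (- real (card S + s0) / 2))"
  proof (rule sum_mono)
    fix S assume S: "S \<in> F"
    have "(1 - q) powr (- real (k S) / 2) \<le> (1 - q) powr (- real (card S + s0) / 2)"
      using ku[OF F[OF S]] q(2) q0 by (intro powr_mono') auto
    then show "P S / P T * B * (1 - q) powr (- real (k S) / 2) \<le> P S / P T * B * (1 - q) powr (- real (card S + s0) / 2)"
      using Pn PT by (intro mult_left_mono) (auto simp: B_def intro: less_imp_le)
  qed
  finally show ?thesis unfolding F_def P_def B_def T_def .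
qed

section \<open>Prior mass of a size and of the true support\<close>

lemma finite_configs: "finite {S. S \<subseteq> {..<p :: nat} \<and> Pr S}"
  by (rule finite_subset[of _ "Pow {..<p}"]) auto

text \<open>Only an inequality: if all configurations of size \<open>j\<close> have weight zero, the
  normaliser is 0 and every quotient is 0.\<close>

lemma prior_S_size_sum:
  "(\<Sum>S | S \<subseteq> {..<p} \<and> card S = j. prior_S n p R X l a c C r S) \<le> f_size p R a c j"
proof -
  let ?Z = "\<Sum>S | S \<subseteq> {..<p} \<and> card S = j. cfg_weight n p X l C r S"
  have "(\<Sum>S | S \<subseteq> {..<p} \<and> card S = j. prior_S n p R X l a c C r S)
      = (\<Sum>S | S \<subseteq> {..<p} \<and> card S = j. f_size p R a c j * (cfg_weight n p X l C r S / ?Z))"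
    by (intro sum.cong) (auto simp: prior_S_def)
  also have "\<dots> = f_size p R a c j * (?Z / ?Z)"
    by (simp only: sum_distrib_left[symmetric] sum_divide_distrib[symmetric])
  also have "\<dots> \<le> f_size p R a c j * 1"
    by (intro mult_left_mono f_size_nonneg) simp
  finally show ?thesis by simp
qed

lemma prior_S_weighted_sum:
  assumes w: "w \<ge> 0"
  shows "(\<Sum>S | S \<subseteq> {..<p} \<and> card S \<le> R \<and> real (card S) \<ge> t. prior_S n p R X l a c C r S * w ^ card S)
    \<le> (\<Sum>j | j \<le> R \<and> real j \<ge> t. f_size p R a c j * w ^ j)"
proof -
  let ?A = "{S. S \<subseteq> {..<p} \<and> card S \<le> R \<and> real (card S) \<ge> t}" and ?J = "{j. j \<le> R \<and> real j \<ge> t}"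
  have fJ: "finite ?J" by (rule finite_subset[of _ "{..R}"]) auto
  have "(\<Sum>S\<in>?A. prior_S n p R X l a c C r S * w ^ card S)
      = (\<Sum>j\<in>?J. \<Sum>S | S \<in> ?A \<and> card S = j. prior_S n p R X l a c C r S * w ^ card S)"
    by (rule sum.group[symmetric, OF finite_configs fJ]) auto
  also have "\<dots> \<le> (\<Sum>j\<in>?J. f_size p R a c j * w ^ j)"
  proof (rule sum_mono)
    fix j assume j: "j \<in> ?J"
    then have "{S. S \<in> ?A \<and> card S = j} = {S. S \<subseteq> {..<p} \<and> card S = j}" by auto
    then have "(\<Sum>S | S \<in> ?A \<and> card S = j. prior_S n p R X l a c C r S * w ^ card S)
        = (\<Sum>S | S \<subseteq> {..<p} \<and> card S = j. prior_S n p R X l a c C r S) * w ^ j"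
      by (simp add: sum_distrib_right)
    also have "\<dots> \<le> f_size p R a c j * w ^ j"
      using w by (intro mult_right_mono prior_S_size_sum) auto
    finally show "(\<Sum>S | S \<in> ?A \<and> card S = j. prior_S n p R X l a c C r S * w ^ card S) \<le> f_size p R a c j * w ^ j" .
  qed
  finally show ?thesis .
qed

lemma Dg_bounds:
  assumes sp: "spectral_form (card S) (gram n X S) Q d" and lo: "lo > 0"
    and d: "\<And>i. i < card S \<Longrightarrow> lo \<le> d i \<and> d i \<le> hi"
  shows "lo ^ card S \<le> Dg n X S" "Dg n X S \<le> hi ^ card S"
proof -
  have D: "Dg n X S = (\<Prod>i<card S. d i)" unfolding Dg_def by (rule det_spectral_form[OF sp])
  have "(\<Prod>i<card S. lo) \<le> (\<Prod>i<card S. d i)" using d lo by (intro prod_mono) auto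
  then show "lo ^ card S \<le> Dg n X S" by (simp add: D)
  have "(\<Prod>i<card S. d i) \<le> (\<Prod>i<card S. hi)" using d lo by (intro prod_mono) (force intro: order_trans less_imp_le)
  then show "Dg n X S \<le> hi ^ card S" by (simp add: D)
qed

text \<open>Determinants of size m differ by at most a factor \<open>(hi / lo) ^ m\<close>, and the
  exponent \<open>l / (2 * m)\<close> removes the power m. So weights of equal size are comparable
  up to \<open>(hi / lo) powr (\<bar>l\<bar> / 2)\<close>, and at most \<open>p ^ m\<close>
  configurations share the mass. The assumption \<open>big\<close> lets \<open>S0\<close> pass the
  truncation on the condition number.\<close>

lemma prior_S_lower:
  assumes S0: "S0 \<subseteq> {..<p}" "S0 \<noteq> {}"
    and lo: "lo > 0" "lo \<le> hi"
    and sp: "\<And>S. S \<subseteq> {..<p} \<Longrightarrow> card S = card S0 \<Longrightarrow>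
        \<exists>Q d. spectral_form (card S) (gram n X S) Q d \<and> (\<forall>i<card S. lo \<le> d i \<and> d i \<le> hi)"
    and big: "hi / lo < C * real p powr r"
  shows "f_size p R a c (card S0) / (real p ^ card S0 * (hi / lo) powr (\<bar>l\<bar> / 2)) \<le> prior_S n p R X l a c C r S0"
proof -
  define m where "m = card S0"
  have fS0: "finite S0" using S0 finite_subset by blast
  have m: "m > 0" using S0 fS0 by (simp add: m_def card_gt_0_iff)
  have hi: "hi > 0" using lo by linarith
  have p: "p > 0" using S0 by auto
  let ?A = "{S. S \<subseteq> {..<p} \<and> card S = m}"
  let ?K = "(hi / lo) powr (\<bar>l\<bar> / 2)"
  have Db: "lo ^ m \<le> Dg n X S" "Dg n X S \<le> hi ^ m" if "S \<in> ?A" for S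
    using that sp[of S] Dg_bounds[OF _ lo(1), of S n X _ _ hi] by (force simp: m_def)+
  have Dp: "Dg n X S > 0" if "S \<in> ?A" for S
    using Db(1)[OF that] lo by (smt (verit) zero_less_power)
  have S0A: "S0 \<in> ?A" using S0 by (simp add: m_def)
  let ?W = "Dg n X S0 powr (- l / (2 * real m))"
  have W0: "cfg_weight n p X l C r S0 = ?W"
  proof -
    obtain Q d where Qd: "spectral_form m (gram n X S0) Q d" "\<forall>i<m. lo \<le> d i \<and> d i \<le> hi"
      using sp[of S0] S0 by (auto simp: m_def)
    obtain i j where ij: "i < m" "lam_min (gram n X S0) = d i" "j < m" "lam_max (gram n X S0) = d j"
      using lam_spectral(3,4)[OF Qd(1) m] by auto
    have mn: "lam_min (gram n X S0) \<ge> lo" "lam_max (gram n X S0) \<le> hi" using ij Qd(2) by auto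
    have "lam_max (gram n X S0) / lam_min (gram n X S0) \<le> hi / lo"
      using mn lo hi by (intro frac_le) auto
    then have "cond_num n X S0 < ereal (C * real p powr r)"
      using mn lo big S0 by (auto simp: cond_num_def)
    then show ?thesis by (simp add: cfg_weight_def m_def)
  qed
  have Wp: "?W > 0" using Dp[OF S0A] by simp
  have up: "cfg_weight n p X l C r S \<le> ?K * ?W" if S: "S \<in> ?A" for S
  proof -
    have "cfg_weight n p X l C r S \<le> Dg n X S powr (- l / (2 * real m))"
      using S by (simp add: cfg_weight_def)
    also have "\<dots> = (Dg n X S / Dg n X S0) powr (- l / (2 * real m)) * ?W"
      using Dp[OF S] Dp[OF S0A] by (simp add: powr_divide)
    also have "(Dg n X S / Dg n X S0) powr (- l / (2 * real m)) \<le> ((hi / lo) ^ m) powr \<bar>- l / (2 * real m)\<bar>"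
    proof (rule powr_ratio_bound)
      show "Dg n X S / Dg n X S0 \<le> (hi / lo) ^ m"
        unfolding power_divide using Db[OF S] Db[OF S0A] Dp[OF S] Dp[OF S0A] lo hi by (intro frac_le) auto
      have "lo ^ m / hi ^ m \<le> Dg n X S / Dg n X S0"
        using Db[OF S] Db[OF S0A] Dp[OF S] Dp[OF S0A] lo hi by (intro frac_le) auto
      then show "1 / (hi / lo) ^ m \<le> Dg n X S / Dg n X S0" by (simp add: power_divide)
    qed (use lo hi in auto)
    also have "((hi / lo) ^ m) powr \<bar>- l / (2 * real m)\<bar> = ?K"
      using lo hi m by (simp add: powr_realpow[symmetric] powr_powr abs_divide abs_mult)
    finally show ?thesis using Wp by (simp add: mult_right_mono)
  qed
  have fA: "finite ?A" by (rule finite_configs)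
  have cA: "real (card ?A) \<le> real p ^ m"
  proof -
    have "card ?A = p choose m" using n_subsets[of "{..<p}" m] by simp
    moreover have "m \<le> p" using card_mono[OF _ S0(1)] by (simp add: m_def)
    ultimately show ?thesis using binomial_le_pow[of m p] by (simp flip: of_nat_power)
  qed
  have Z: "(\<Sum>S\<in>?A. cfg_weight n p X l C r S) \<le> real p ^ m * ?K * ?W"
  proof -
    have "(\<Sum>S\<in>?A. cfg_weight n p X l C r S) \<le> real (card ?A) * (?K * ?W)"
      using up by (rule sum_bounded_above)
    also have "\<dots> \<le> real p ^ m * (?K * ?W)"
      using cA Wp by (intro mult_right_mono) auto
    finally show ?thesis by (simp add: mult.assoc)
  qed
  have Zp: "(\<Sum>S\<in>?A. cfg_weight n p X l C r S) > 0"
    by (rule sum_pos2[OF fA S0A]) (use Wp W0 cfg_weight_nonneg in auto)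
  have "1 / (real p ^ m * ?K) = ?W / (real p ^ m * ?K * ?W)" using Wp by simp
  also have "\<dots> \<le> ?W / (\<Sum>S\<in>?A. cfg_weight n p X l C r S)"
    by (rule divide_left_mono[OF Z]) (use Wp Zp p lo hi in auto)
  finally have "f_size p R a c m * (1 / (real p ^ m * ?K)) \<le> f_size p R a c m * (?W / (\<Sum>S\<in>?A. cfg_weight n p X l C r S))"
    by (rule mult_left_mono[OF _ f_size_nonneg])
  then show ?thesis by (simp add: prior_S_def m_def[symmetric] W0)
qed

text \<open>The threshold is real, so the sum starts at its ceiling; replacing the ceiling by
  \<open>t\<close> afterwards only increases a power of \<open>x\<close>.\<close>

lemma geometric_tail:
  fixes x t :: real
  assumes x: "0 < x" "x \<le> 1/2" and t: "t > 0"
  shows "(\<Sum>j | j \<le> R \<and> real j \<ge> t. x ^ j) \<le> 2 * x powr t"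
proof -
  define N where "N = nat \<lceil>t\<rceil>"
  have N: "real N \<ge> t" using t by (simp add: N_def)
  have sub: "{j. j \<le> R \<and> real j \<ge> t} \<subseteq> {N..R}" by (auto simp: N_def nat_le_iff ceiling_le_iff)
  have "(\<Sum>j | j \<le> R \<and> real j \<ge> t. x ^ j) \<le> (\<Sum>j\<in>{N..R}. x ^ j)"
    using sub x by (intro sum_mono2) auto
  also have "\<dots> \<le> 2 * x ^ N"
  proof (cases "N \<le> R")
    case True
    then have "(\<Sum>j\<in>{N..R}. x ^ j) = (x ^ N - x ^ Suc R) / (1 - x)"
      using x by (simp add: sum_gp)
    also have "\<dots> \<le> x ^ N / (1 - x)" using x by (intro divide_right_mono) auto
    also have "\<dots> \<le> x ^ N / (1/2)" using x by (intro divide_left_mono) auto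
    finally show ?thesis by simp
  qed (use x in auto)
  also have "x ^ N = x powr real N" using x by (simp add: powr_realpow)
  also have "\<dots> \<le> x powr t" using x N by (intro powr_mono') auto
  finally show ?thesis by simp
qed

section \<open>Asymptotics\<close>

lemma f_size_eq:
  assumes "j \<le> R" "c > 0" "p > 0"
  shows "f_size p R a c j = (1 / (c * real p powr a)) ^ j / (\<Sum>t\<le>R. c powr (- real t) * real p powr (- a * real t))"
proof -
  have "c powr (- real j) * real p powr (- a * real j) = (1 / (c * real p powr a)) ^ j"
    using assms(2,3) by (simp add: powr_realpow[symmetric] powr_divide powr_mult powr_powr powr_minus_divide)
  then show ?thesis using assms(1) by (simp add: f_size_def)
qed

text \<open>The sizes form a geometric series of ratio \<open>x\<close>: a factor
  \<open>1 / (c * real p powr a)\<close> from the prior times \<open>w\<close>, the cost in moments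
  of one more column. The normaliser of \<open>f_size\<close> occurs in the mass of the true support
  as well and cancels. All other factors except the ratio of weights are powers with exponent
  \<open>card (supp b0)\<close>, so the limit depends on a single base.\<close>

lemma posterior_expectation_geometric:
  fixes n p R :: nat and rho l a :: real
  assumes s: "sigma2 > 0" and g: "g > 0" and al: "alpha > 0" and b0: "supp b0 \<subseteq> {..<p}"
    and ne: "supp b0 \<noteq> {}" and cR: "card (supp b0) \<le> R" and c: "c > 0"
    and lo: "lo > 0" "lo \<le> hi"
    and sp: "\<And>S. S \<subseteq> {..<p} \<Longrightarrow> card S = card (supp b0) \<Longrightarrow>
        \<exists>Q d. spectral_form (card S) (gram n X S) Q d \<and> (\<forall>i<card S. lo \<le> d i \<and> d i \<le> hi)"
    and big: "hi / lo < C * real p powr r"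
    and q: "alpha * (1 + 4 * (1 - phi)\<^sup>2) \<le> q" "q < 1"
    and K: "2 * alpha / sigma2 * (1 - phi)\<^sup>2 * (\<Sum>i<n. (\<Sum>j<p. X i j * b0 j)\<^sup>2) \<le> K * real (card (supp b0))"
    and rho: "rho > 0"
  defines "M \<equiv> 1 + 2 * alpha * g * (hi / lo) powr \<bar>l + 1\<bar>" and "w \<equiv> (1 - q) powr (- 1 / 2)"
  defines "x \<equiv> w / (c * real p powr a)"
  assumes x: "x \<le> 1 / 2"
  shows "(\<integral>Y. posterior n p R X sigma2 g l alpha a c C r phi b0 {b. real (card (supp b)) \<ge> rho * real (card (supp b0))} Y
             \<partial>data_measure n p X sigma2 b0)
     \<le> 2 * (hi / lo) powr (\<bar>l\<bar> / 2) *
        (x powr rho * (c * real p powr a) * real p * M powr (1 / 2) * w * exp K) ^ card (supp b0)"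
proof -
  define s0 where "s0 = card (supp b0)"
  have fin: "finite (supp b0)" using b0 finite_subset by blast
  have s0: "s0 > 0" using ne fin by (simp add: s0_def card_gt_0_iff)
  have p: "p > 0" using ne b0 by auto
  have hi: "hi > 0" using lo by linarith
  have w: "w > 0" using q(2) by (simp add: w_def)
  have Mp: "M > 0" unfolding M_def using al g by (intro add_pos_nonneg) auto
  define y where "y = 1 / (c * real p powr a)"
  have y: "y > 0" using c p by (simp add: y_def)
  have xy: "x = y * w" by (simp add: x_def y_def)
  have xp: "x > 0" using y w by (simp add: xy)
  define Z where "Z = (\<Sum>t\<le>R. c powr (- real t) * real p powr (- a * real t))"
  have Z: "Z > 0" unfolding Z_def by (rule sum_pos) (use c p in auto)
  have f: "f_size p R a c j = y ^ j / Z" if "j \<le> R" for j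
    unfolding y_def Z_def by (rule f_size_eq[OF that c p])
  define k where "k = (hi / lo) powr (\<bar>l\<bar> / 2)"
  have k: "k > 0" using lo hi by (simp add: k_def)
  define P0 where "P0 = prior_S n p R X l a c C r (supp b0)"
  have P0: "y ^ s0 / Z / (real p ^ s0 * k) \<le> P0"
    using prior_S_lower[OF b0 ne lo sp big, of R a c l] f[OF cR] by (simp add: P0_def s0_def k_def)
  have P0l: "y ^ s0 / Z / (real p ^ s0 * k) > 0" using y Z p k by simp
  then have P0p: "P0 > 0" using P0 by linarith
  define B where "B = M powr (real s0 / 2) * exp (K * real s0)"
  have B: "B > 0" using Mp by (simp add: B_def)
  obtain Q d where Qd: "spectral_form (card (supp b0)) (gram n X (supp b0)) Q d"
    and d: "\<And>i. i < card (supp b0) \<Longrightarrow> lo \<le> d i \<and> d i \<le> hi"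
    using sp[OF b0 refl] by blast
  have tp: "rho * real (card (supp b0)) > 0" using rho s0 by (simp add: s0_def)
  let ?A = "{S. S \<subseteq> {..<p} \<and> card S \<le> R \<and> real (card S) \<ge> rho * real s0}"
  let ?J = "{j. j \<le> R \<and> real j \<ge> rho * real s0}"
  have "(\<integral>Y. posterior n p R X sigma2 g l alpha a c C r phi b0 {b. real (card (supp b)) \<ge> rho * real (card (supp b0))} Y
             \<partial>data_measure n p X sigma2 b0)
     \<le> (\<Sum>S\<in>?A. prior_S n p R X l a c C r S / P0 * B * (1 - q) powr (- real (card S + s0) / 2))"
    unfolding P0_def B_def s0_def M_def
    by (rule posterior_expectation[OF s g al b0 ne cR Qd lo(1) d tp q P0p[unfolded P0_def] K])
  also have "\<dots> = B * w ^ s0 / P0 * (\<Sum>S\<in>?A. prior_S n p R X l a c C r S * w ^ card S)"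
    unfolding sum_distrib_left
  proof (rule sum.cong[OF refl])
    fix S :: "nat set"
    have "(1 - q) powr (- real (card S + s0) / 2) = w ^ card S * w ^ s0"
      using q(2) unfolding w_def power_add[symmetric]
      by (simp add: powr_realpow[symmetric] powr_powr del: of_nat_add)
    then show "prior_S n p R X l a c C r S / P0 * B * (1 - q) powr (- real (card S + s0) / 2)
        = B * w ^ s0 / P0 * (prior_S n p R X l a c C r S * w ^ card S)" by simp
  qed
  also have "\<dots> \<le> B * w ^ s0 / P0 * (\<Sum>j\<in>?J. f_size p R a c j * w ^ j)"
    by (rule mult_left_mono[OF prior_S_weighted_sum]) (use B w P0p in auto)
  also have "(\<Sum>j\<in>?J. f_size p R a c j * w ^ j) = (\<Sum>j\<in>?J. x ^ j) / Z"
    unfolding sum_divide_distrib by (intro sum.cong refl) (simp add: f xy power_mult_distrib)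
  also have "B * w ^ s0 / P0 * ((\<Sum>j\<in>?J. x ^ j) / Z) \<le> B * w ^ s0 / P0 * ((2 * x powr (rho * real s0)) / Z)"
    by (intro mult_left_mono divide_right_mono geometric_tail[OF xp x]) (use B w P0p Z rho s0 in auto)
  also have "\<dots> \<le> B * w ^ s0 / (y ^ s0 / Z / (real p ^ s0 * k)) * ((2 * x powr (rho * real s0)) / Z)"
    by (intro mult_right_mono divide_left_mono[OF P0 _ mult_pos_pos[OF P0p P0l]]) (use B w Z in auto)
  also have "\<dots> = 2 * k * (x powr (rho * real s0) * (1 / y) ^ s0 * real p ^ s0 * B * w ^ s0)"
    using Z y by (simp add: power_divide field_simps)
  also have "x powr (rho * real s0) * (1 / y) ^ s0 * real p ^ s0 * B * w ^ s0
      = (x powr rho * (1 / y) * real p * M powr (1 / 2) * w * exp K) ^ s0"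
  proof -
    have "x powr (rho * real s0) = (x powr rho) ^ s0" using xp by (simp add: powr_realpow[symmetric] powr_powr)
    moreover have "M powr (real s0 / 2) = (M powr (1 / 2)) ^ s0" using Mp by (simp add: powr_realpow[symmetric] powr_powr)
    moreover have "exp (K * real s0) = exp K ^ s0" by (simp add: exp_of_nat_mult[symmetric] mult.commute)
    ultimately show ?thesis by (simp only: B_def power_mult_distrib mult_ac)
  qed
  also have "1 / y = c * real p powr a" by (simp add: y_def)
  finally show ?thesis by (simp only: k_def s0_def)
qed

lemma spectral_form_scaled_bounds:
  assumes n: "n > 0" and m: "card S > 0" and lo: "lo \<le> lam_min ((1 / real n) \<cdot>\<^sub>m gram n X S)"
    and hi: "lam_max ((1 / real n) \<cdot>\<^sub>m gram n X S) \<le> hi"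
  shows "\<exists>Q d. spectral_form (card S) (gram n X S) Q d \<and> (\<forall>i<card S. real n * lo \<le> d i \<and> d i \<le> real n * hi)"
proof -
  obtain Q d where sp: "spectral_form (card S) (gram n X S) Q d" using gram_spectral by blast
  have sp': "spectral_form (card S) ((1 / real n) \<cdot>\<^sub>m gram n X S) Q (\<lambda>i. 1 / real n * d i)"
    by (rule smult_spectral_form[OF sp])
  have "real n * lo \<le> d i \<and> d i \<le> real n * hi" if i: "i < card S" for i
  proof -
    have "lo \<le> 1 / real n * d i" "1 / real n * d i \<le> hi"
      using lam_spectral(1,2)[OF sp' m i] lo hi by linarith+
    then show ?thesis using n by (simp add: field_simps)
  qed
  then show ?thesis using sp by blast
qed

lemma ell_uu_bounds:
  assumes "S \<subseteq> {..<p}" "card S = s"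
  shows "ell n p X s \<le> lam_min ((1 / real n) \<cdot>\<^sub>m gram n X S)"
    "lam_max ((1 / real n) \<cdot>\<^sub>m gram n X S) \<le> uu n p X s"
proof -
  have "finite {S. S \<subseteq> {..<p} \<and> card S = s}" by (rule finite_configs)
  then show "ell n p X s \<le> lam_min ((1 / real n) \<cdot>\<^sub>m gram n X S)"
    "lam_max ((1 / real n) \<cdot>\<^sub>m gram n X S) \<le> uu n p X s"
    unfolding ell_def uu_def using assms by (auto intro!: Min_le Max_ge)
qed

lemma signal_energy_bound:
  assumes S: "supp b \<subseteq> S" "S \<subseteq> {..<p}"
    and sp: "spectral_form (card S) (gram n X S) Q d" and d: "\<And>i. i < card S \<Longrightarrow> d i \<le> hi"
  shows "(\<Sum>i<n. (\<Sum>j<p. X i j * b j)\<^sup>2) \<le> hi * (\<Sum>j<p. (b j)\<^sup>2)"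
proof -
  have fS: "finite S" using S finite_subset by blast
  let ?x = "vec_index (to_vec S b)"
  have "(\<Sum>i<n. (\<Sum>j<p. X i j * b j)\<^sup>2) = qform (card S) (\<lambda>k l. gram n X S $$ (k,l)) ?x"
    by (simp add: qform_gram sum_supp[OF S] lin_pred_to_vec[OF fS])
  also have "\<dots> \<le> (\<Sum>a<card S. hi * (\<Sum>i<card S. Q $$ (i,a) * ?x i)\<^sup>2)"
    unfolding qform_spectral_form[OF sp] by (intro sum_mono mult_right_mono) (use d in auto)
  also have "\<dots> = hi * (\<Sum>k<card S. (?x k)\<^sup>2)"
    by (simp only: sum_distrib_left[symmetric] spectral_form_norm[OF sp])
  also have "(\<Sum>k<card S. (?x k)\<^sup>2) = (\<Sum>k<card S. (b (col_ix S k))\<^sup>2)"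
    by (intro sum.cong) (auto simp: to_vec_def)
  also have "\<dots> = (\<Sum>j\<in>S. (b j)\<^sup>2)" by (rule sum_col_ix[OF fS])
  also have "\<dots> = (\<Sum>j<p. (b j)\<^sup>2)"
    using S by (intro sum.mono_neutral_left) (auto simp: supp_def)
  finally show ?thesis .
qed

text \<open>The supremum over the truth is rendered by an arbitrary admissible sequence
  \<open>bstar\<close>: convergence along each one includes sequences that nearly attain the
  supremum for every n.\<close>

theorem theorem2:
  fixes p s :: "nat \<Rightarrow> nat"
    and X :: "nat \<Rightarrow> nat \<Rightarrow> nat \<Rightarrow> real"
    and phi :: "nat \<Rightarrow> real"
    and bstar :: "nat \<Rightarrow> nat \<Rightarrow> real"
    and sigma2 g l alpha a c C r rho :: real
  defines "R \<equiv> (\<lambda>n. design_rank n (p n) (X n))"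
  defines "rho0 \<equiv> (a + 1) / (a - r * max (1 + l) (max 1 (- l)))"
  assumes sigma2: "sigma2 > 0" and g: "g > 0" and alpha: "0 < alpha" "alpha < 1"
    and pos: "a > 0" "c > 0" "C > 0" "r > 0"
    and phi: "\<And>n. 0 < phi n \<and> phi n < 1"
    and sizes: "\<And>n. s n \<le> R n \<and> R n \<le> n"
    and n_ll_p: "(\<lambda>n. real n / real (p n)) \<longlonglongrightarrow> 0"
    and a_big: "a > r * max (1 + l) (max 1 (- l))"
    and rho: "rho > rho0"
    and sparse: "\<And>n. supp (bstar n) \<subseteq> {..<p n} \<and> card (supp (bstar n)) = s n"
    and A1: "(\<lambda>n. real (s n) / real n) \<longlonglongrightarrow> 0"
    and A2a: "(\<lambda>n. real (s n) / (real n * sqrt (\<Sum>j<p n. (bstar n j)\<^sup>2))) \<longlonglongrightarrow> 0"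
    and A2b: "(\<lambda>n. 1 - phi n) \<in> O(\<lambda>n. real (s n) / (real n * sqrt (\<Sum>j<p n. (bstar n j)\<^sup>2)))"
    and A3: "0 < liminf (\<lambda>n. ereal (ell n (p n) (X n) (s n)))"
            "liminf (\<lambda>n. ereal (ell n (p n) (X n) (s n))) < limsup (\<lambda>n. ereal (uu n (p n) (X n) (s n)))"
            "limsup (\<lambda>n. ereal (uu n (p n) (X n) (s n))) < \<infinity>"
  shows "(\<lambda>n. \<integral>Y. posterior n (p n) (R n) (X n) sigma2 g l alpha a c C r (phi n) (bstar n)
                   {b. real (card (supp b)) \<ge> rho * real (s n)} Y
                 \<partial>data_measure n (p n) (X n) sigma2 (bstar n)) \<longlonglongrightarrow> 0"
proof -
  define N where "N n = sqrt (\<Sum>j<p n. (bstar n j)\<^sup>2)" for n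
  define E where "E n = (\<integral>Y. posterior n (p n) (R n) (X n) sigma2 g l alpha a c C r (phi n) (bstar n)
                   {b. real (card (supp b)) \<ge> rho * real (s n)} Y
                 \<partial>data_measure n (p n) (X n) sigma2 (bstar n))" for n
  \<comment> \<open>The maximum is at least 1 and \<open>r\<close> is positive, so the denominator
    of \<open>rho0\<close> lies strictly between 0 and \<open>a\<close>; hence \<open>rho0\<close>
    exceeds \<open>(a + 1) / a\<close>.\<close>
  have arho: "a * rho > a + 1"
  proof -
    let ?D = "a - r * max (1 + l) (max 1 (- l))"
    have "r * max (1 + l) (max 1 (- l)) > 0" using pos by simp
    then have "?D > 0" "?D < a" using a_big by auto
    then have "(a + 1) / a < (a + 1) / ?D" using pos by (intro divide_strict_left_mono) auto
    then have "(a + 1) / a < rho" using rho by (simp add: rho0_def)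
    then show ?thesis using pos by (simp add: field_simps)
  qed
  have rho_pos: "rho > 0"
  proof -
    have "a * rho > 0" using arho pos by linarith
    then show ?thesis using pos by (simp add: zero_less_mult_iff)
  qed
  obtain lo where lo: "lo > 0" and ev_lo: "eventually (\<lambda>n. ell n (p n) (X n) (s n) > lo) sequentially"
  proof -
    obtain z where z: "0 < z" "z < liminf (\<lambda>n. ereal (ell n (p n) (X n) (s n)))"
      using dense[OF A3(1)] by blast
    have "eventually (\<lambda>n. z < ereal (ell n (p n) (X n) (s n))) sequentially"
      using z(2) by (rule less_LiminfD)
    moreover obtain l0 where "z = ereal l0"
      using z by (cases z) auto
    ultimately show ?thesis using that[of l0] z by auto
  qed
  obtain hi where hi: "hi \<ge> lo" and ev_hi: "eventually (\<lambda>n. uu n (p n) (X n) (s n) < hi) sequentially"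
  proof -
    obtain z where z: "limsup (\<lambda>n. ereal (uu n (p n) (X n) (s n))) < z" "z < \<infinity>"
      using dense[OF A3(3)] by blast
    have "eventually (\<lambda>n. ereal (uu n (p n) (X n) (s n)) < z) sequentially"
      using z(1) by (rule Limsup_lessD)
    \<comment> \<open>The maximum with \<open>lo\<close> gives \<open>hi \<ge> lo\<close> at once,
      without comparing \<open>ell\<close> and \<open>uu\<close>.\<close>
    then have "eventually (\<lambda>n. uu n (p n) (X n) (s n) < max lo (real_of_ereal z)) sequentially"
      by eventually_elim (use z in \<open>cases z; auto\<close>)
    then show ?thesis using that[of "max lo (real_of_ereal z)"] by simp
  qed
  obtain K1 where K1: "K1 > 0"
    and ev_phi: "eventually (\<lambda>n. norm (1 - phi n) \<le> K1 * norm (real (s n) / (real n * N n))) sequentially"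
    using landau_o.bigE[OF A2b] unfolding N_def by blast
  \<comment> \<open>If s n, n or the norm of bstar n vanished, the bound (A2) would read 1 - phi n \<le> 0.\<close>
  have ev_pos: "eventually (\<lambda>n. s n > 0 \<and> n > 0 \<and> N n \<noteq> 0 \<and> 1 - phi n \<le> K1 * (real (s n) / (real n * N n))) sequentially"
    using ev_phi
  proof eventually_elim
    case (elim n)
    have "N n \<ge> 0" unfolding N_def by (intro real_sqrt_ge_zero sum_nonneg) simp
    then have "1 - phi n \<le> K1 * (real (s n) / (real n * N n))" using elim phi[of n] by simp
    moreover from this have "real (s n) / (real n * N n) \<noteq> 0" using phi[of n] by (metis diff_gt_0_iff_gt mult_zero_right not_le)
    ultimately show ?case by auto
  qed
  have phi_lim: "(\<lambda>n. 1 - phi n) \<longlonglongrightarrow> 0"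
  proof (rule tendsto_sandwich[OF _ _ tendsto_const])
    show "eventually (\<lambda>n. 0 \<le> 1 - phi n) sequentially" using phi by (intro always_eventually allI) (simp add: less_imp_le)
    show "eventually (\<lambda>n. 1 - phi n \<le> K1 * (real (s n) / (real n * N n))) sequentially"
      using ev_pos by eventually_elim simp
    show "(\<lambda>n. K1 * (real (s n) / (real n * N n))) \<longlonglongrightarrow> 0"
      using tendsto_mult[OF tendsto_const A2a, of K1] by (simp add: N_def)
  qed
  \<comment> \<open>A fixed number strictly between \<open>alpha\<close> and 1: as
    \<open>phi n\<close> tends to 1 the inflated factor eventually stays below it, and
    \<open>w\<close> below does not depend on n.\<close>
  define q where "q = (1 + alpha) / 2"
  have q: "q < 1" "alpha < q" using alpha by (auto simp: q_def)
  have ev_q: "eventually (\<lambda>n. alpha * (1 + 4 * (1 - phi n)\<^sup>2) \<le> q) sequentially"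
  proof -
    have "(\<lambda>n. alpha * (1 + 4 * (1 - phi n)\<^sup>2)) \<longlonglongrightarrow> alpha * (1 + 4 * 0\<^sup>2)"
      by (intro tendsto_intros phi_lim)
    then have "eventually (\<lambda>n. alpha * (1 + 4 * (1 - phi n)\<^sup>2) < q) sequentially"
      using q by (intro order_tendstoD(2)) auto
    then show ?thesis by eventually_elim simp
  qed
  have p_top: "filterlim (\<lambda>n. real (p n)) at_top sequentially"
  proof (rule filterlim_at_top_mono[OF filterlim_real_sequentially])
    have "eventually (\<lambda>n. real n / real (p n) < 1) sequentially"
      using n_ll_p by (rule order_tendstoD(2)) simp
    then show "eventually (\<lambda>n. real n \<le> real (p n)) sequentially"
      using ev_pos
    proof eventually_elim
      case (elim n)
      \<comment> \<open>For \<open>p n = 0\<close> the quotient \<open>real n / real (p n)\<close>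
        would be 0 by convention and bound nothing; a nonempty support rules this out.\<close>
      then have "supp (bstar n) \<noteq> {}" using sparse[of n] by auto
      then have "p n > 0" using sparse[of n] by auto
      then show ?case using elim by (simp add: field_simps)
    qed
  qed
  define w where "w = (1 - q) powr (- 1 / 2)"
  have w: "w > 0" using q by (simp add: w_def)
  \<comment> \<open>By (A2), \<open>(1 - phi n)\<^sup>2\<close> is at most
    \<open>K1\<^sup>2 * (s n)\<^sup>2 / (n * N n)\<^sup>2\<close>, while the signal energy is at
    most \<open>n * hi * (N n)\<^sup>2\<close>. The norm cancels, and \<open>s n \<le> n\<close>
    leaves \<open>K1\<^sup>2 * hi * s n\<close>.\<close>
  define K where "K = 2 * alpha / sigma2 * (K1\<^sup>2 * hi)"
  define M where "M = 1 + 2 * alpha * g * (hi / lo) powr \<bar>l + 1\<bar>"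
  define x where "x n = w / (c * real (p n) powr a)" for n
  define B where "B n = x n powr rho * (c * real (p n) powr a) * real (p n) * M powr (1 / 2) * w * exp K" for n
  have p_neg: "(\<lambda>n. real (p n) powr (- e)) \<longlonglongrightarrow> 0" if "e > 0" for e :: real
    by (rule tendsto_neg_powr[OF _ p_top]) (use that in simp)
  have x_lim: "x \<longlonglongrightarrow> 0"
  proof -
    have "x = (\<lambda>n. w / c * real (p n) powr (- a))"
      by (simp add: x_def fun_eq_iff powr_minus divide_inverse)
    then show ?thesis using tendsto_mult[OF tendsto_const p_neg[OF pos(1)], of "w / c"] by simp
  qed
  have ev_x: "eventually (\<lambda>n. x n \<le> 1 / 2) sequentially"
    using order_tendstoD(2)[OF x_lim, of "1/2"] by (auto elim: eventually_mono)
  have ev_p: "eventually (\<lambda>n. real (p n) > 0) sequentially"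
    using p_top by (rule filterlim_at_top_dense[THEN iffD1, rule_format])
  \<comment> \<open>For large n every configuration of the true size, having condition number at
    most \<open>hi / lo\<close>, passes the truncation in the prior.\<close>
  have ev_big: "eventually (\<lambda>n. hi / lo < C * real (p n) powr r) sequentially"
  proof -
    have hl: "hi / lo > 0" using lo hi by simp
    have "eventually (\<lambda>n. real (p n) powr (- r) < C / (hi / lo)) sequentially"
      using p_neg[OF pos(4)] by (rule order_tendstoD(2)) (rule divide_pos_pos[OF pos(3) hl])
    then show ?thesis using ev_p
    proof eventually_elim
      case (elim n)
      have "1 / real (p n) powr r < C / (hi / lo)" using elim by (simp add: powr_minus_divide)
      moreover have "k < C * P" if "P > 0" "k > 0" "1 / P < C / k" for P k :: real
        using that by (simp add: field_simps)
      ultimately show ?case using elim hl by simp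
    qed
  qed
  \<comment> \<open>Counting powers of \<open>p n\<close>: the tail of sizes gives
    \<open>- a * rho\<close>, the prior of the true size \<open>a\<close>, and the number of its
    competitors 1. The total is negative by \<open>arho\<close>.\<close>
  have B_lim: "B \<longlonglongrightarrow> 0"
  proof -
    define k where "k = (w / c) powr rho * c * M powr (1 / 2) * w * exp K"
    have "((\<lambda>n. k * real (p n) powr (- (a * rho - a - 1))) \<longlongrightarrow> k * 0) sequentially"
      using arho by (intro tendsto_intros tendsto_neg_powr[OF _ p_top]) auto
    moreover have "eventually (\<lambda>n. k * real (p n) powr (- (a * rho - a - 1)) = B n) sequentially"
      using ev_p
    proof eventually_elim
      case (elim n)
      have "x n powr rho = (w / c) powr rho * real (p n) powr (- (a * rho))"
        using elim w pos by (simp add: x_def powr_divide powr_mult powr_powr powr_minus field_simps)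
      moreover have "real (p n) powr (- (a * rho - a - 1)) = real (p n) powr (- (a * rho)) * real (p n) powr a * real (p n)"
      proof -
        have "- (a * rho - a - 1) = - (a * rho) + a + 1" by simp
        then show ?thesis using elim by (simp only: powr_add powr_one)
      qed
      ultimately show ?case by (simp add: B_def k_def)
    qed
    ultimately show ?thesis by (simp add: tendsto_cong[of _ B, OF _, symmetric] Lim_transform_eventually)
  qed
  have B_nonneg: "B n \<ge> 0" for n using w pos by (simp add: B_def)
  have bound: "eventually (\<lambda>n. E n \<le> 2 * (hi / lo) powr (\<bar>l\<bar> / 2) * B n) sequentially"
    using ev_lo ev_hi ev_pos ev_q ev_x ev_big order_tendstoD(2)[OF B_lim, of 1, simplified]
  proof eventually_elim
    case (elim n)
    have n: "n > 0" and sn: "s n > 0" and Nn: "N n \<noteq> 0" using elim by auto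
    have hl: "real n * hi / (real n * lo) = hi / lo" using n by simp
    have b0: "supp (bstar n) \<subseteq> {..<p n}" and cs: "card (supp (bstar n)) = s n" using sparse by auto
    have ne: "supp (bstar n) \<noteq> {}" using cs sn by auto
    have sp: "\<exists>Q d. spectral_form (card S) (gram n (X n) S) Q d \<and> (\<forall>i<card S. real n * lo \<le> d i \<and> d i \<le> real n * hi)"
      if "S \<subseteq> {..<p n}" "card S = card (supp (bstar n))" for S
      using ell_uu_bounds[of S "p n" "s n" n "X n"] that cs sn elim
      by (intro spectral_form_scaled_bounds[OF n]) auto
    have KK: "2 * alpha / sigma2 * (1 - phi n)\<^sup>2 * (\<Sum>i<n. (\<Sum>j<p n. X n i j * bstar n j)\<^sup>2) \<le> K * real (card (supp (bstar n)))"
    proof -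
      have hp: "hi > 0" using lo hi by linarith
      have N2: "(\<Sum>j<p n. (bstar n j)\<^sup>2) = (N n)\<^sup>2"
        unfolding N_def by (simp add: sum_nonneg)
      obtain Q d where Qd: "spectral_form (s n) (gram n (X n) (supp (bstar n))) Q d" "\<forall>i<s n. d i \<le> real n * hi"
        using sp[OF b0 refl] cs by auto
      have e: "(\<Sum>i<n. (\<Sum>j<p n. X n i j * bstar n j)\<^sup>2) \<le> real n * hi * (N n)\<^sup>2"
        using signal_energy_bound[OF order.refl b0, of n "X n" Q d "real n * hi"] Qd cs N2 by simp
      have "(1 - phi n)\<^sup>2 \<le> (K1 * (real (s n) / (real n * N n)))\<^sup>2"
        using elim phi[of n] by (intro power_mono) auto
      then have "(1 - phi n)\<^sup>2 * (\<Sum>i<n. (\<Sum>j<p n. X n i j * bstar n j)\<^sup>2)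
          \<le> (K1 * (real (s n) / (real n * N n)))\<^sup>2 * (real n * hi * (N n)\<^sup>2)"
        by (intro mult_mono e) (auto intro!: sum_nonneg)
      also have "\<dots> = K1\<^sup>2 * hi * real (s n) * (real (s n) / real n)"
        using n Nn by (simp add: power_mult_distrib power_divide power2_eq_square)
      also have "\<dots> \<le> K1\<^sup>2 * hi * real (s n) * 1"
        using sizes[of n] n hp by (intro mult_left_mono) auto
      finally have "2 * alpha / sigma2 * ((1 - phi n)\<^sup>2 * (\<Sum>i<n. (\<Sum>j<p n. X n i j * bstar n j)\<^sup>2))
          \<le> 2 * alpha / sigma2 * (K1\<^sup>2 * hi * real (s n))"
        using alpha sigma2 by (intro mult_left_mono) auto
      then show ?thesis by (simp add: K_def cs mult.assoc)
    qed
    have cR: "card (supp (bstar n)) \<le> R n" using sizes[of n] cs by simp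
    have nlo: "real n * lo > 0" "real n * lo \<le> real n * hi" using n lo hi by simp_all
    have big: "real n * hi / (real n * lo) < C * real (p n) powr r" unfolding hl using elim by blast
    have qn: "alpha * (1 + 4 * (1 - phi n)\<^sup>2) \<le> q" using elim by blast
    have xn: "(1 - q) powr (- 1 / 2) / (c * real (p n) powr a) \<le> 1 / 2"
      using elim unfolding x_def w_def by blast
    have "E n \<le> 2 * (hi / lo) powr (\<bar>l\<bar> / 2) * B n ^ s n"
      using posterior_expectation_geometric[OF sigma2 g alpha(1) b0 ne cR pos(2) nlo sp big qn q(1) KK rho_pos xn]
      unfolding E_def B_def x_def w_def M_def hl cs .
    \<comment> \<open>Since \<open>B n < 1\<close> eventually and \<open>s n\<close> is at least 1,
      the same bound covers bounded and growing sparsity.\<close>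
    also have "B n ^ s n \<le> B n ^ 1"
      using B_nonneg[of n] elim sn by (intro power_decreasing) auto
    finally show ?case using lo hi by (simp add: mult_left_mono)
  qed
  have "(\<lambda>n. 2 * (hi / lo) powr (\<bar>l\<bar> / 2) * B n) \<longlonglongrightarrow> 0"
    using tendsto_mult[OF tendsto_const B_lim, of "2 * (hi / lo) powr (\<bar>l\<bar> / 2)"] by simp
  moreover have "eventually (\<lambda>n. 0 \<le> E n) sequentially"
    unfolding E_def by (intro always_eventually allI Bochner_Integration.integral_nonneg posterior_nonneg)
  ultimately have "E \<longlonglongrightarrow> 0"
    using bound by (intro tendsto_sandwich[OF _ bound tendsto_const]) auto
  then show ?thesis by (simp add: E_def[abs_def])
qed

end
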